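(* Let $V_+,V_-\in\mathbb{C}$ be such that $\mathrm{Im}\,V_+\ne\mathrm{Im}\,V_-$, and let $\mathcal{L}$ be the operator on $L^2(\mathbb{R})$ with $\mathrm{Dom}(\mathcal{L})=H^2(\mathbb{R})$, $\mathcal{L}u=-u''+Vu$, where $V(x)=V_+$ for $x\ge0$ and $V(x)=V_-$ for $x<0$. Let $z\in\mathbb{C}$ be such that $\mathrm{Im}\,z\in|(\mathrm{Im}\,V_+,\mathrm{Im}\,V_-)|$. Then $$\|(\mathcal{L}-z)^{-1}\|=\frac{2|\mathrm{Im}\,V_+-\mathrm{Im}\,V_-|}{|V_+-V_-|}\,\frac{\mathrm{Re}\,z}{|\mathrm{Im}\,V_+-\mathrm{Im}\,z|\,|\mathrm{Im}\,V_--\mathrm{Im}\,z|}\left(1+\mathcal{O}\left(\frac{1}{|\mathrm{Re}\,z|}\right)\right)$$ as $\mathrm{Re}\,z\to+\infty$, uniformly for all $\mathrm{Im}\,z\in|(\mathrm{Im}\,V_+,\mathrm{Im}\,V_-)|$.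
   Context: For real $a\ne b$, $|(a,b)|$ denotes the open interval with endpoints $a$ and $b$. The norm is the operator norm on $L^2(\mathbb{R})$. The asymptotic statement means: there are constants $M,C>0$ depending only on $V_+,V_-$ such that for all $z$ with $\mathrm{Re}\,z\ge M$ and $\mathrm{Im}\,z\in|(\mathrm{Im}\,V_+,\mathrm{Im}\,V_-)|$, the left side divided by the explicit leading factor on the right differs from $1$ by at most $C/|\mathrm{Re}\,z|$ in absolute value. *)

theory Defs
  imports "HOL-Analysis.Analysis"
begin

section \<open>The Hilbert space of square-integrable functions on the line\<close>

definition square_integrable :: "(real \<Rightarrow> complex) \<Rightarrow> bool" where
  "square_integrable f \<longleftrightarrow>
     f \<in> borel_measurable lborel \<and> integrable lborel (\<lambda>x. (cmod (f x))\<^sup>2)"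

lemma square_integrable_zero: "square_integrable (\<lambda>x. 0)"
  by (simp add: square_integrable_def)

lemma square_integrable_add:
  assumes "square_integrable f" "square_integrable g"
  shows "square_integrable (\<lambda>x. f x + g x)"
  unfolding square_integrable_def
proof
  have [measurable]: "f \<in> borel_measurable borel" "g \<in> borel_measurable borel"
    using assms by (auto simp: square_integrable_def)
  show "(\<lambda>x. f x + g x) \<in> borel_measurable lborel" by simp
  show "integrable lborel (\<lambda>x. (cmod (f x + g x))\<^sup>2)"
  proof (rule Bochner_Integration.integrable_bound)
    show "integrable lborel (\<lambda>x. 2 * (cmod (f x))\<^sup>2 + 2 * (cmod (g x))\<^sup>2)"
      using assms by (auto simp: square_integrable_def)
    have "(cmod (a + b))\<^sup>2 \<le> 2 * (cmod a)\<^sup>2 + 2 * (cmod b)\<^sup>2" for a b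
    proof -
      have "(cmod (a + b))\<^sup>2 \<le> (cmod a + cmod b)\<^sup>2"
        by (intro power_mono norm_triangle_ineq) auto
      also have "\<dots> \<le> 2 * (cmod a)\<^sup>2 + 2 * (cmod b)\<^sup>2"
        using sum_squares_bound[of "cmod a" "cmod b"] by (simp add: power2_sum)
      finally show ?thesis .
    qed
    then show "AE x in lborel. norm ((cmod (f x + g x))\<^sup>2)
                 \<le> norm (2 * (cmod (f x))\<^sup>2 + 2 * (cmod (g x))\<^sup>2)"
      by simp
  qed simp
qed

lemma square_integrable_cmult:
  assumes "square_integrable f"
  shows "square_integrable (\<lambda>x. c * f x)"
  using assms by (auto simp: square_integrable_def norm_mult power_mult_distrib)

lemma square_integrable_uminus:
  "square_integrable f \<Longrightarrow> square_integrable (\<lambda>x. - f x)"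
  using square_integrable_cmult[of f "-1"] by simp

lemma square_integrable_scaleR:
  "square_integrable f \<Longrightarrow> square_integrable (\<lambda>x. r *\<^sub>R f x)"
  using square_integrable_cmult[of f "of_real r"] by (simp add: scaleR_conv_of_real)

lemma square_integrable_diff:
  "square_integrable f \<Longrightarrow> square_integrable g \<Longrightarrow> square_integrable (\<lambda>x. f x - g x)"
  using square_integrable_add[of f "\<lambda>x. - g x"] square_integrable_uminus[of g] by simp

lemma square_integrable_inner:
  assumes "square_integrable f" "square_integrable g"
  shows "integrable lborel (\<lambda>x. inner (f x) (g x))"
proof (rule Bochner_Integration.integrable_bound)
  have [measurable]: "f \<in> borel_measurable borel" "g \<in> borel_measurable borel"
    using assms by (auto simp: square_integrable_def)
  show "(\<lambda>x. inner (f x) (g x)) \<in> borel_measurable lborel" by simp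
  show "integrable lborel (\<lambda>x. (cmod (f x))\<^sup>2 + (cmod (g x))\<^sup>2)"
    using assms by (auto simp: square_integrable_def)
  have "\<bar>inner a b\<bar> \<le> (cmod a)\<^sup>2 + (cmod b)\<^sup>2" for a b
  proof -
    have "\<bar>inner a b\<bar> \<le> cmod a * cmod b" by (rule Cauchy_Schwarz_ineq2)
    also have "\<dots> \<le> 2 * cmod a * cmod b" by simp
    also have "\<dots> \<le> (cmod a)\<^sup>2 + (cmod b)\<^sup>2" by (rule sum_squares_bound)
    finally show ?thesis .
  qed
  then show "AE x in lborel. norm (inner (f x) (g x))
               \<le> norm ((cmod (f x))\<^sup>2 + (cmod (g x))\<^sup>2)"
    by simp
qed

quotient_type L2 = "real \<Rightarrow> complex" /
  partial: "\<lambda>f g. square_integrable f \<and> square_integrable g \<and> (AE x in lborel. f x = g x)"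
proof (rule part_equivpI)
  show "\<exists>f. square_integrable f \<and> square_integrable f \<and> (AE x in lborel. f x = f x)"
    using square_integrable_zero by auto
qed (auto intro!: sympI transpI elim: eventually_elim2 simp: eq_commute)

instantiation L2 :: real_vector
begin

lift_definition zero_L2 :: L2 is "\<lambda>x. 0"
  by (simp add: square_integrable_zero)

lift_definition plus_L2 :: "L2 \<Rightarrow> L2 \<Rightarrow> L2" is "\<lambda>f g x. f x + g x"
  by (auto simp: square_integrable_add elim: eventually_elim2)

lift_definition uminus_L2 :: "L2 \<Rightarrow> L2" is "\<lambda>f x. - f x"
  by (auto simp: square_integrable_uminus)

lift_definition minus_L2 :: "L2 \<Rightarrow> L2 \<Rightarrow> L2" is "\<lambda>f g x. f x - g x"
  by (auto simp: square_integrable_diff elim: eventually_elim2)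

lift_definition scaleR_L2 :: "real \<Rightarrow> L2 \<Rightarrow> L2" is "\<lambda>r f x. r *\<^sub>R f x"
  by (auto simp: square_integrable_scaleR elim: eventually_mono)

instance
  by standard
    (transfer, auto simp: square_integrable_add square_integrable_diff square_integrable_uminus
       square_integrable_scaleR square_integrable_zero algebra_simps)+

end

text \<open>
  The real inner product below is the real part of the usual Hermitian one, so that the
  induced norm is the usual norm of \<open>L\<^sup>2(\<real>; \<complex>)\<close>. Since all operators below are complex
  linear, their operator norm does not depend on which scalar field is used.
\<close>

instantiation L2 :: real_inner
begin

lift_definition inner_L2 :: "L2 \<Rightarrow> L2 \<Rightarrow> real" is "\<lambda>f g. LINT x|lborel. inner (f x) (g x)"
proof -
  fix f f' g g' :: "real \<Rightarrow> complex"
  assume f: "square_integrable f \<and> square_integrable f' \<and> (AE x in lborel. f x = f' x)"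
     and g: "square_integrable g \<and> square_integrable g' \<and> (AE x in lborel. g x = g' x)"
  have "AE x in lborel. inner (f x) (g x) = inner (f' x) (g' x)"
    using f g by (auto elim: eventually_elim2)
  moreover have "integrable lborel (\<lambda>x. inner (f x) (g x))"
    "integrable lborel (\<lambda>x. inner (f' x) (g' x))"
    using f g by (auto intro: square_integrable_inner)
  ultimately show "(LINT x|lborel. inner (f x) (g x)) = (LINT x|lborel. inner (f' x) (g' x))"
    by (intro integral_cong_AE) auto
qed

definition norm_L2 :: "L2 \<Rightarrow> real" where "norm_L2 u = sqrt (inner u u)"
definition sgn_L2 :: "L2 \<Rightarrow> L2" where "sgn_L2 u = u /\<^sub>R norm u"
definition dist_L2 :: "L2 \<Rightarrow> L2 \<Rightarrow> real" where "dist_L2 u v = norm (u - v)"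
definition uniformity_L2 :: "(L2 \<times> L2) filter" where
  "uniformity_L2 = (INF e\<in>{0<..}. principal {(u, v). dist u v < e})"
definition open_L2 :: "L2 set \<Rightarrow> bool" where
  "open_L2 U \<longleftrightarrow> (\<forall>x\<in>U. \<forall>\<^sub>F (x', y) in uniformity. x' = x \<longrightarrow> y \<in> U)"

instance
proof
  fix u v w :: L2 and r :: real
  show "inner u v = inner v u"
    by transfer (simp add: inner_commute)
  show "inner (u + v) w = inner u w + inner v w"
    by transfer (auto simp: inner_add_left square_integrable_inner)
  show "inner (r *\<^sub>R u) v = r * inner u v"
    by transfer simp
  show "0 \<le> inner u u"
    by transfer simp
  show "inner u u = 0 \<longleftrightarrow> u = 0"
  proof transfer
    fix f :: "real \<Rightarrow> complex"
    assume f: "square_integrable f \<and> square_integrable f \<and> (AE x in lborel. f x = f x)"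
    then have "integrable lborel (\<lambda>x. inner (f x) (f x))"
      by (auto intro: square_integrable_inner)
    then have "(LINT x|lborel. inner (f x) (f x)) = 0 \<longleftrightarrow> (AE x in lborel. inner (f x) (f x) = 0)"
      by (intro integral_nonneg_eq_0_iff_AE) auto
    then show "(LINT x|lborel. inner (f x) (f x)) = 0 \<longleftrightarrow>
        square_integrable f \<and> square_integrable (\<lambda>x. 0) \<and> (AE x in lborel. f x = 0)"
      using f by (simp add: square_integrable_zero)
  qed
qed (simp_all only: norm_L2_def sgn_L2_def dist_L2_def uniformity_L2_def open_L2_def)

end

lift_definition scaleC_L2 :: "complex \<Rightarrow> L2 \<Rightarrow> L2" (infixr \<open>*\<^sub>C\<close> 75) is "\<lambda>c f x. c * f x"
  by (auto simp: square_integrable_cmult elim: eventually_mono)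


section \<open>Weak derivatives and the Sobolev space \<open>H\<^sup>2(\<real>)\<close>\<close>

definition test_function :: "(real \<Rightarrow> real) \<Rightarrow> bool" where
  "test_function \<phi> \<longleftrightarrow>
     (\<forall>n x. (deriv ^^ n) \<phi> differentiable (at x)) \<and> compact (closure {x. \<phi> x \<noteq> 0})"

lemma test_function_measurable:
  assumes "test_function \<phi>"
  shows "\<phi> \<in> borel_measurable borel" "deriv \<phi> \<in> borel_measurable borel"
proof -
  have d: "(deriv ^^ n) \<phi> \<in> borel_measurable borel" for n
    using assms
    by (intro borel_measurable_continuous_onI continuous_at_imp_continuous_on ballI
          differentiable_imp_continuous_within) (auto simp: test_function_def)
  show "\<phi> \<in> borel_measurable borel" using d[of 0] by simp
  show "deriv \<phi> \<in> borel_measurable borel" using d[of 1] by simp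
qed

text \<open>
  Real-valued test functions suffice: the defining identity is complex linear in \<open>\<phi>\<close>.
\<close>

lift_definition has_weak_derivative :: "L2 \<Rightarrow> L2 \<Rightarrow> bool" is
  "\<lambda>f g. \<forall>\<phi>. test_function \<phi> \<longrightarrow>
     (LINT x|lborel. deriv \<phi> x *\<^sub>R f x) = - (LINT x|lborel. \<phi> x *\<^sub>R g x)"
proof -
  fix f f' g g' :: "real \<Rightarrow> complex"
  assume f: "square_integrable f \<and> square_integrable f' \<and> (AE x in lborel. f x = f' x)"
     and g: "square_integrable g \<and> square_integrable g' \<and> (AE x in lborel. g x = g' x)"
  have [measurable]: "f \<in> borel_measurable borel" "f' \<in> borel_measurable borel"
    "g \<in> borel_measurable borel" "g' \<in> borel_measurable borel"
    using f g by (auto simp: square_integrable_def)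
  have "(LINT x|lborel. deriv \<phi> x *\<^sub>R f x) = (LINT x|lborel. deriv \<phi> x *\<^sub>R f' x) \<and>
        (LINT x|lborel. \<phi> x *\<^sub>R g x) = (LINT x|lborel. \<phi> x *\<^sub>R g' x)"
    if "test_function \<phi>" for \<phi>
  proof -
    note [measurable] = test_function_measurable[OF that]
    show ?thesis
      using f g by (auto intro!: integral_cong_AE elim: eventually_mono)
  qed
  then show "(\<forall>\<phi>. test_function \<phi> \<longrightarrow>
        (LINT x|lborel. deriv \<phi> x *\<^sub>R f x) = - (LINT x|lborel. \<phi> x *\<^sub>R g x)) \<longleftrightarrow>
      (\<forall>\<phi>. test_function \<phi> \<longrightarrow>
        (LINT x|lborel. deriv \<phi> x *\<^sub>R f' x) = - (LINT x|lborel. \<phi> x *\<^sub>R g' x))"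
    by auto
qed

text \<open>Weak derivatives are unique, so the description is proper whenever one exists.\<close>

definition weak_deriv :: "L2 \<Rightarrow> L2" where
  "weak_deriv u = (THE v. has_weak_derivative u v)"

definition H2 :: "L2 set" where
  "H2 = {u. \<exists>v w. has_weak_derivative u v \<and> has_weak_derivative v w}"


section \<open>The Schroedinger operator with a step potential\<close>

definition step_potential :: "complex \<Rightarrow> complex \<Rightarrow> real \<Rightarrow> complex" where
  "step_potential Vp Vm x = (if 0 \<le> x then Vp else Vm)"

lemma square_integrable_step_potential:
  assumes "square_integrable f"
  shows "square_integrable (\<lambda>x. step_potential Vp Vm x * f x)"
  unfolding square_integrable_def
proof
  have [measurable]: "f \<in> borel_measurable borel"
    using assms by (auto simp: square_integrable_def)
  have [measurable]: "step_potential Vp Vm \<in> borel_measurable borel"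
    unfolding step_potential_def[abs_def] by measurable
  show "(\<lambda>x. step_potential Vp Vm x * f x) \<in> borel_measurable lborel" by simp
  show "integrable lborel (\<lambda>x. (cmod (step_potential Vp Vm x * f x))\<^sup>2)"
  proof (rule Bochner_Integration.integrable_bound)
    show "integrable lborel (\<lambda>x. ((cmod Vp)\<^sup>2 + (cmod Vm)\<^sup>2) * (cmod (f x))\<^sup>2)"
      using assms by (auto simp: square_integrable_def)
    show "AE x in lborel. norm ((cmod (step_potential Vp Vm x * f x))\<^sup>2)
            \<le> norm (((cmod Vp)\<^sup>2 + (cmod Vm)\<^sup>2) * (cmod (f x))\<^sup>2)"
      by (auto simp: step_potential_def norm_mult power_mult_distrib intro!: mult_right_mono)
  qed simp
qed

lift_definition potential_op :: "complex \<Rightarrow> complex \<Rightarrow> L2 \<Rightarrow> L2" is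
  "\<lambda>Vp Vm f x. step_potential Vp Vm x * f x"
  by (auto simp: square_integrable_step_potential elim: eventually_mono)

text \<open>Meaningful on the domain \<open>H2\<close> only.\<close>

definition step_schroedinger :: "complex \<Rightarrow> complex \<Rightarrow> L2 \<Rightarrow> L2" where
  "step_schroedinger Vp Vm u = - weak_deriv (weak_deriv u) + potential_op Vp Vm u"


section \<open>Resolvents of operators with domain\<close>

definition resolvent :: "L2 set \<Rightarrow> (L2 \<Rightarrow> L2) \<Rightarrow> complex \<Rightarrow> L2 \<Rightarrow> L2" where
  "resolvent D A z = inv_into D (\<lambda>u. A u - z *\<^sub>C u)"

definition resolvent_set :: "L2 set \<Rightarrow> (L2 \<Rightarrow> L2) \<Rightarrow> complex set" where
  "resolvent_set D A =
     {z. bij_betw (\<lambda>u. A u - z *\<^sub>C u) D UNIV \<and> bounded_linear (resolvent D A z)}"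

end

theory Submission
  imports Defs "HOL-Computational_Algebra.Polynomial"
begin

text \<open>
Let \<open>k\<^sub>\<plusminus>\<close> be the square root of \<open>V\<^sub>\<plusminus> - z\<close> with positive real part. On each half-line the equation
\<open>- u'' + (V - z) u = f\<close> has constant coefficients, so for every prescribed value \<open>c\<close> at the origin it has exactly
one square-integrable solution, and \<open>c\<close> is then fixed by requiring \<open>u'\<close> to be continuous at the origin.
The outcome is the exact formula
\<open>(L - z)\<^sup>-\<^sup>1 f = (\<integral> \<phi> f) / (k\<^sub>+ + k\<^sub>-) \<cdot> \<phi> + R f\<close>, where \<open>\<phi> x = exp (- k\<^sub>\<plusminus> \<bar>x\<bar>)\<close> decays on both sides and \<open>R\<close>
is the direct sum of the Dirichlet resolvents of the two half-lines (\<open>transmission_primitives\<close>,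
\<open>transmission_split\<close>).

The rank-one term has norm exactly \<open>\<parallel>\<phi>\<parallel>\<^sup>2 / \<bar>k\<^sub>+ + k\<^sub>-\<bar>\<close>. It dominates because the imaginary parts of \<open>V\<^sub>\<plusminus> - z\<close> have
opposite signs: as \<open>Re z\<close> grows, \<open>k\<^sub>+\<close> and \<open>k\<^sub>-\<close> approach the opposite points \<open>\<plusminus> \<i> sqrt (Re z)\<close>, and
\<open>k\<^sub>+ + k\<^sub>- = (V\<^sub>+ - V\<^sub>-) / (k\<^sub>+ - k\<^sub>-)\<close> becomes small. With \<open>\<delta>\<^sub>\<plusminus> = \<bar>Im V\<^sub>\<plusminus> - Im z\<bar>\<close> one has
\<open>1 / Re k\<^sub>\<plusminus> = 2 \<bar>Im k\<^sub>\<plusminus>\<bar> / \<delta>\<^sub>\<plusminus>\<close> without any error, so the norm of the rank-one term is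
\<open>\<bar>k\<^sub>+ - k\<^sub>-\<bar> (\<bar>Im k\<^sub>+\<bar> / \<delta>\<^sub>+ + \<bar>Im k\<^sub>-\<bar> / \<delta>\<^sub>-) / \<bar>V\<^sub>+ - V\<^sub>-\<bar>\<close>, and inserting \<open>\<bar>Im k\<^sub>\<plusminus>\<bar> = sqrt (Re z) (1 + O(1 / Re z))\<close> gives the
leading factor with a relative error that does not deteriorate as \<open>\<delta>\<^sub>\<plusminus>\<close> tends to zero (\<open>gain_asymptotics\<close>). A
Schur test bounds \<open>R\<close> by a multiple of \<open>1 / \<delta>\<^sub>+ + 1 / \<delta>\<^sub>-\<close> (\<open>Dirichlet_bound\<close>), which is smaller than the
leading factor by another factor \<open>1 / Re z\<close>.

What remains is to connect these formulas with weak derivatives. In one direction, an indefinite integral has its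
integrand as weak derivative. In the other, by the lemma of du Bois-Reymond, a function with a weak derivative
is almost everywhere an indefinite integral of it; hence an element of the kernel of \<open>L - z\<close> is a classical
solution on each half-line, square integrability leaves only the decaying exponentials, and these can be matched
at the origin in no other way than by zero (\<open>homogeneous_solution_zero\<close>).
\<close>

section \<open>Smooth functions and bumps\<close>

definition smooth :: "(real \<Rightarrow> real) \<Rightarrow> bool" where
  "smooth f \<longleftrightarrow> (\<forall>n x. (deriv ^^ n) f differentiable (at x))"

text \<open>
Higher derivatives are rarely available in closed form. It is enough to exhibit a class of differentiable functions
that is closed under differentiation.
\<close>
lemma smooth_coinduct:
  assumes "P f" and step: "\<And>f. P f \<Longrightarrow> (\<forall>x. f differentiable (at x)) \<and> P (deriv f)"
  shows "smooth f"
proof -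
  have "P ((deriv ^^ n) f)" for n
    by (induction n) (use assms in auto)
  then show ?thesis
    using step by (auto simp: smooth_def)
qed

lemma smooth_differentiable: "smooth f \<Longrightarrow> f differentiable (at x)"
  unfolding smooth_def by (metis funpow_0)

lemma smooth_DERIV: "smooth f \<Longrightarrow> (f has_real_derivative deriv f x) (at x)"
  using smooth_differentiable DERIV_deriv_iff_real_differentiable by blast

lemma smooth_deriv: "smooth f \<Longrightarrow> smooth (deriv f)"
  unfolding smooth_def by (metis comp_apply funpow_Suc_right)

lemma smooth_primitive:
  assumes "\<And>x. (F has_real_derivative f x) (at x)" "smooth f"
  shows "smooth F"
proof -
  have d: "deriv F = f" using assms(1) DERIV_imp_deriv by blast
  have "(deriv ^^ n) F differentiable (at x)" for n x
  proof (cases n)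
    case 0 then show ?thesis
      using assms(1) real_differentiable_def by auto
  next
    case (Suc m)
    then show ?thesis using assms(2) d by (simp add: funpow_swap1 funpow_Suc_right smooth_def del: funpow.simps)
  qed
  then show ?thesis by (auto simp: smooth_def)
qed

lemma smooth_lincomb:
  assumes "smooth f" "smooth g"
  shows "smooth (\<lambda>x. f x - c * g x)"
proof (rule smooth_coinduct[where P = "\<lambda>h. \<exists>f g. smooth f \<and> smooth g \<and> h = (\<lambda>x. f x - c * g x)"])
  show "\<exists>f' g'. smooth f' \<and> smooth g' \<and> (\<lambda>x. f x - c * g x) = (\<lambda>x. f' x - c * g' x)"
    using assms by blast
next
  fix h assume "\<exists>f g. smooth f \<and> smooth g \<and> h = (\<lambda>x. f x - c * g x)"
  then obtain f g where fg: "smooth f" "smooth g" and h: "h = (\<lambda>x. f x - c * g x)" by blast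
  have D: "(h has_real_derivative deriv f x - c * deriv g x) (at x)" for x
    unfolding h by (auto intro!: derivative_eq_intros smooth_DERIV fg)
  then have "deriv h = (\<lambda>x. deriv f x - c * deriv g x)"
    using DERIV_imp_deriv by blast
  then show "(\<forall>x. h differentiable (at x)) \<and> (\<exists>f g. smooth f \<and> smooth g \<and> deriv h = (\<lambda>x. f x - c * g x))"
    using D fg smooth_deriv real_differentiable_def by blast
qed

lemma power_over_fact_le_exp:
  fixes s :: real
  assumes "0 \<le> s"
  shows "s ^ n / fact n \<le> exp s"
proof -
  have "(\<Sum>i\<in>{n}. s ^ i /\<^sub>R fact i) \<le> (\<Sum>i. s ^ i /\<^sub>R fact i)"
    using assms exp_converges[of s] by (intro sum_le_suminf) (auto simp: sums_iff)
  then show ?thesis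
    using exp_converges[of s] by (simp add: sums_iff divide_inverse mult.commute)
qed

text \<open>
The functions \<open>p / q\<^sup>m \<cdot> exp (- 1 / q)\<close>, cut off where \<open>q\<close> is not positive, form a class to which
\<open>smooth_coinduct\<close> applies; it contains the classical bump functions.
\<close>
definition flat_exp :: "real poly \<Rightarrow> real poly \<Rightarrow> nat \<Rightarrow> real \<Rightarrow> real" where
  "flat_exp p q m x =
     (if poly q x > 0 then poly p x / poly q x ^ m * exp (- (1 / poly q x)) else 0)"

text \<open>
The factor \<open>exp (- 1 / t)\<close> beats every power of \<open>1 / t\<close>. Quadratic vanishing in \<open>q\<close> is what makes the derivative at
a zero of \<open>q\<close> equal to zero.
\<close>
lemma flat_exp_bound:
  "\<bar>flat_exp p q m x\<bar> \<le> fact (m + 2) * \<bar>poly p x\<bar> * \<bar>poly q x\<bar>\<^sup>2"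
proof (cases "poly q x > 0")
  case True
  define t where "t = poly q x"
  have t: "t > 0" using True t_def by simp
  have "(1 / t) ^ (m + 2) / fact (m + 2) \<le> exp (1 / t)"
    using t by (intro power_over_fact_le_exp) auto
  then have "1 \<le> fact (m + 2) * t ^ (m + 2) * exp (1 / t)"
    using t by (simp add: field_simps del: fact_Suc)
  then have "exp (- (1 / t)) \<le> fact (m + 2) * t ^ (m + 2)"
    by (simp add: exp_minus field_simps del: fact_Suc)
  then have "exp (- (1 / t)) / t ^ m \<le> fact (m + 2) * t\<^sup>2"
    using t by (simp add: field_simps power_add power2_eq_square del: fact_Suc)
  then have "\<bar>poly p x\<bar> * (exp (- (1 / t)) / t ^ m) \<le> \<bar>poly p x\<bar> * (fact (m + 2) * t\<^sup>2)"
    by (intro mult_left_mono) auto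
  then show ?thesis
    using True by (simp add: flat_exp_def t_def abs_mult field_simps del: fact_Suc)
qed (simp add: flat_exp_def)

lemma DERIV_flat_exp:
  "(flat_exp p q m has_real_derivative
      flat_exp (pderiv p * q\<^sup>2 - smult (of_nat m) (p * pderiv q * q) + p * pderiv q) q (m + 2) x) (at x)"
  (is "(_ has_real_derivative flat_exp ?p q _ x) _")
proof -
  have cont: "isCont (poly q) x" by simp
  consider "poly q x > 0" | "poly q x < 0" | "poly q x = 0" by linarith
  then show ?thesis
  proof cases
    case 1
    define t where "t = poly q x"
    have t: "t > 0" using 1 t_def by simp
    have qm: "((\<lambda>y. poly q y ^ m) has_real_derivative of_nat m * (poly (pderiv q) x * t ^ (m - 1))) (at x)"
      unfolding t_def using DERIV_power[OF poly_DERIV[of q x], of m] by simp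
    have e: "((\<lambda>y. exp (- (1 / poly q y))) has_real_derivative exp (- (1 / t)) * (poly (pderiv q) x / t\<^sup>2)) (at x)"
      using t unfolding t_def
      by (auto intro!: derivative_eq_intros poly_DERIV simp: power2_eq_square)
    have "((\<lambda>y. poly p y / poly q y ^ m * exp (- (1 / poly q y))) has_real_derivative
            (poly (pderiv p) x * t ^ m - poly p x * (of_nat m * (poly (pderiv q) x * t ^ (m - 1)))) /
              (t ^ m * t ^ m) * exp (- (1 / t)) +
            (exp (- (1 / t)) * (poly (pderiv q) x / t\<^sup>2)) * (poly p x / t ^ m)) (at x)"
      using t DERIV_mult[OF DERIV_divide[OF poly_DERIV[of p x] qm] e] unfolding t_def by simp
    moreover have "(poly (pderiv p) x * t ^ m - poly p x * (of_nat m * (poly (pderiv q) x * t ^ (m - 1)))) /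
              (t ^ m * t ^ m) * exp (- (1 / t)) +
            (exp (- (1 / t)) * (poly (pderiv q) x / t\<^sup>2)) * (poly p x / t ^ m) = flat_exp ?p q (m + 2) x"
    proof -
      have algebra: "(P' * T - P * (Q' * k)) / (T * T) * E + E * (Q' / t\<^sup>2) * (P / T) =
          (P' * t\<^sup>2 - k * t / T * (P * Q' * t) + P * Q') / (T * t\<^sup>2) * E"
        if "T \<noteq> 0" for P P' T Q' k E :: real
        using that t by (simp add: divide_simps) algebra
      have m: "real m * t ^ (m - 1) * t / t ^ m = real m"
        using t by (cases m) auto
      have comm: "poly p x * (real m * (poly (pderiv q) x * t ^ (m - 1))) =
          poly p x * (poly (pderiv q) x * (real m * t ^ (m - 1)))"
        by (rule arg_cong[where f = "(*) (poly p x)"]) (rule mult.left_commute)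
      have val: "flat_exp ?p q (m + 2) x = (poly (pderiv p) x * t\<^sup>2 -
          real m * (poly p x * poly (pderiv q) x * t) + poly p x * poly (pderiv q) x) / (t ^ m * t\<^sup>2) * exp (- (1 / t))"
        using t unfolding flat_exp_def t_def[symmetric] by (simp add: t_def power_add) (simp add: power2_eq_square)
      have "t ^ m \<noteq> 0" using t by simp
      from algebra[OF this, of "poly (pderiv p) x" "poly p x" "poly (pderiv q) x" "real m * t ^ (m - 1)" "exp (- (1 / t))"]
      show ?thesis
        unfolding comm val m .
    qed
    ultimately have "((\<lambda>y. poly p y / poly q y ^ m * exp (- (1 / poly q y))) has_real_derivative
            flat_exp ?p q (m + 2) x) (at x)" by simp
    moreover have "\<forall>\<^sub>F y in nhds x. flat_exp p q m y = poly p y / poly q y ^ m * exp (- (1 / poly q y))"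
      using order_tendstoD(1)[OF cont[unfolded isCont_def tendsto_at_iff_tendsto_nhds] 1]
      by (rule eventually_mono) (simp add: flat_exp_def)
    ultimately show ?thesis
      by (subst DERIV_cong_ev[OF refl _ refl])
  next
    case 2
    have "\<forall>\<^sub>F y in nhds x. flat_exp p q m y = 0"
      using order_tendstoD(2)[OF cont[unfolded isCont_def tendsto_at_iff_tendsto_nhds] 2]
      by (rule eventually_mono) (simp add: flat_exp_def)
    moreover have "((\<lambda>y. 0) has_real_derivative flat_exp ?p q (m + 2) x) (at x)"
      using 2 by (simp add: flat_exp_def)
    ultimately show ?thesis
      by (subst DERIV_cong_ev[OF refl _ refl])
  next
    case 3
    have q': "((\<lambda>y. (poly q y - poly q x) / (y - x)) \<longlongrightarrow> poly (pderiv q) x) (at x)"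
      using poly_DERIV[of q x] by (simp add: has_field_derivative_iff)
    have "((\<lambda>y. fact (m + 2) * \<bar>poly p y\<bar> * (\<bar>(poly q y - poly q x) / (y - x)\<bar> * \<bar>poly q y\<bar>)) \<longlongrightarrow>
           fact (m + 2) * \<bar>poly p x\<bar> * (\<bar>poly (pderiv q) x\<bar> * \<bar>poly q x\<bar>)) (at x)"
      by (intro tendsto_intros q')
    then have lim: "((\<lambda>y. fact (m + 2) * \<bar>poly p y\<bar> * (\<bar>(poly q y - poly q x) / (y - x)\<bar> * \<bar>poly q y\<bar>)) \<longlongrightarrow> 0) (at x)"
      using 3 by simp
    have "((\<lambda>y. (flat_exp p q m y - flat_exp p q m x) / (y - x)) \<longlongrightarrow> 0) (at x)"
    proof (rule Lim_null_comparison[OF _ lim])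
      have "norm ((flat_exp p q m y - flat_exp p q m x) / (y - x)) \<le>
          fact (m + 2) * \<bar>poly p y\<bar> * (\<bar>(poly q y - poly q x) / (y - x)\<bar> * \<bar>poly q y\<bar>)" for y
      proof -
        have "norm ((flat_exp p q m y - flat_exp p q m x) / (y - x)) = \<bar>flat_exp p q m y\<bar> / \<bar>y - x\<bar>"
          using 3 by (simp add: flat_exp_def)
        also have "\<dots> \<le> (fact (m + 2) * \<bar>poly p y\<bar> * \<bar>poly q y\<bar>\<^sup>2) / \<bar>y - x\<bar>"
          by (intro divide_right_mono flat_exp_bound) auto
        finally show ?thesis using 3 by (simp add: power2_eq_square del: fact_Suc)
      qed
      then show "\<forall>\<^sub>F y in at x. norm ((flat_exp p q m y - flat_exp p q m x) / (y - x)) \<le>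
          fact (m + 2) * \<bar>poly p y\<bar> * (\<bar>(poly q y - poly q x) / (y - x)\<bar> * \<bar>poly q y\<bar>)"
        by simp
    qed
    then show ?thesis
      using 3 by (simp add: has_field_derivative_iff flat_exp_def)
  qed
qed

lemma smooth_flat_exp: "smooth (flat_exp p q m)"
proof (rule smooth_coinduct[where P = "\<lambda>f. \<exists>p m. f = flat_exp p q m"])
  show "\<exists>p' m'. flat_exp p q m = flat_exp p' q m'" by blast
  fix f assume "\<exists>p m. f = flat_exp p q m"
  then obtain p m where f: "f = flat_exp p q m" by blast
  have "\<forall>x. f differentiable (at x)"
    unfolding f using DERIV_flat_exp real_differentiable_def by blast
  moreover have "deriv f = flat_exp (pderiv p * q\<^sup>2 - smult (of_nat m) (p * pderiv q * q) + p * pderiv q) q (m + 2)"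
    unfolding f using DERIV_flat_exp DERIV_imp_deriv by blast
  ultimately show "(\<forall>x. f differentiable (at x)) \<and> (\<exists>p m. deriv f = flat_exp p q m)" by blast
qed

text \<open>
The polynomial is \<open>(n + 1) (x - a) (b - x)\<close>. Its sign confines the support to the interval, and growing \<open>n\<close> pushes the
values towards 1 inside.
\<close>
definition bump :: "real \<Rightarrow> real \<Rightarrow> nat \<Rightarrow> real \<Rightarrow> real" where
  "bump a b n = flat_exp 1 [: - (real (Suc n) * a * b), real (Suc n) * (a + b), - real (Suc n) :] 0"

lemma bump_eq:
  assumes "a < b"
  shows "bump a b n x =
    (if a < x \<and> x < b then exp (- (1 / (real (Suc n) * ((x - a) * (b - x))))) else 0)"
proof -
  have "poly [: - (real (Suc n) * a * b), real (Suc n) * (a + b), - real (Suc n) :] x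
        = real (Suc n) * ((x - a) * (b - x))"
    by (simp add: algebra_simps)
  moreover have "real (Suc n) * ((x - a) * (b - x)) > 0 \<longleftrightarrow> a < x \<and> x < b"
    using assms by (auto simp: zero_less_mult_iff)
  ultimately show ?thesis by (simp add: bump_def flat_exp_def)
qed

lemma test_function_iff:
  "test_function \<phi> \<longleftrightarrow> smooth \<phi> \<and> (\<exists>a b. \<forall>x. x \<notin> {a..b} \<longrightarrow> \<phi> x = 0)"
proof
  assume t: "test_function \<phi>"
  then have "bounded {x. \<phi> x \<noteq> 0}"
    by (auto simp: test_function_def compact_closure)
  then obtain a where "\<forall>x\<in>{x. \<phi> x \<noteq> 0}. \<bar>x\<bar> \<le> a"
    by (auto simp: bounded_iff)
  then have "\<forall>x. x \<notin> {- a..a} \<longrightarrow> \<phi> x = 0" by fastforce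
  then show "smooth \<phi> \<and> (\<exists>a b. \<forall>x. x \<notin> {a..b} \<longrightarrow> \<phi> x = 0)"
    using t unfolding test_function_def smooth_def by blast
next
  assume r: "smooth \<phi> \<and> (\<exists>a b. \<forall>x. x \<notin> {a..b} \<longrightarrow> \<phi> x = 0)"
  then obtain a b where "{x. \<phi> x \<noteq> 0} \<subseteq> {a..b}" by blast
  then have "bounded {x. \<phi> x \<noteq> 0}"
    using bounded_closed_interval bounded_subset by blast
  then show "test_function \<phi>"
    using r by (auto simp: test_function_def smooth_def compact_closure)
qed

lemma test_function_bump: "a < b \<Longrightarrow> test_function (bump a b n)"
  unfolding test_function_iff
  by (intro conjI exI[of _ a] exI[of _ b]) (auto simp: bump_eq, simp add: bump_def smooth_flat_exp)

lemma bump_tendsto: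
  assumes "a < b"
  shows "(\<lambda>n. bump a b n x) \<longlonglongrightarrow> indicator {a<..<b} x"
proof (cases "a < x \<and> x < b")
  case True
  define c where "c = (x - a) * (b - x)"
  have "(\<lambda>n. exp (- (1 / c * inverse (real (Suc n))))) \<longlonglongrightarrow> exp (- (1 / c * 0))"
    by (intro tendsto_intros LIMSEQ_inverse_real_of_nat)
  then show ?thesis
    using True assms by (simp add: bump_eq c_def divide_inverse mult.commute)
qed (use assms in \<open>auto simp: bump_eq\<close>)

lemma bump_bounds: "a < b \<Longrightarrow> 0 \<le> bump a b n x" "a < b \<Longrightarrow> bump a b n x \<le> indicator {a..b} x"
  by (auto simp: bump_eq)

section \<open>Calculus of test functions\<close>

lemma test_functionE:
  assumes "test_function \<phi>"
  obtains a b where "a < b" "\<And>x. \<phi> x \<noteq> 0 \<Longrightarrow> a < x \<and> x < b" "\<And>x. deriv \<phi> x \<noteq> 0 \<Longrightarrow> a < x \<and> x < b"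
proof -
  obtain a b where ab: "\<And>x. x \<notin> {a..b} \<Longrightarrow> \<phi> x = 0"
    using assms unfolding test_function_iff by blast
  have ab': "deriv \<phi> x = 0" if "x \<notin> {a..b}" for x
  proof -
    have "\<forall>\<^sub>F y in nhds x. y \<in> - {a..b}"
      using that by (intro eventually_nhds_in_open) auto
    then have "\<forall>\<^sub>F y in nhds x. \<phi> y = 0"
      by (rule eventually_mono) (use ab in auto)
    then have "deriv \<phi> x = deriv (\<lambda>_. 0) x"
      by (rule deriv_cong_ev) (rule refl)
    then show ?thesis by simp
  qed
  have "a - 1 < x \<and> x < max a b + 1" if "x \<in> {a..b}" for x
    using that by auto
  then show thesis
    using ab ab' by (intro that[of "a - 1" "max a b + 1"]) (simp, blast+)
qed

lemma test_function_deriv: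
  assumes "test_function \<phi>"
  shows "test_function (deriv \<phi>)"
proof -
  obtain a b where "\<And>x. deriv \<phi> x \<noteq> 0 \<Longrightarrow> a < x \<and> x < b"
    using test_functionE[OF assms] by metis
  then have "\<forall>x. x \<notin> {a..b} \<longrightarrow> deriv \<phi> x = 0" by fastforce
  then show ?thesis
    using assms smooth_deriv unfolding test_function_iff by blast
qed

lemma test_function_lincomb:
  assumes "test_function \<phi>" "test_function \<psi>"
  shows "test_function (\<lambda>x. \<phi> x - c * \<psi> x)"
proof -
  obtain a b a' b' where "\<And>x. x \<notin> {a..b} \<Longrightarrow> \<phi> x = 0" "\<And>x. x \<notin> {a'..b'} \<Longrightarrow> \<psi> x = 0"
    using assms unfolding test_function_iff by metis
  then have "\<forall>x. x \<notin> {min a a'..max b b'} \<longrightarrow> \<phi> x - c * \<psi> x = 0"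
    by (metis atLeastAtMost_iff diff_self max.coboundedI1 max.coboundedI2 min.coboundedI1
        min.coboundedI2 mult_zero_right)
  then show ?thesis
    using assms smooth_lincomb unfolding test_function_iff by blast
qed

lemma test_function_DERIV: "test_function \<phi> \<Longrightarrow> (\<phi> has_real_derivative deriv \<phi> x) (at x)"
  using smooth_DERIV test_function_iff by blast

lemma test_function_isCont: "test_function \<phi> \<Longrightarrow> isCont \<phi> x"
  using DERIV_isCont test_function_DERIV by blast

section \<open>Testing locally integrable functions\<close>

definition locally_integrable :: "(real \<Rightarrow> complex) \<Rightarrow> bool" where
  "locally_integrable g \<longleftrightarrow> (\<forall>a b. set_integrable lborel {a..b} g)"

lemma locally_integrableD: "locally_integrable g \<Longrightarrow> set_integrable lborel {a..b} g"
  by (simp add: locally_integrable_def)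

lemma locally_integrable_diff:
  "locally_integrable f \<Longrightarrow> locally_integrable g \<Longrightarrow> locally_integrable (\<lambda>x. f x - g x)"
  by (simp add: locally_integrable_def set_integral_diff)

lemma locally_integrable_continuous:
  "continuous_on UNIV g \<Longrightarrow> locally_integrable g"
  unfolding locally_integrable_def set_integrable_def
  by (intro allI borel_integrable_compact) (auto intro: continuous_on_subset)

lemma locally_integrable_square_integrable:
  assumes "square_integrable f"
  shows "locally_integrable f"
  unfolding locally_integrable_def set_integrable_def
proof (intro allI)
  fix a b :: real
  have [measurable]: "f \<in> borel_measurable borel"
    using assms by (auto simp: square_integrable_def)
  show "integrable lborel (\<lambda>x. indicator {a..b} x *\<^sub>R f x)"
  proof (rule Bochner_Integration.integrable_bound)
    show "integrable lborel (\<lambda>x. indicator {a..b} x + (cmod (f x))\<^sup>2)"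
      using assms unfolding square_integrable_def
      by (intro Bochner_Integration.integrable_add integrable_real_indicator) (auto simp: emeasure_lborel_Icc_eq)
    have le: "t \<le> 1 + t\<^sup>2" for t :: real
    proof -
      have "2 * t \<le> t\<^sup>2 + 1" using sum_squares_bound[of t 1] by simp
      then show ?thesis using zero_le_power2[of t] by linarith
    qed
    show "AE x in lborel. norm (indicator {a..b} x *\<^sub>R f x) \<le> norm (indicator {a..b} x + (cmod (f x))\<^sup>2)"
    proof (rule AE_I2)
      fix x
      show "norm (indicator {a..b} x *\<^sub>R f x) \<le> norm (indicator {a..b} x + (cmod (f x))\<^sup>2)"
        using le[of "cmod (f x)"] by (simp add: indicator_def)
    qed
  qed simp
qed

lemma integrable_test_function_scaleR:
  assumes "test_function \<phi>" "locally_integrable g"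
  shows "integrable lborel (\<lambda>x. \<phi> x *\<^sub>R g x)"
proof -
  obtain a b where ab: "\<And>x. \<phi> x \<noteq> 0 \<Longrightarrow> a < x \<and> x < b"
    using test_functionE[OF assms(1)] by metis
  have [measurable]: "\<phi> \<in> borel_measurable borel"
    by (rule test_function_measurable(1)[OF assms(1)])
  have int: "integrable lborel (\<lambda>x. indicator {a..b} x *\<^sub>R g x)"
    using locally_integrableD[OF assms(2)] by (simp add: set_integrable_def)
  have "bounded (\<phi> ` {a..b})"
    using test_function_isCont[OF assms(1)]
    by (intro compact_imp_bounded compact_continuous_image continuous_at_imp_continuous_on) auto
  then obtain B where B: "\<And>x. x \<in> {a..b} \<Longrightarrow> \<bar>\<phi> x\<bar> \<le> B"
    unfolding bounded_iff by (metis image_eqI real_norm_def)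
  have eq: "\<phi> x *\<^sub>R g x = \<phi> x *\<^sub>R (indicator {a..b} x *\<^sub>R g x)" for x
    using ab[of x] by (auto simp: indicator_def)
  show ?thesis
    unfolding eq
  proof (rule Bochner_Integration.integrable_bound)
    show "integrable lborel (\<lambda>x. B *\<^sub>R norm (indicator {a..b} x *\<^sub>R g x))"
      by (intro integrable_scaleR_right integrable_norm int)
    show "(\<lambda>x. \<phi> x *\<^sub>R (indicator {a..b} x *\<^sub>R g x)) \<in> borel_measurable lborel"
      by (rule borel_measurable_scaleR[OF _ borel_measurable_integrable[OF int]]) simp
    have "\<bar>\<phi> x\<bar> * norm (indicator {a..b} x *\<^sub>R g x) \<le> \<bar>B\<bar> * norm (indicator {a..b} x *\<^sub>R g x)" for x
      using B[of x] by (cases "x \<in> {a..b}") (auto intro!: mult_right_mono)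
    then show "AE x in lborel. norm (\<phi> x *\<^sub>R (indicator {a..b} x *\<^sub>R g x)) \<le> norm (B *\<^sub>R norm (indicator {a..b} x *\<^sub>R g x))"
      by (simp add: abs_mult mult.assoc)
  qed
qed

text \<open>
Bounded open intervals are stable under intersection and generate the Borel sets, so on every bounded window the integrals
over all Borel sets vanish.
\<close>
lemma AE_zero_if_interval_integrals_zero:
  fixes g :: "real \<Rightarrow> complex"
  assumes loc: "locally_integrable g"
    and zero: "\<And>a b. a < b \<Longrightarrow> (LINT x:{a<..<b}|lborel. g x) = 0"
  shows "AE x in lborel. g x = 0"
proof -
  have "AE x in lborel. indicator {- real n<..<real n} x *\<^sub>R g x = 0" for n :: nat
  proof -
    define h where "h = (\<lambda>x. indicator {- real n<..<real n} x *\<^sub>R g x)"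
    have "set_integrable lborel {- real n<..<real n} g"
      by (rule set_integrable_subset[OF locally_integrableD[OF loc, of "- real n" "real n"]]) auto
    then have int: "integrable lborel h"
      by (simp add: h_def set_integrable_def)
    have tot: "(LINT x|lborel. h x) = 0"
      using zero[of "- real n" "real n"] by (cases "n = 0") (auto simp: h_def set_lebesgue_integral_def)
    have si: "set_integrable lborel A h" if "A \<in> sets borel" for A
      unfolding set_integrable_def using int that by (intro integrable_mult_indicator) auto
    have "(LINT x:A|lborel. h x) = 0" if "A \<in> sets borel" for A
    proof -
      let ?G = "range (\<lambda>(a, b). box a b :: real set)"
      have "Int_stable ?G"
        by (auto simp: Int_stable_def box_real image_iff)
      moreover have "?G \<subseteq> Pow UNIV" by simp
      moreover have borel: "sets borel = sigma_sets UNIV ?G"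
        by (subst borel_eq_box) simp
      then have "A \<in> sigma_sets UNIV ?G" using that by simp
      ultimately show ?thesis
      proof (induction rule: sigma_sets_induct_disjoint)
        case (basic A)
        then obtain a b where A: "A = {a<..<b}" by (auto simp: box_real)
        let ?l = "max a (- real n)" and ?r = "min b (real n)"
        have "(LINT x:A|lborel. h x) = (LINT x:{?l<..<?r}|lborel. g x)"
          unfolding set_lebesgue_integral_def h_def A
          by (intro Bochner_Integration.integral_cong) (auto simp: indicator_def)
        also have "\<dots> = 0"
          using zero[of ?l ?r] by (cases "?l < ?r") (auto simp: set_lebesgue_integral_def)
        finally show ?case .
      next
        case empty
        then show ?case by (simp add: set_lebesgue_integral_def)
      next
        case (compl A)
        then have A: "A \<in> sets borel" using borel by simp
        have "(LINT x:UNIV|lborel. h x) = (LINT x:A|lborel. h x) + (LINT x:UNIV - A|lborel. h x)"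
          using A set_integral_Un[of A "UNIV - A" lborel h] si by (simp add: Un_absorb1)
        then show ?case using compl tot by (simp add: set_lebesgue_integral_def)
      next
        case (union A)
        then have "A i \<in> sets borel" for i using borel by auto
        then show ?case
          using union by (subst lebesgue_integral_countable_add) (auto simp: disjoint_family_on_def intro!: si)
      qed
    qed
    then show ?thesis
      using sigma_finite_measure.density_zero[OF lborel.sigma_finite_measure_axioms int] by (simp add: h_def)
  qed
  then have "AE x in lborel. \<forall>n::nat. indicator {- real n<..<real n} x *\<^sub>R g x = 0"
    by (subst AE_all_countable) blast
  then show ?thesis
  proof (rule eventually_mono)
    fix x assume *: "\<forall>n::nat. indicator {- real n<..<real n} x *\<^sub>R g x = 0"
    obtain n :: nat where "\<bar>x\<bar> < real n" using reals_Archimedean2 by blast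
    then show "g x = 0" using *[rule_format, of n] by (auto simp: indicator_def)
  qed
qed

text \<open>
Bumps converge boundedly to the indicator of an interval, so dominated convergence reduces the claim to
integrals over intervals.
\<close>
lemma AE_zero_if_orthogonal_to_test_functions:
  assumes loc: "locally_integrable g"
    and zero: "\<And>\<phi>. test_function \<phi> \<Longrightarrow> (LINT x|lborel. \<phi> x *\<^sub>R g x) = 0"
  shows "AE x in lborel. g x = 0"
proof (rule AE_zero_if_interval_integrals_zero[OF loc])
  fix a b :: real assume ab: "a < b"
  have int: "integrable lborel (\<lambda>x. indicator {a..b} x *\<^sub>R g x)"
    using locally_integrableD[OF loc] by (simp add: set_integrable_def)
  have int': "integrable lborel (\<lambda>x. indicator {a<..<b} x *\<^sub>R g x)"
    using set_integrable_subset[OF locally_integrableD[OF loc, of a b], of "{a<..<b}"]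
    by (simp add: set_integrable_def greaterThanLessThan_subseteq_atLeastAtMost_iff)
  have "(\<lambda>n. LINT x|lborel. bump a b n x *\<^sub>R g x) \<longlonglongrightarrow> (LINT x|lborel. indicator {a<..<b} x *\<^sub>R g x)"
  proof (rule integral_dominated_convergence)
    show "integrable lborel (\<lambda>x. norm (indicator {a..b} x *\<^sub>R g x))"
      using int by (rule integrable_norm)
    show "(\<lambda>x. bump a b n x *\<^sub>R g x) \<in> borel_measurable lborel" for n
      using integrable_test_function_scaleR[OF test_function_bump[OF ab] loc] by (rule borel_measurable_integrable)
    show "AE x in lborel. (\<lambda>n. bump a b n x *\<^sub>R g x) \<longlonglongrightarrow> indicator {a<..<b} x *\<^sub>R g x"
      by (intro AE_I2 tendsto_intros bump_tendsto ab)
    show "AE x in lborel. norm (bump a b n x *\<^sub>R g x) \<le> norm (indicator {a..b} x *\<^sub>R g x)" for n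
    proof (rule AE_I2)
      fix x
      show "norm (bump a b n x *\<^sub>R g x) \<le> norm (indicator {a..b} x *\<^sub>R g x)"
        using mult_right_mono[OF bump_bounds(2)[OF ab, of n x], of "norm (g x)"] bump_bounds(1)[OF ab, of n x]
        by simp
    qed
  qed (use int' in auto)
  then show "(LINT x:{a<..<b}|lborel. g x) = 0"
    using zero[OF test_function_bump[OF ab]]
    by (simp add: set_lebesgue_integral_def LIMSEQ_const_iff)
qed

section \<open>Weak derivatives and indefinite integrals\<close>

lemma integral_test_function_deriv:
  assumes "test_function \<phi>"
  shows "(LINT x:{a..}|lborel. deriv \<phi> x) = - \<phi> a"
proof -
  obtain l r where lr: "l < r" "\<And>x. \<phi> x \<noteq> 0 \<Longrightarrow> l < x \<and> x < r" "\<And>x. deriv \<phi> x \<noteq> 0 \<Longrightarrow> l < x \<and> x < r"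
    using test_functionE[OF assms] by metis
  let ?r = "max r a"
  have "(LINT x:{a..}|lborel. deriv \<phi> x) = (LINT x|lborel. deriv \<phi> x * indicator {a..?r} x)"
    unfolding set_lebesgue_integral_def
    by (intro Bochner_Integration.integral_cong) (use lr(3) in \<open>force simp: indicator_def\<close>)+
  also have "\<dots> = \<phi> ?r - \<phi> a"
    by (intro integral_FTC_Icc_real test_function_DERIV test_function_isCont test_function_deriv assms) auto
  also have "\<phi> ?r = 0" using lr(2)[of ?r] by force
  finally show ?thesis by simp
qed

lemma integrable_pair_scaleR:
  fixes f :: "real \<Rightarrow> real" and g :: "real \<Rightarrow> complex"
  assumes "integrable lborel f" "integrable lborel g"
  shows "integrable (lborel \<Otimes>\<^sub>M lborel) (\<lambda>(x, y). f x *\<^sub>R g y)"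
proof -
  have [measurable]: "f \<in> borel_measurable borel" "g \<in> borel_measurable borel"
    using assms by auto
  show ?thesis
  proof (rule lborel_pair.Fubini_integrable)
    show "integrable lborel (\<lambda>x. LINT y|lborel. norm (case (x, y) of (x, y) \<Rightarrow> f x *\<^sub>R g y))"
      using assms(1) by simp
    show "AE x in lborel. integrable lborel (\<lambda>y. case (x, y) of (x, y) \<Rightarrow> f x *\<^sub>R g y)"
      using assms(2) by simp
  qed simp
qed

text \<open>
Integration by parts for a merely integrable \<open>g\<close>: write \<open>F\<close> as an integral of \<open>g\<close> and exchange the order
of integration over the triangle \<open>y \<le> x\<close>.
\<close>
lemma weak_derivative_of_primitive:
  assumes loc: "locally_integrable g"
    and F: "\<And>a b. a \<le> b \<Longrightarrow> F b - F a = (LINT x:{a..b}|lborel. g x)"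
    and \<phi>: "test_function \<phi>"
  shows "(LINT x|lborel. deriv \<phi> x *\<^sub>R F x) = - (LINT x|lborel. \<phi> x *\<^sub>R g x)"
proof -
  obtain a b where ab: "a < b" "\<And>x. \<phi> x \<noteq> 0 \<Longrightarrow> a < x \<and> x < b" "\<And>x. deriv \<phi> x \<noteq> 0 \<Longrightarrow> a < x \<and> x < b"
    using test_functionE[OF \<phi>] by metis
  define G where "G = (\<lambda>y. indicator {a..b} y *\<^sub>R g y)"
  have G: "integrable lborel G"
    using locally_integrableD[OF loc] by (simp add: G_def set_integrable_def)
  have \<phi>': "integrable lborel (deriv \<phi>)"
  proof -
    have "continuous_on {a..b} (deriv \<phi>)"
      using test_function_isCont[OF test_function_deriv[OF \<phi>]] by (intro continuous_at_imp_continuous_on) auto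
    then have "integrable lborel (\<lambda>x. indicator {a..b} x *\<^sub>R deriv \<phi> x)"
      by (intro borel_integrable_compact) auto
    also have "(\<lambda>x. indicator {a..b} x *\<^sub>R deriv \<phi> x) = deriv \<phi>"
      using ab(3) by (fastforce simp: indicator_def fun_eq_iff)
    finally show ?thesis .
  qed
  have [measurable]: "deriv \<phi> \<in> borel_measurable borel" "G \<in> borel_measurable borel"
    using \<phi>' G by auto
  define H where "H = (\<lambda>x y. indicator {y..} x *\<^sub>R (deriv \<phi> x *\<^sub>R G y))"
  have Hint: "integrable (lborel \<Otimes>\<^sub>M lborel) (case_prod H)"
  proof (rule Bochner_Integration.integrable_bound[OF integrable_pair_scaleR[OF \<phi>' G]])
    have "(\<lambda>(x, y). indicator {z. snd z \<le> fst z} (x, y) *\<^sub>R (deriv \<phi> x *\<^sub>R G y)) \<in> borel_measurable (lborel \<Otimes>\<^sub>M lborel)"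
      by measurable
    also have "(\<lambda>(x, y). indicator {z. snd z \<le> fst z} (x, y) *\<^sub>R (deriv \<phi> x *\<^sub>R G y)) = case_prod H"
      by (auto simp: H_def fun_eq_iff indicator_def)
    finally show "case_prod H \<in> borel_measurable (lborel \<Otimes>\<^sub>M lborel)" .
  qed (auto simp: H_def indicator_def)
  have inner_x: "(LINT x|lborel. H x y) = - (\<phi> y *\<^sub>R g y)" for y
  proof -
    have "(LINT x|lborel. H x y) = (LINT x:{y..}|lborel. deriv \<phi> x) *\<^sub>R G y"
      unfolding set_lebesgue_integral_def
      using \<phi>' by (subst integral_scaleR_left[symmetric])
        (auto simp: H_def simp flip: real_scaleR_def intro!: integrable_mult_indicator)
    also have "\<dots> = - (\<phi> y *\<^sub>R G y)"
      using integral_test_function_deriv[OF \<phi>] by simp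
    also have "\<phi> y *\<^sub>R G y = \<phi> y *\<^sub>R g y"
      using ab(2)[of y] by (auto simp: G_def indicator_def)
    finally show ?thesis .
  qed
  have inner_y: "(LINT y|lborel. H x y) = deriv \<phi> x *\<^sub>R F x - deriv \<phi> x *\<^sub>R F a" for x
  proof (cases "x \<in> {a<..<b}")
    case True
    have "(LINT y|lborel. H x y) = (LINT y|lborel. deriv \<phi> x *\<^sub>R (indicator {a..x} y *\<^sub>R g y))"
      using True by (intro Bochner_Integration.integral_cong) (auto simp: H_def G_def indicator_def)
    also have "\<dots> = deriv \<phi> x *\<^sub>R (LINT y:{a..x}|lborel. g y)"
      unfolding set_lebesgue_integral_def by (rule integral_scaleR_right)
    also have "\<dots> = deriv \<phi> x *\<^sub>R (F x - F a)"
      using F True by simp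
    finally show ?thesis by (simp add: scaleR_diff_right)
  next
    case False
    then have "deriv \<phi> x = 0" using ab(3)[of x] by auto
    then show ?thesis by (simp add: H_def)
  qed
  have tot: "(LINT x|lborel. deriv \<phi> x *\<^sub>R F a) = 0"
  proof -
    have "(LINT x|lborel. deriv \<phi> x) = (LINT x:{a..}|lborel. deriv \<phi> x)"
      unfolding set_lebesgue_integral_def
      by (intro Bochner_Integration.integral_cong) (use ab(3) in \<open>force simp: indicator_def\<close>)+
    moreover have "\<phi> a = 0" using ab(2)[of a] by force
    ultimately show ?thesis
      using integral_test_function_deriv[OF \<phi>, of a] \<phi>' by simp
  qed
  have "integrable lborel (\<lambda>x. (LINT y|lborel. H x y) + deriv \<phi> x *\<^sub>R F a)"
    using lborel_pair.integrable_fst'[OF Hint] \<phi>' by (intro Bochner_Integration.integrable_add) auto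
  then have dF: "integrable lborel (\<lambda>x. deriv \<phi> x *\<^sub>R F x)"
    by (simp add: inner_y)
  have "(LINT x|lborel. deriv \<phi> x *\<^sub>R F x) = (LINT x|lborel. deriv \<phi> x *\<^sub>R F x - deriv \<phi> x *\<^sub>R F a)"
    using tot dF \<phi>' by simp
  also have "\<dots> = (LINT x|lborel. LINT y|lborel. H x y)"
    by (simp add: inner_y)
  also have "\<dots> = (LINT y|lborel. LINT x|lborel. H x y)"
    using lborel_pair.Fubini_integral[OF Hint] by simp
  also have "\<dots> = - (LINT x|lborel. \<phi> x *\<^sub>R g x)"
    by (simp add: inner_x)
  finally show ?thesis .
qed

text \<open>
Mean value zero is precisely what makes the antiderivative vanish again to the right of the support.
\<close>
lemma test_function_primitive:
  assumes \<phi>: "test_function \<phi>" and zero: "(LINT x|lborel. \<phi> x) = 0"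
  obtains \<Phi> where "test_function \<Phi>" "deriv \<Phi> = \<phi>"
proof -
  obtain a b where ab: "a < b" "\<And>x. \<phi> x \<noteq> 0 \<Longrightarrow> a < x \<and> x < b"
    using test_functionE[OF \<phi>] by metis
  obtain F where F: "\<And>x. (F has_real_derivative \<phi> x) (at x)"
    using einterval_antiderivative[of "-\<infinity>" "\<infinity>" \<phi>] test_function_isCont[OF \<phi>]
    by (auto simp: has_real_derivative_iff_has_vector_derivative)
  have FTC: "F y - F x = (LINT t|lborel. \<phi> t * indicator {x..y} t)" if "x \<le> y" for x y
    using integral_FTC_Icc_real[of x y F \<phi>] that F test_function_isCont[OF \<phi>] by simp
  define \<Phi> where "\<Phi> = (\<lambda>x. F x - F a)"
  have D: "(\<Phi> has_real_derivative \<phi> x) (at x)" for x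
    unfolding \<Phi>_def using F by (auto intro!: derivative_eq_intros)
  have off: "\<phi> x = 0" if "x \<le> a \<or> b \<le> x" for x
    using ab(2)[of x] that by fastforce
  have "\<Phi> x = 0" if "x \<notin> {a..b}" for x
  proof (cases "x < a")
    case True
    have "(\<lambda>t. \<phi> t * indicator {x..a} t) = (\<lambda>t. 0)"
      by (auto simp: fun_eq_iff indicator_def off)
    then show ?thesis
      using FTC[of x a] True by (simp add: \<Phi>_def)
  next
    case False
    then have bx: "b < x" using that by simp
    have "\<phi> t * indicator {a..x} t = \<phi> t" for t
      using bx off[of t] by (cases "t < a \<or> x < t") auto
    then have "(\<lambda>t. \<phi> t * indicator {a..x} t) = \<phi>" by (rule ext)
    then show ?thesis
      using FTC[of a x] False zero by (simp add: \<Phi>_def)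
  qed
  moreover have "smooth \<Phi>"
    using smooth_primitive[OF D] \<phi> by (simp add: test_function_iff)
  ultimately have "test_function \<Phi>"
    unfolding test_function_iff by blast
  then show thesis using that D DERIV_imp_deriv by blast
qed

text \<open>
Subtracting a multiple of one fixed bump from a test function makes its mean zero, hence makes it a derivative. So \<open>v\<close> acts
on every test function as a constant does, the constant being its mean against the normalised bump.
\<close>
lemma du_Bois_Reymond:
  assumes loc: "locally_integrable v"
    and zero: "\<And>\<phi>. test_function \<phi> \<Longrightarrow> (LINT x|lborel. deriv \<phi> x *\<^sub>R v x) = 0"
  shows "\<exists>c. AE x in lborel. v x = c"
proof -
  define \<psi> where "\<psi> = bump 0 1 0"
  have \<psi>: "test_function \<psi>" unfolding \<psi>_def by (rule test_function_bump) simp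
  have int_test: "integrable lborel \<phi>" if "test_function \<phi>" for \<phi>
    using integrable_Re[OF integrable_test_function_scaleR[OF that locally_integrable_continuous[of "\<lambda>_. 1"]]] by simp
  have "(LINT x|lborel. \<psi> x) \<noteq> 0"
  proof
    assume "(LINT x|lborel. \<psi> x) = 0"
    then have "AE x in lborel. \<psi> x = 0"
      using integral_nonneg_eq_0_iff_AE[OF int_test[OF \<psi>]] bump_bounds(1)[of 0 1]
      by (simp add: \<psi>_def)
    then have "AE x in lborel. x \<notin> {0<..<1::real}"
      by (rule eventually_mono) (auto simp: \<psi>_def bump_eq)
    then have "emeasure lborel {x::real. 0 < x \<and> x < 1} = 0"
      by (subst (asm) AE_iff_measurable[OF _ refl]) auto
    moreover have "{x::real. 0 < x \<and> x < 1} = {0<..<1}" by auto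
    ultimately show False by simp
  qed
  define I where "I = (LINT x|lborel. \<psi> x)"
  have I: "I \<noteq> 0" using \<open>(LINT x|lborel. \<psi> x) \<noteq> 0\<close> by (simp add: I_def)
  define c where "c = (LINT x|lborel. \<psi> x *\<^sub>R v x) /\<^sub>R I"
  have "AE x in lborel. v x - c = 0"
  proof (rule AE_zero_if_orthogonal_to_test_functions)
    show "locally_integrable (\<lambda>x. v x - c)"
      by (intro locally_integrable_diff loc locally_integrable_continuous) auto
    fix \<phi> assume \<phi>: "test_function \<phi>"
    \<comment> \<open>The multiple of \<open>\<psi>\<close> that makes the mean of \<open>\<phi> - r \<psi>\<close> zero.\<close>
    define r where "r = (LINT x|lborel. \<phi> x) / I"
    have \<chi>: "test_function (\<lambda>x. \<phi> x - r * \<psi> x)"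
      by (rule test_function_lincomb[OF \<phi> \<psi>])
    have "(LINT x|lborel. \<phi> x - r * \<psi> x) = 0"
      using int_test[OF \<phi>] int_test[OF \<psi>] I by (simp add: r_def flip: I_def)
    then obtain \<Phi> where "test_function \<Phi>" "deriv \<Phi> = (\<lambda>x. \<phi> x - r * \<psi> x)"
      using test_function_primitive[OF \<chi>] by metis
    then have "(LINT x|lborel. (\<phi> x - r * \<psi> x) *\<^sub>R v x) = 0"
      using zero by metis
    then have "(LINT x|lborel. \<phi> x *\<^sub>R v x) = r *\<^sub>R (LINT x|lborel. \<psi> x *\<^sub>R v x)"
      using integrable_test_function_scaleR[OF \<phi> loc] integrable_test_function_scaleR[OF \<psi> loc]
      by (simp add: scaleR_diff_left flip: scaleR_scaleR)
    also have "\<dots> = (LINT x|lborel. \<phi> x) *\<^sub>R c"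
      by (simp add: r_def c_def divide_inverse)
    also have "\<dots> = (LINT x|lborel. \<phi> x *\<^sub>R c)"
      using int_test[OF \<phi>] by simp
    finally show "(LINT x|lborel. \<phi> x *\<^sub>R (v x - c)) = 0"
      using integrable_test_function_scaleR[OF \<phi> loc] int_test[OF \<phi>]
      by (simp add: scaleR_diff_right)
  qed
  then show ?thesis by auto
qed

section \<open>The norm of square-integrable functions\<close>

text \<open>
This is the norm of the class of \<open>f\<close> in \<open>L2\<close>, taken on representatives so that pointwise formulas can be used.
\<close>
definition l2norm :: "(real \<Rightarrow> complex) \<Rightarrow> real" where
  "l2norm f = sqrt (LINT x|lborel. (cmod (f x))\<^sup>2)"

lemma square_integrableD:
  assumes "square_integrable f"
  shows "f \<in> borel_measurable borel" "integrable lborel (\<lambda>x. (cmod (f x))\<^sup>2)"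
  using assms by (auto simp: square_integrable_def)

lemma l2norm_nonneg: "0 \<le> l2norm f"
  by (simp add: l2norm_def)

lemma l2norm_power2: "(l2norm f)\<^sup>2 = (LINT x|lborel. (cmod (f x))\<^sup>2)"
  by (simp add: l2norm_def)

lemma norm_abs_L2:
  assumes "square_integrable f"
  shows "norm (abs_L2 f) = l2norm f"
proof -
  have "inner (abs_L2 f) (abs_L2 f) = (LINT x|lborel. inner (f x) (f x))"
    using assms by (intro inner_L2.abs_eq) auto
  then show ?thesis
    by (simp add: norm_L2_def l2norm_def power2_norm_eq_inner)
qed

lemma l2norm_add:
  assumes "square_integrable f" "square_integrable g"
  shows "l2norm (\<lambda>x. f x + g x) \<le> l2norm f + l2norm g"
proof -
  have "abs_L2 f + abs_L2 g = abs_L2 (\<lambda>x. f x + g x)"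
    using assms by (intro plus_L2.abs_eq) auto
  then show ?thesis
    using norm_triangle_ineq[of "abs_L2 f" "abs_L2 g"] assms
    by (simp add: norm_abs_L2 square_integrable_add)
qed

lemma l2norm_cmult: "l2norm (\<lambda>x. c * f x) = cmod c * l2norm f"
proof -
  have "(LINT x|lborel. (cmod (c * f x))\<^sup>2) = (cmod c)\<^sup>2 * (LINT x|lborel. (cmod (f x))\<^sup>2)"
    by (simp add: norm_mult power_mult_distrib)
  then show ?thesis
    by (simp add: l2norm_def real_sqrt_mult)
qed

lemma l2norm_cong_norm: "(\<And>x. cmod (f x) = cmod (g x)) \<Longrightarrow> l2norm f = l2norm g"
  by (simp add: l2norm_def)

lemma square_integrable_bound:
  assumes "square_integrable g" "f \<in> borel_measurable borel" "\<And>x. cmod (f x) \<le> cmod (g x)"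
  shows "square_integrable f" "l2norm f \<le> l2norm g"
proof -
  have le: "(cmod (f x))\<^sup>2 \<le> (cmod (g x))\<^sup>2" for x
    using assms(3) by (intro power_mono) auto
  show f: "square_integrable f"
    unfolding square_integrable_def
  proof
    show "integrable lborel (\<lambda>x. (cmod (f x))\<^sup>2)"
      using le assms(2) by (intro Bochner_Integration.integrable_bound[OF square_integrableD(2)[OF assms(1)]]) auto
  qed (use assms in simp)
  show "l2norm f \<le> l2norm g"
    unfolding l2norm_def
    using le square_integrableD(2)[OF f] square_integrableD(2)[OF assms(1)]
    by (intro real_sqrt_le_mono integral_mono) auto
qed

lemma square_integrable_indicator:
  assumes "square_integrable f" "A \<in> sets borel"
  shows "square_integrable (\<lambda>x. indicator A x *\<^sub>R f x)" "l2norm (\<lambda>x. indicator A x *\<^sub>R f x) \<le> l2norm f"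
proof -
  have m: "(\<lambda>x. indicator A x *\<^sub>R f x) \<in> borel_measurable borel"
    using square_integrableD(1)[OF assms(1)] assms(2) by measurable
  have "cmod (indicator A x *\<^sub>R f x) \<le> cmod (f x)" for x
    by (simp add: indicator_def)
  then show "square_integrable (\<lambda>x. indicator A x *\<^sub>R f x)" "l2norm (\<lambda>x. indicator A x *\<^sub>R f x) \<le> l2norm f"
    using square_integrable_bound[OF assms(1) m] by auto
qed

lemma square_integrable_reflect:
  assumes "square_integrable f"
  shows "square_integrable (\<lambda>x. f (- x))" "l2norm (\<lambda>x. f (- x)) = l2norm f"
proof -
  have [measurable]: "f \<in> borel_measurable borel"
    using square_integrableD[OF assms] by simp
  show "square_integrable (\<lambda>x. f (- x))"
    unfolding square_integrable_def
    using lborel_integrable_real_affine[OF square_integrableD(2)[OF assms], of "-1" 0] by simp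
  show "l2norm (\<lambda>x. f (- x)) = l2norm f"
    using lborel_integral_real_affine[of "-1" "\<lambda>x. (cmod (f x))\<^sup>2" 0] by (simp add: l2norm_def)
qed

lemma square_integrable_shift:
  assumes "square_integrable f"
  shows "square_integrable (\<lambda>x. f (x - a))" "l2norm (\<lambda>x. f (x - a)) = l2norm f"
proof -
  have [measurable]: "f \<in> borel_measurable borel"
    using square_integrableD[OF assms] by simp
  show "square_integrable (\<lambda>x. f (x - a))"
    unfolding square_integrable_def
    using lborel_integrable_real_affine[OF square_integrableD(2)[OF assms], of 1 "- a"] by simp
  show "l2norm (\<lambda>x. f (x - a)) = l2norm f"
    using lborel_integral_real_affine[of 1 "\<lambda>x. (cmod (f x))\<^sup>2" "- a"] by (simp add: l2norm_def)
qed

lemma integrable_mult_square_integrable: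
  assumes "square_integrable f" "square_integrable g"
  shows "integrable lborel (\<lambda>x. f x * g x)" "cmod (LINT x|lborel. f x * g x) \<le> l2norm f * l2norm g"
proof -
  have [measurable]: "f \<in> borel_measurable borel" "g \<in> borel_measurable borel"
    using assms square_integrableD by auto
  let ?f = "\<lambda>x. complex_of_real (cmod (f x))" and ?g = "\<lambda>x. complex_of_real (cmod (g x))"
  have si: "square_integrable ?f" "square_integrable ?g" and nf: "l2norm ?f = l2norm f" "l2norm ?g = l2norm g"
    using square_integrable_bound(1)[OF assms(1), of ?f] square_integrable_bound(1)[OF assms(2), of ?g]
    by (auto simp: l2norm_def)
  have int: "integrable lborel (\<lambda>x. cmod (f x) * cmod (g x))"
    using square_integrable_inner[OF si] by (simp add: inner_complex_def)
  show "integrable lborel (\<lambda>x. f x * g x)"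
    by (rule Bochner_Integration.integrable_bound[OF int]) (auto simp: norm_mult)
  have "cmod (LINT x|lborel. f x * g x) \<le> (LINT x|lborel. cmod (f x) * cmod (g x))"
    using integral_norm_bound[of lborel "\<lambda>x. f x * g x"] by (simp add: norm_mult)
  also have "\<dots> = inner (abs_L2 ?f) (abs_L2 ?g)"
    using si by (subst inner_L2.abs_eq) (auto simp: inner_complex_def)
  also have "\<dots> \<le> norm (abs_L2 ?f) * norm (abs_L2 ?g)"
    by (rule norm_cauchy_schwarz)
  finally show "cmod (LINT x|lborel. f x * g x) \<le> l2norm f * l2norm g"
    using si nf by (simp add: norm_abs_L2)
qed

lemma square_integrableI_nn_integral:
  assumes [measurable]: "f \<in> borel_measurable borel"
    and le: "(\<integral>\<^sup>+ x. ennreal ((cmod (f x))\<^sup>2) \<partial>lborel) \<le> ennreal (B\<^sup>2)" and "0 \<le> B"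
  shows "square_integrable f" "l2norm f \<le> B"
proof -
  have int: "integrable lborel (\<lambda>x. (cmod (f x))\<^sup>2)"
    by (rule integrableI_bounded) (use le in \<open>auto simp: le_less_trans\<close>)
  then show "square_integrable f"
    by (simp add: square_integrable_def)
  have "ennreal (LINT x|lborel. (cmod (f x))\<^sup>2) \<le> ennreal (B\<^sup>2)"
    using le nn_integral_eq_integral[OF int] by simp
  then have "(LINT x|lborel. (cmod (f x))\<^sup>2) \<le> B\<^sup>2"
    by simp
  then show "l2norm f \<le> B"
    unfolding l2norm_def using \<open>0 \<le> B\<close> by (simp add: real_le_lsqrt)
qed

section \<open>First-order equations on the line\<close>

lemma nn_integral_exp_decay:
  fixes a :: real
  assumes "0 < a"
  shows "(\<integral>\<^sup>+ x. ennreal (exp (- (a * x))) * indicator {0..} x \<partial>lborel) = ennreal (1 / a)"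
proof -
  have "(\<integral>\<^sup>+ x. ennreal (exp (- (a * x))) * indicator {0..} x \<partial>lborel) = 0 - (- (exp (- (a * 0)) / a))"
  proof (rule nn_integral_FTC_atLeast)
    show "((\<lambda>x. - (exp (- (a * x)) / a)) has_real_derivative exp (- (a * x))) (at x)" for x
      using assms by (auto intro!: derivative_eq_intros)
    have "filterlim (\<lambda>x. a * x) at_top at_top"
      using assms by (intro filterlim_tendsto_pos_mult_at_top[OF tendsto_const]) (auto simp: filterlim_ident)
    then have "filterlim (\<lambda>x. - (a * x)) at_bot at_top"
      by (simp add: filterlim_uminus_at_bot)
    then have "((\<lambda>x. exp (- (a * x))) \<longlongrightarrow> 0) at_top"
      by (rule filterlim_compose[OF exp_at_bot])
    then have "((\<lambda>x. - (exp (- (a * x)) / a)) \<longlongrightarrow> - (0 / a)) at_top"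
      by (intro tendsto_intros) (use assms in auto)
    then show "((\<lambda>x. - (exp (- (a * x)) / a)) \<longlongrightarrow> 0) at_top" by simp
  qed auto
  then show ?thesis by simp
qed

lemma decay_square_integrable:
  fixes k :: complex
  assumes k: "0 < Re k"
  shows "square_integrable (\<lambda>x. indicator {0..} x *\<^sub>R exp (- (k * of_real x)))"
    "(l2norm (\<lambda>x. indicator {0..} x *\<^sub>R exp (- (k * of_real x))))\<^sup>2 = 1 / (2 * Re k)"
proof -
  let ?h = "\<lambda>x. indicator {0..} x *\<^sub>R exp (- (k * of_real x))"
  have meas: "?h \<in> borel_measurable borel" by measurable
  have sq: "(cmod (?h x))\<^sup>2 = exp (- (2 * Re k * x)) * indicator {0..} x" for x
    by (simp add: indicator_def power2_eq_square flip: exp_add)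
  have "(\<integral>\<^sup>+ x. ennreal ((cmod (?h x))\<^sup>2) \<partial>lborel) = ennreal (1 / (2 * Re k))"
    unfolding sq using nn_integral_exp_decay[of "2 * Re k"] k
    by (simp add: ennreal_mult' ennreal_indicator)
  then have nn: "(\<integral>\<^sup>+ x. ennreal ((cmod (?h x))\<^sup>2) \<partial>lborel) = ennreal (1 / (2 * Re k))" .
  then have "(\<integral>\<^sup>+ x. ennreal ((cmod (?h x))\<^sup>2) \<partial>lborel) \<le> ennreal ((sqrt (1 / (2 * Re k)))\<^sup>2)"
    using k by simp
  from square_integrableI_nn_integral(1)[OF meas this] k
  show si: "square_integrable ?h" by simp
  have "ennreal (LINT x|lborel. (cmod (?h x))\<^sup>2) = ennreal (1 / (2 * Re k))"
    using nn nn_integral_eq_integral[OF square_integrableD(2)[OF si]] by simp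
  then have "(LINT x|lborel. (cmod (?h x))\<^sup>2) = 1 / (2 * Re k)"
    using k by (subst (asm) ennreal_inj) auto
  then show "(l2norm ?h)\<^sup>2 = 1 / (2 * Re k)"
    by (simp add: l2norm_power2)
qed

text \<open>
For \<open>Re k > 0\<close> this is the only square-integrable solution of \<open>p' = k p - f\<close>.
\<close>
definition outgoing :: "complex \<Rightarrow> (real \<Rightarrow> complex) \<Rightarrow> real \<Rightarrow> complex" where
  "outgoing k f x = (LINT y:{x..}|lborel. exp (k * of_real (x - y)) * f y)"

context
  fixes k :: complex and f :: "real \<Rightarrow> complex"
  assumes k: "0 < Re k" and f: "square_integrable f"
begin

lemma outgoing_integrand:
  "indicator {x..} y *\<^sub>R (exp (k * of_real (x - y)) * f y)
    = (indicator {0..} (y - x) *\<^sub>R exp (- (k * of_real (y - x)))) * f y"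
  by (simp add: indicator_def algebra_simps)

lemma integrable_outgoing:
  "integrable lborel (\<lambda>y. indicator {x..} y *\<^sub>R (exp (k * of_real (x - y)) * f y))"
  unfolding outgoing_integrand
  by (rule integrable_mult_square_integrable(1)[OF square_integrable_shift(1)[OF decay_square_integrable(1)[OF k]] f])

lemma outgoing_le: "cmod (outgoing k f x) \<le> sqrt (1 / (2 * Re k)) * l2norm f"
proof -
  have "cmod (outgoing k f x) \<le> l2norm (\<lambda>y. indicator {0..} (y - x) *\<^sub>R exp (- (k * of_real (y - x)))) * l2norm f"
    unfolding outgoing_def set_lebesgue_integral_def outgoing_integrand
    by (rule integrable_mult_square_integrable(2)[OF square_integrable_shift(1)[OF decay_square_integrable(1)[OF k]] f])
  also have "l2norm (\<lambda>y. indicator {0..} (y - x) *\<^sub>R exp (- (k * of_real (y - x)))) = sqrt (1 / (2 * Re k))"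
    using square_integrable_shift(2)[OF decay_square_integrable(1)[OF k], of x]
      decay_square_integrable(2)[OF k] by (metis l2norm_nonneg real_sqrt_unique)
  finally show ?thesis .
qed

lemma measurable_outgoing: "outgoing k f \<in> borel_measurable borel"
proof -
  have [measurable]: "f \<in> borel_measurable borel"
    using square_integrableD[OF f] by simp
  have "(\<lambda>x. LINT y|lborel. indicator {z. fst z \<le> snd z} (x, y) *\<^sub>R (exp (k * of_real (x - y)) * f y)) \<in> borel_measurable borel"
    by measurable
  also have "(\<lambda>x. LINT y|lborel. indicator {z. fst z \<le> snd z} (x, y) *\<^sub>R (exp (k * of_real (x - y)) * f y)) = outgoing k f"
    by (simp add: outgoing_def set_lebesgue_integral_def fun_eq_iff indicator_def)
  finally show ?thesis .
qed

text \<open>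
Schur test: the kernel \<open>exp (- Re k (y - x))\<close> on \<open>x \<le> y\<close> has total mass \<open>1 / Re k\<close> in each of its two variables.
\<close>
lemma outgoing_square_integrable:
  "square_integrable (outgoing k f)" "l2norm (outgoing k f) \<le> l2norm f / Re k"
proof -
  have [measurable]: "f \<in> borel_measurable borel" "outgoing k f \<in> borel_measurable borel"
    using square_integrableD[OF f] measurable_outgoing by auto
  define \<kappa> where "\<kappa> = Re k"
  have \<kappa>: "0 < \<kappa>" using k by (simp add: \<kappa>_def)
  define W where "W = (\<lambda>s::real. ennreal (exp (- (\<kappa> * s))) * indicator {0..} s)"
  have [measurable]: "W \<in> borel_measurable borel" unfolding W_def by measurable
  have W: "(\<integral>\<^sup>+ s. W s \<partial>lborel) = ennreal (1 / \<kappa>)"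
    unfolding W_def by (rule nn_integral_exp_decay[OF \<kappa>])
  have Wy: "(\<integral>\<^sup>+ y. W (y - x) \<partial>lborel) = ennreal (1 / \<kappa>)" for x
    using nn_integral_real_affine[of W 1 "- x"] W by simp
  have Wx: "(\<integral>\<^sup>+ x. W (y - x) \<partial>lborel) = ennreal (1 / \<kappa>)" for y
    using nn_integral_real_affine[of W "-1" y] W by simp
  have pt: "ennreal ((cmod (outgoing k f x))\<^sup>2) \<le> ennreal (1 / \<kappa>) * (\<integral>\<^sup>+ y. W (y - x) * ennreal ((cmod (f y))\<^sup>2) \<partial>lborel)" for x
  proof -
    \<comment> \<open>Split the kernel into two equal square roots before applying the Cauchy-Schwarz inequality.\<close>
    let ?A = "\<lambda>y. ennreal (exp (- (\<kappa> * (y - x)) / 2) * indicator {0..} (y - x))"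
    let ?B = "\<lambda>y. ennreal (exp (- (\<kappa> * (y - x)) / 2) * indicator {0..} (y - x) * cmod (f y))"
    have "ennreal (cmod (outgoing k f x)) \<le>
        (\<integral>\<^sup>+ y. ennreal (norm (indicator {x..} y *\<^sub>R (exp (k * of_real (x - y)) * f y))) \<partial>lborel)"
      unfolding outgoing_def set_lebesgue_integral_def
      by (rule integral_norm_bound_ennreal[OF integrable_outgoing])
    also have "\<dots> = (\<integral>\<^sup>+ y. ?A y * ?B y \<partial>lborel)"
    proof (rule nn_integral_cong)
      fix y
      have "exp (\<kappa> * (x - y)) = exp (- (\<kappa> * (y - x)) / 2) * exp (- (\<kappa> * (y - x)) / 2)"
        by (simp add: algebra_simps flip: exp_add)
      then show "ennreal (norm (indicator {x..} y *\<^sub>R (exp (k * of_real (x - y)) * f y))) = ?A y * ?B y"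
        by (cases "x \<le> y") (simp_all add: norm_mult \<kappa>_def ennreal_mult[symmetric] mult.assoc)
    qed
    finally have "(ennreal (cmod (outgoing k f x)))\<^sup>2 \<le> (\<integral>\<^sup>+ y. ?A y * ?B y \<partial>lborel)\<^sup>2"
      by (intro power_mono) auto
    also have "\<dots> \<le> (\<integral>\<^sup>+ y. (?A y)\<^sup>2 \<partial>lborel) * (\<integral>\<^sup>+ y. (?B y)\<^sup>2 \<partial>lborel)"
      by (rule Cauchy_Schwarz_nn_integral) measurable
    also have "(\<integral>\<^sup>+ y. (?A y)\<^sup>2 \<partial>lborel) = (\<integral>\<^sup>+ y. W (y - x) \<partial>lborel)"
      unfolding W_def
      by (intro nn_integral_cong)
        (auto simp: indicator_def power2_eq_square ennreal_mult[symmetric] simp flip: exp_add)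
    also have "(\<integral>\<^sup>+ y. (?B y)\<^sup>2 \<partial>lborel) = (\<integral>\<^sup>+ y. W (y - x) * ennreal ((cmod (f y))\<^sup>2) \<partial>lborel)"
      unfolding W_def
    proof (intro nn_integral_cong)
      fix y
      have "(exp (- (\<kappa> * (y - x)) / 2) * cmod (f y))\<^sup>2 = exp (- (\<kappa> * (y - x))) * (cmod (f y))\<^sup>2"
        by (simp add: power_mult_distrib power2_eq_square[of "exp _"] flip: exp_add)
      then show "(?B y)\<^sup>2 = ennreal (exp (- (\<kappa> * (y - x)))) * indicator {0..} (y - x) * ennreal ((cmod (f y))\<^sup>2)"
        by (cases "x \<le> y") (simp_all add: ennreal_power ennreal_mult[symmetric])
    qed
    finally show ?thesis
      using Wy by (simp add: ennreal_power)
  qed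
  have "(\<integral>\<^sup>+ x. ennreal ((cmod (outgoing k f x))\<^sup>2) \<partial>lborel)
      \<le> (\<integral>\<^sup>+ x. ennreal (1 / \<kappa>) * (\<integral>\<^sup>+ y. W (y - x) * ennreal ((cmod (f y))\<^sup>2) \<partial>lborel) \<partial>lborel)"
    by (intro nn_integral_mono pt)
  also have "\<dots> = ennreal (1 / \<kappa>) * (\<integral>\<^sup>+ x. \<integral>\<^sup>+ y. W (y - x) * ennreal ((cmod (f y))\<^sup>2) \<partial>lborel \<partial>lborel)"
    by (rule nn_integral_cmult) measurable
  also have "(\<integral>\<^sup>+ x. \<integral>\<^sup>+ y. W (y - x) * ennreal ((cmod (f y))\<^sup>2) \<partial>lborel \<partial>lborel)
      = (\<integral>\<^sup>+ y. \<integral>\<^sup>+ x. W (y - x) * ennreal ((cmod (f y))\<^sup>2) \<partial>lborel \<partial>lborel)"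
    by (rule lborel_pair.Fubini'[symmetric]) measurable
  also have "\<dots> = (\<integral>\<^sup>+ y. ennreal (1 / \<kappa>) * ennreal ((cmod (f y))\<^sup>2) \<partial>lborel)"
    by (subst nn_integral_multc) (auto simp: Wx)
  also have "\<dots> = ennreal (1 / \<kappa>) * ennreal (LINT y|lborel. (cmod (f y))\<^sup>2)"
    by (subst nn_integral_cmult) (auto simp: nn_integral_eq_integral[OF square_integrableD(2)[OF f]])
  also have "ennreal (1 / \<kappa>) * (ennreal (1 / \<kappa>) * ennreal (LINT y|lborel. (cmod (f y))\<^sup>2)) = ennreal ((l2norm f / \<kappa>)\<^sup>2)"
    using \<kappa> by (simp add: ennreal_mult[symmetric] l2norm_power2 power_divide power2_eq_square[of \<kappa>])
  finally have "(\<integral>\<^sup>+ x. ennreal ((cmod (outgoing k f x))\<^sup>2) \<partial>lborel) \<le> ennreal ((l2norm f / \<kappa>)\<^sup>2)" .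
  from square_integrableI_nn_integral[OF _ this] \<kappa>
  show "square_integrable (outgoing k f)" "l2norm (outgoing k f) \<le> l2norm f / Re k"
    using l2norm_nonneg[of f] by (auto simp: \<kappa>_def)
qed

text \<open>
The source \<open>f\<close> need not be continuous, so the differential equation is stated in integrated form. It follows by integrating the
kernel in \<open>x\<close> first.
\<close>
lemma outgoing_primitive:
  assumes ab: "a \<le> b"
  shows "outgoing k f b - outgoing k f a = (LINT x:{a..b}|lborel. k * outgoing k f x - f x)"
proof -
  have [measurable]: "f \<in> borel_measurable borel"
    using square_integrableD[OF f] by simp
  let ?e = "\<lambda>x y. exp (k * of_real (x - y))"
  define G where "G = (\<lambda>y. cmod k *\<^sub>R (indicator {a..} y *\<^sub>R (?e b y * f y)))"
  have outgoing_int: "integrable lborel (\<lambda>y. indicator {a..} y *\<^sub>R (?e b y * f y))"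
  proof -
    define c where "c = exp (k * of_real (b - a))"
    have "?e b y = c * ?e a y" for y
      unfolding c_def by (subst exp_add[symmetric], rule arg_cong[where f = exp]) (simp add: algebra_simps)
    then have "(\<lambda>y. indicator {a..} y *\<^sub>R (?e b y * f y)) =
        (\<lambda>y. c * (indicator {a..} y *\<^sub>R (?e a y * f y)))"
      by (intro ext) (simp only: mult_scaleR_right mult.assoc)
    then show ?thesis
      using integrable_mult_right[OF integrable_outgoing[of a], of c] by simp
  qed
  have G: "integrable lborel G"
    unfolding G_def by (intro integrable_scaleR_right outgoing_int)
  have ind: "integrable lborel (indicator {a..b} :: real \<Rightarrow> real)"
    by (auto simp: emeasure_lborel_Icc_eq)
  define H where "H = (\<lambda>x y. indicator {a..b} x *\<^sub>R (indicator {x..} y *\<^sub>R (k * (?e x y * f y))))"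
  have Hint: "integrable (lborel \<Otimes>\<^sub>M lborel) (case_prod H)"
  proof (rule Bochner_Integration.integrable_bound[OF integrable_pair_scaleR[OF ind G]])
    have "(\<lambda>(x, y). indicator {a..b} x *\<^sub>R (indicator {z. fst z \<le> snd z} (x, y) *\<^sub>R (k * (?e x y * f y)))) \<in> borel_measurable (lborel \<Otimes>\<^sub>M lborel)"
      by measurable
    also have "(\<lambda>(x, y). indicator {a..b} x *\<^sub>R (indicator {z. fst z \<le> snd z} (x, y) *\<^sub>R (k * (?e x y * f y)))) = case_prod H"
      by (auto simp: H_def fun_eq_iff indicator_def)
    finally show "case_prod H \<in> borel_measurable (lborel \<Otimes>\<^sub>M lborel)" .
    have "cmod (H x y) \<le> cmod (indicator {a..b} x *\<^sub>R G y)" for x y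
    proof (cases "x \<in> {a..b} \<and> x \<le> y")
      case True
      have "exp (Re k * (x - y)) \<le> exp (Re k * (b - y))"
        using True k by (simp add: mult_left_mono)
      then show ?thesis
        using True by (auto simp: H_def G_def norm_mult intro!: mult_left_mono mult_right_mono)
    qed (auto simp: H_def)
    then show "AE z in lborel \<Otimes>\<^sub>M lborel. cmod (case z of (x, y) \<Rightarrow> H x y) \<le> cmod (case z of (x, y) \<Rightarrow> indicator {a..b} x *\<^sub>R G y)"
      by (intro AE_I2) auto
  qed
  have inner_y: "(LINT y|lborel. H x y) = indicator {a..b} x *\<^sub>R (k * outgoing k f x)" for x
  proof -
    have "(LINT y|lborel. H x y) = indicator {a..b} x *\<^sub>R (LINT y|lborel. k * (indicator {x..} y *\<^sub>R (?e x y * f y)))"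
      unfolding H_def by (simp only: integral_scaleR_right mult_scaleR_right)
    then show ?thesis
      by (simp only: integral_mult_right_zero outgoing_def set_lebesgue_integral_def)
  qed
  have FTC: "(LINT x|lborel. indicator {a..c} x *\<^sub>R (k * ?e x y)) = ?e c y - ?e a y" if "a \<le> c" for c y
  proof (rule integral_FTC_Icc[OF that])
    show "((\<lambda>x. ?e x y) has_vector_derivative k * ?e x y) (at x within {a..c})" for x
      unfolding of_real_diff
      by (rule has_vector_derivative_real_field) (auto intro!: derivative_eq_intros)
    show "continuous_on {a..c} (\<lambda>x. k * ?e x y)" by (intro continuous_intros)
  qed
  have inner_x: "(LINT x|lborel. H x y) =
      indicator {a..b} y *\<^sub>R f y + indicator {b..} y *\<^sub>R (?e b y * f y) - indicator {a..} y *\<^sub>R (?e a y * f y)"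
    if "y \<noteq> b" for y
  proof (cases "a \<le> y")
    case True
    have "(LINT x|lborel. H x y) = (LINT x|lborel. (indicator {a..min b y} x *\<^sub>R (k * ?e x y)) * f y)"
      using True by (intro Bochner_Integration.integral_cong) (auto simp: H_def indicator_def)
    also have "\<dots> = (?e (min b y) y - ?e a y) * f y"
      using FTC[of "min b y" y] True ab by (simp only: integral_mult_left_zero min.bounded_iff)
    finally show ?thesis
      using True that by (cases "y < b") (auto simp: algebra_simps min_def)
  next
    case False
    then have "H x y = 0" for x by (auto simp: H_def indicator_def)
    then show ?thesis using False ab by simp
  qed
  have fint: "integrable lborel (\<lambda>y. indicator {a..b} y *\<^sub>R f y)"
    using locally_integrableD[OF locally_integrable_square_integrable[OF f]] by (simp add: set_integrable_def)
  have "(LINT x|lborel. indicator {a..b} x *\<^sub>R (k * outgoing k f x)) = (LINT x|lborel. LINT y|lborel. H x y)"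
    by (simp only: inner_y)
  also have "\<dots> = (LINT y|lborel. LINT x|lborel. H x y)"
    using lborel_pair.Fubini_integral[OF Hint] by simp
  also have "\<dots> = (LINT y|lborel. indicator {a..b} y *\<^sub>R f y + indicator {b..} y *\<^sub>R (?e b y * f y) - indicator {a..} y *\<^sub>R (?e a y * f y))"
  proof (rule integral_cong_AE)
    show "(\<lambda>y. LINT x|lborel. H x y) \<in> borel_measurable lborel"
      using lborel_pair.integrable_snd[OF Hint] by (rule borel_measurable_integrable)
    show "(\<lambda>y. indicator {a..b} y *\<^sub>R f y + indicator {b..} y *\<^sub>R (?e b y * f y) - indicator {a..} y *\<^sub>R (?e a y * f y)) \<in> borel_measurable lborel"
      by measurable
    show "AE y in lborel. (LINT x|lborel. H x y) = indicator {a..b} y *\<^sub>R f y + indicator {b..} y *\<^sub>R (?e b y * f y) - indicator {a..} y *\<^sub>R (?e a y * f y)"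
      using AE_lborel_singleton[of b] by (rule eventually_mono) (rule inner_x)
  qed
  also have "\<dots> = (LINT y|lborel. indicator {a..b} y *\<^sub>R f y) + outgoing k f b - outgoing k f a"
    unfolding outgoing_def set_lebesgue_integral_def
    by (simp only: Bochner_Integration.integral_add[OF fint integrable_outgoing]
        Bochner_Integration.integral_diff[OF Bochner_Integration.integrable_add[OF fint integrable_outgoing] integrable_outgoing])
  finally have *: "(LINT x:{a..b}|lborel. k * outgoing k f x) = (LINT y:{a..b}|lborel. f y) + outgoing k f b - outgoing k f a"
    by (simp only: set_lebesgue_integral_def)
  have "set_integrable lborel {a..b} (\<lambda>x. k * outgoing k f x)" "set_integrable lborel {a..b} f"
    by (intro locally_integrableD locally_integrable_square_integrable square_integrable_cmult
        outgoing_square_integrable(1) f)+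
  then show ?thesis
    using * by (simp add: set_integral_diff)
qed

end

section \<open>Indefinite integrals on intervals\<close>

text \<open>
On an interval this says that \<open>F\<close> is locally absolutely continuous with derivative \<open>g\<close> almost everywhere.
\<close>
definition primitive_on :: "real set \<Rightarrow> (real \<Rightarrow> complex) \<Rightarrow> (real \<Rightarrow> complex) \<Rightarrow> bool" where
  "primitive_on A F g \<longleftrightarrow>
     (\<forall>a b. a \<le> b \<longrightarrow> {a..b} \<subseteq> A \<longrightarrow> F b - F a = (LINT x:{a..b}|lborel. g x))"

lemma primitive_onD: "primitive_on A F g \<Longrightarrow> a \<le> b \<Longrightarrow> {a..b} \<subseteq> A \<Longrightarrow> F b - F a = (LINT x:{a..b}|lborel. g x)"
  by (simp add: primitive_on_def)

lemma primitive_on_lincomb: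
  assumes "primitive_on A F f" "primitive_on A G g" "locally_integrable f" "locally_integrable g"
  shows "primitive_on A (\<lambda>x. F x + c * G x) (\<lambda>x. f x + c * g x)"
  unfolding primitive_on_def
proof (intro allI impI)
  fix a b :: real assume ab: "a \<le> b" "{a..b} \<subseteq> A"
  have "(LINT x:{a..b}|lborel. f x + c * g x) = (LINT x:{a..b}|lborel. f x) + c * (LINT x:{a..b}|lborel. g x)"
    using locally_integrableD[OF assms(3)] locally_integrableD[OF assms(4)]
    by (subst set_integral_add(2)) auto
  also have "\<dots> = (F b - F a) + c * (G b - G a)"
    using assms(1,2) ab by (simp add: primitive_on_def)
  finally show "F b + c * G b - (F a + c * G a) = (LINT x:{a..b}|lborel. f x + c * g x)"
    by (simp add: algebra_simps)
qed

lemma primitive_on_reflect: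
  assumes "primitive_on A F f"
  shows "primitive_on {x. - x \<in> A} (\<lambda>x. F (- x)) (\<lambda>x. - f (- x))"
  unfolding primitive_on_def
proof (intro allI impI)
  fix a b :: real assume ab: "a \<le> b" "{a..b} \<subseteq> {x. - x \<in> A}"
  have sub: "{- b..- a} \<subseteq> A"
  proof
    fix x assume "x \<in> {- b..- a}"
    then have "- x \<in> {a..b}" by auto
    then show "x \<in> A" using ab(2) by fastforce
  qed
  have "{x. - x \<in> {- b..- a}} = {a..b}" by auto
  then have "(LINT x:{- b..- a}|lborel. f x) = (LINT x:{a..b}|lborel. f (- x))"
    by (subst set_integral_reflect) simp
  then show "F (- b) - F (- a) = (LINT x:{a..b}|lborel. - f (- x))"
    using primitive_onD[OF assms _ sub] ab(1)
    by (simp add: set_lebesgue_integral_def algebra_simps)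
qed

text \<open>
One exceptional point is allowed in the integrand, for the origin, where the two half-line equations need not agree.
\<close>
lemma primitive_on_cong:
  assumes "primitive_on A F g" "\<And>x. x \<in> A \<Longrightarrow> F' x = F x" "\<And>x. x \<in> A \<Longrightarrow> x \<noteq> p \<Longrightarrow> g' x = g x"
  shows "primitive_on A F' g'"
  unfolding primitive_on_def
proof (intro allI impI)
  fix a b :: real assume ab: "a \<le> b" "{a..b} \<subseteq> A"
  have "(LINT x:{a..b}|lborel. g' x) = (LINT x:{a..b}|lborel. g x)"
    unfolding set_lebesgue_integral_def
    by (rule integral_discrete_difference[where X = "{p}"]) (use ab assms(3) in \<open>auto simp: indicator_def\<close>)
  moreover have "a \<in> A" "b \<in> A" using ab by auto
  ultimately show "F' b - F' a = (LINT x:{a..b}|lborel. g' x)"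
    using primitive_onD[OF assms(1) ab] assms(2) by simp
qed

lemma set_integral_Icc_split:
  assumes "locally_integrable g" "a \<le> b" "b \<le> c"
  shows "(LINT x:{a..c}|lborel. g x) = (LINT x:{a..b}|lborel. g x) + (LINT x:{b..c}|lborel. g x)"
proof -
  have "{a..c} = {a..b} \<union> {b..c}" using assms by auto
  moreover have "AE x in lborel. \<not> (x \<in> {a..b} \<and> x \<in> {b..c})"
    using AE_lborel_singleton[of b] by (rule eventually_mono) auto
  ultimately show ?thesis
    using locally_integrableD[OF assms(1)] by (simp add: set_integral_Un_AE)
qed

lemma primitive_on_glue:
  assumes "primitive_on {..p} F g" "primitive_on {p..} F g" "locally_integrable g"
  shows "primitive_on UNIV F g"
  unfolding primitive_on_def
proof (intro allI impI)
  fix a b :: real assume ab: "a \<le> b"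
  consider "b \<le> p" | "p \<le> a" | "a < p" "p < b" by linarith
  then show "F b - F a = (LINT x:{a..b}|lborel. g x)"
  proof cases
    case 1 then show ?thesis using primitive_onD[OF assms(1) ab] by auto
  next
    case 2 then show ?thesis using primitive_onD[OF assms(2) ab] by auto
  next
    case 3
    have "(LINT x:{a..b}|lborel. g x) = (LINT x:{a..p}|lborel. g x) + (LINT x:{p..b}|lborel. g x)"
      using 3 by (intro set_integral_Icc_split[OF assms(3)]) auto
    moreover have "F p - F a = (LINT x:{a..p}|lborel. g x)"
      by (rule primitive_onD[OF assms(1)]) (use 3 in auto)
    moreover have "F b - F p = (LINT x:{p..b}|lborel. g x)"
      by (rule primitive_onD[OF assms(2)]) (use 3 in auto)
    ultimately show ?thesis by (simp add: algebra_simps)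
  qed
qed

lemma primitive_on_exp:
  "primitive_on A (\<lambda>x. exp (- (k * of_real x))) (\<lambda>x. - k * exp (- (k * of_real x)))"
  unfolding primitive_on_def set_lebesgue_integral_def
proof (intro allI impI)
  fix a b :: real assume ab: "a \<le> b"
  show "exp (- (k * of_real b)) - exp (- (k * of_real a)) =
      (LINT x|lborel. indicator {a..b} x *\<^sub>R (- k * exp (- (k * of_real x))))"
  proof (rule integral_FTC_Icc[OF ab, symmetric])
    show "((\<lambda>x. exp (- (k * of_real x))) has_vector_derivative - k * exp (- (k * of_real x))) (at x within {a..b})" for x
      by (rule has_vector_derivative_real_field) (auto intro!: derivative_eq_intros)
    show "continuous_on {a..b} (\<lambda>x. - k * exp (- (k * of_real x)))" by (intro continuous_intros)
  qed
qed

section \<open>Second-order equations on a half-line\<close>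

text \<open>
The mirror image of \<open>outgoing\<close>: the square-integrable solution of \<open>q' = f - k q\<close>.
\<close>
definition incoming :: "complex \<Rightarrow> (real \<Rightarrow> complex) \<Rightarrow> real \<Rightarrow> complex" where
  "incoming k f x = outgoing k (\<lambda>y. f (- y)) (- x)"

lemma incoming_square_integrable:
  assumes "0 < Re k" "square_integrable f"
  shows "square_integrable (incoming k f)" "l2norm (incoming k f) \<le> l2norm f / Re k"
proof -
  note r = square_integrable_reflect[OF assms(2)]
  note o = outgoing_square_integrable[OF assms(1) r(1)]
  show "square_integrable (incoming k f)"
    using square_integrable_reflect(1)[OF o(1)] by (simp add: incoming_def[abs_def])
  show "l2norm (incoming k f) \<le> l2norm f / Re k"
    using square_integrable_reflect(2)[OF o(1)] o(2) r(2) by (simp add: incoming_def[abs_def])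
qed

lemma incoming_primitive:
  assumes "0 < Re k" "square_integrable f"
  shows "primitive_on A (incoming k f) (\<lambda>x. f x - k * incoming k f x)"
proof -
  have "primitive_on UNIV (outgoing k (\<lambda>y. f (- y))) (\<lambda>x. k * outgoing k (\<lambda>y. f (- y)) x - f (- x))"
    using outgoing_primitive[OF assms(1) square_integrable_reflect(1)[OF assms(2)]]
    by (simp add: primitive_on_def)
  from primitive_on_reflect[OF this] show ?thesis
    by (simp add: incoming_def[abs_def] primitive_on_def)
qed

text \<open>
Variation of constants for \<open>- u'' + k\<^sup>2 u = g\<close> on the positive half-line with \<open>u 0 = c\<close>. The outgoing and the incoming
solution together solve the equation, and a multiple of the decaying exponential corrects the boundary value.
\<close>
definition halfline_solution :: "complex \<Rightarrow> (real \<Rightarrow> complex) \<Rightarrow> complex \<Rightarrow> real \<Rightarrow> complex" where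
  "halfline_solution k g c x =
     1 / (2 * k) * (outgoing k g x + incoming k g x + (2 * k * c - outgoing k g 0) * exp (- (k * of_real x)))"

definition halfline_solution_deriv :: "complex \<Rightarrow> (real \<Rightarrow> complex) \<Rightarrow> complex \<Rightarrow> real \<Rightarrow> complex" where
  "halfline_solution_deriv k g c x =
     1 / 2 * (outgoing k g x - incoming k g x - (2 * k * c - outgoing k g 0) * exp (- (k * of_real x)))"

text \<open>
With value 0 at the origin the solution is that of the Dirichlet problem.
\<close>
lemma halfline_solution_split:
  "k \<noteq> 0 \<Longrightarrow> halfline_solution k g c x = c * exp (- (k * of_real x)) + halfline_solution k g 0 x"
  by (simp add: halfline_solution_def field_simps)

lemma locally_integrable_exp: "locally_integrable (\<lambda>x. a * exp (- (k * of_real x)))"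
  by (rule locally_integrable_continuous) (intro continuous_intros)

lemma locally_integrable_add:
  "locally_integrable f \<Longrightarrow> locally_integrable g \<Longrightarrow> locally_integrable (\<lambda>x. f x + g x)"
  by (simp add: locally_integrable_def set_integral_add)

lemma locally_integrable_cmult: "locally_integrable f \<Longrightarrow> locally_integrable (\<lambda>x. c * f x)"
  by (simp add: locally_integrable_def)

context
  fixes k :: complex and g :: "real \<Rightarrow> complex"
  assumes k: "0 < Re k" and g: "square_integrable g"
begin

lemma outgoing_primitive_on: "primitive_on A (outgoing k g) (\<lambda>x. k * outgoing k g x - g x)"
  using outgoing_primitive[OF k g] by (simp add: primitive_on_def)

lemma halfline_primitives:
  "primitive_on A (halfline_solution k g c) (halfline_solution_deriv k g c)"
  "primitive_on A (halfline_solution_deriv k g c) (\<lambda>x. k\<^sup>2 * halfline_solution k g c x - g x)"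
proof -
  have k0: "k \<noteq> 0" using k by auto
  define \<alpha> where "\<alpha> = 2 * k * c - outgoing k g 0"
  let ?O = "outgoing k g" and ?I = "incoming k g" and ?E = "\<lambda>x. exp (- (k * of_real x))"
  let ?O' = "\<lambda>x. k * ?O x - g x" and ?I' = "\<lambda>x. g x - k * ?I x" and ?E' = "\<lambda>x. - k * ?E x"
  have lg: "locally_integrable g" by (rule locally_integrable_square_integrable[OF g])
  have lO: "locally_integrable ?O'"
    by (intro locally_integrable_diff locally_integrable_cmult lg
        locally_integrable_square_integrable outgoing_square_integrable(1) k g)
  have lI: "locally_integrable ?I'"
    by (intro locally_integrable_diff locally_integrable_cmult lg
        locally_integrable_square_integrable incoming_square_integrable(1) k g)
  note lE = locally_integrable_exp[of "- k" k]
  have zero: "primitive_on A (\<lambda>x. 0) (\<lambda>x. 0)" "locally_integrable (\<lambda>x. 0)"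
    by (simp_all add: primitive_on_def set_lebesgue_integral_def locally_integrable_def set_integrable_def)
  have comb: "primitive_on A (\<lambda>x. 0 + d * ((?O x + e * ?I x) + e' * ?E x)) (\<lambda>x. 0 + d * ((?O' x + e * ?I' x) + e' * ?E' x))" for d e e'
    by (intro primitive_on_lincomb zero outgoing_primitive_on incoming_primitive k g primitive_on_exp lO lI lE
        locally_integrable_add locally_integrable_cmult)
  show "primitive_on A (halfline_solution k g c) (halfline_solution_deriv k g c)"
    by (rule primitive_on_cong[OF comb[of "1 / (2 * k)" 1 \<alpha>]])
      (use k0 in \<open>unfold halfline_solution_def halfline_solution_deriv_def \<alpha>_def[symmetric], simp_all add: field_simps\<close>)
  show "primitive_on A (halfline_solution_deriv k g c) (\<lambda>x. k\<^sup>2 * halfline_solution k g c x - g x)"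
    by (rule primitive_on_cong[OF comb[of "1 / 2" "- 1" "- \<alpha>"]])
      (use k0 in \<open>unfold halfline_solution_def halfline_solution_deriv_def \<alpha>_def[symmetric], simp_all add: field_simps power2_eq_square\<close>)
qed

lemma halfline_square_integrable:
  "square_integrable (\<lambda>x. indicator {0..} x *\<^sub>R halfline_solution k g c x)"
  "square_integrable (\<lambda>x. indicator {0..} x *\<^sub>R halfline_solution_deriv k g c x)"
proof -
  let ?O = "\<lambda>x. indicator {0..} x *\<^sub>R outgoing k g x" and ?I = "\<lambda>x. indicator {0..} x *\<^sub>R incoming k g x"
    and ?E = "\<lambda>x. indicator {0..} x *\<^sub>R exp (- (k * of_real x))"
  have O: "square_integrable ?O" and I: "square_integrable ?I"
    using square_integrable_indicator(1)[OF outgoing_square_integrable(1)[OF k g]]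
      square_integrable_indicator(1)[OF incoming_square_integrable(1)[OF k g]] by auto
  have comb: "square_integrable (\<lambda>x. d * ((?O x + e * ?I x) + e' * ?E x))" for d e e'
    by (intro square_integrable_cmult square_integrable_add O I decay_square_integrable k)
  have eq1: "(\<lambda>x. indicator {0..} x *\<^sub>R halfline_solution k g c x) =
      (\<lambda>x. 1 / (2 * k) * ((?O x + 1 * ?I x) + (2 * k * c - outgoing k g 0) * ?E x))"
    by (simp only: halfline_solution_def scaleR_conv_of_real distrib_left mult_1 mult.left_commute mult.assoc)
  show "square_integrable (\<lambda>x. indicator {0..} x *\<^sub>R halfline_solution k g c x)"
    using comb[of "1 / (2 * k)" 1 "2 * k * c - outgoing k g 0"] by (simp only: eq1)
  have eq2: "(\<lambda>x. indicator {0..} x *\<^sub>R halfline_solution_deriv k g c x) =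
      (\<lambda>x. 1 / 2 * ((?O x + (- 1) * ?I x) + (- (2 * k * c - outgoing k g 0)) * ?E x))"
    by (intro ext) (simp add: halfline_solution_deriv_def scaleR_conv_of_real algebra_simps)
  show "square_integrable (\<lambda>x. indicator {0..} x *\<^sub>R halfline_solution_deriv k g c x)"
    using comb[of "1 / 2" "- 1" "- (2 * k * c - outgoing k g 0)"] by (simp only: eq2)
qed

text \<open>
Two Schur bounds \<open>1 / Re k\<close> and the boundary term \<open>1 / (2 Re k)\<close> add up to \<open>5 / (2 Re k)\<close>; the prefactor
of the solution formula contributes \<open>1 / (2 \<bar>k\<bar>)\<close>.
\<close>
lemma Dirichlet_bound:
  "l2norm (\<lambda>x. indicator {0..} x *\<^sub>R halfline_solution k g 0 x) \<le> 5 / (4 * cmod k * Re k) * l2norm g"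
proof -
  have k0: "cmod k > 0" using k by auto
  let ?O = "\<lambda>x. indicator {0..} x *\<^sub>R outgoing k g x" and ?I = "\<lambda>x. indicator {0..} x *\<^sub>R incoming k g x"
    and ?E = "\<lambda>x. indicator {0..} x *\<^sub>R exp (- (k * of_real x))"
  define r where "r = sqrt (1 / (2 * Re k))"
  have r: "r * r = 1 / (2 * Re k)" "0 \<le> r" using k by (auto simp: r_def)
  have O: "square_integrable ?O" "l2norm ?O \<le> l2norm g / Re k"
    using square_integrable_indicator[OF outgoing_square_integrable(1)[OF k g], of "{0..}"]
      outgoing_square_integrable(2)[OF k g] by auto
  have I: "square_integrable ?I" "l2norm ?I \<le> l2norm g / Re k"
    using square_integrable_indicator[OF incoming_square_integrable(1)[OF k g], of "{0..}"]
      incoming_square_integrable(2)[OF k g] by auto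
  have E: "square_integrable ?E" "l2norm ?E = r"
    using decay_square_integrable[OF k] l2norm_nonneg[of ?E] unfolding r_def
    by (auto simp: real_sqrt_unique)
  let ?a = "- outgoing k g 0"
  have "(\<lambda>x. indicator {0..} x *\<^sub>R halfline_solution k g 0 x) = (\<lambda>x. 1 / (2 * k) * ((?O x + ?I x) + ?a * ?E x))"
    by (simp add: halfline_solution_def scaleR_conv_of_real algebra_simps)
  then have eq: "l2norm (\<lambda>x. indicator {0..} x *\<^sub>R halfline_solution k g 0 x)
      = 1 / (2 * cmod k) * l2norm (\<lambda>x. (?O x + ?I x) + ?a * ?E x)"
    by (simp only: l2norm_cmult norm_divide norm_mult norm_one norm_numeral)
  have tri: "l2norm (\<lambda>x. (?O x + ?I x) + ?a * ?E x) \<le> (l2norm ?O + l2norm ?I) + cmod ?a * l2norm ?E"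
    using l2norm_add[OF square_integrable_add[OF O(1) I(1)] square_integrable_cmult[OF E(1), of ?a]]
      l2norm_add[OF O(1) I(1)] by (simp only: l2norm_cmult)
  have "cmod ?a \<le> r * l2norm g"
    using outgoing_le[OF k g, of 0] by (simp add: r_def)
  then have "cmod ?a * l2norm ?E \<le> (r * l2norm g) * r"
    unfolding E(2) using r(2) by (rule mult_right_mono)
  also have "(r * l2norm g) * r = 1 / (2 * Re k) * l2norm g"
    unfolding r(1)[symmetric] by (simp only: mult.assoc mult.commute mult.left_commute)
  finally have "l2norm (\<lambda>x. (?O x + ?I x) + ?a * ?E x) \<le> l2norm g / Re k + l2norm g / Re k + 1 / (2 * Re k) * l2norm g"
    using tri O(2) I(2) by linarith
  also have "\<dots> = 5 / (2 * Re k) * l2norm g"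
    using k by (simp add: field_simps)
  finally have "1 / (2 * cmod k) * l2norm (\<lambda>x. (?O x + ?I x) + ?a * ?E x) \<le> 1 / (2 * cmod k) * (5 / (2 * Re k) * l2norm g)"
    using k0 by (intro mult_left_mono) auto
  then show ?thesis
    unfolding eq by (simp add: mult.assoc)
qed

lemma halfline_boundary_values:
  assumes "\<And>x. x < 0 \<Longrightarrow> g x = 0"
  shows "halfline_solution k g c 0 = c" "halfline_solution_deriv k g c 0 = outgoing k g 0 - k * c"
proof -
  have k0: "k \<noteq> 0" using k by auto
  have "incoming k g 0 = integral\<^sup>L lborel (\<lambda>y::real. 0::complex)"
    unfolding incoming_def outgoing_def set_lebesgue_integral_def
    by (rule integral_discrete_difference[where X = "{0::real}"]) (auto simp: indicator_def assms)
  then have "incoming k g 0 = 0" by simp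
  then show "halfline_solution k g c 0 = c" "halfline_solution_deriv k g c 0 = outgoing k g 0 - k * c"
    using k0 by (auto simp: halfline_solution_def halfline_solution_deriv_def field_simps)
qed

end

text \<open>
Both arguments are functions of the distance to the origin, which allows the left half-line to be treated as a second copy of the
right one.
\<close>
definition two_sided :: "(real \<Rightarrow> complex) \<Rightarrow> (real \<Rightarrow> complex) \<Rightarrow> real \<Rightarrow> complex" where
  "two_sided p m x = (if 0 \<le> x then p x else m (- x))"

lemma two_sided_l2:
  assumes "square_integrable (\<lambda>x. indicator {0..} x *\<^sub>R p x)" "square_integrable (\<lambda>x. indicator {0..} x *\<^sub>R m x)"
  shows "square_integrable (two_sided p m)"
    "(l2norm (two_sided p m))\<^sup>2 = (l2norm (\<lambda>x. indicator {0..} x *\<^sub>R p x))\<^sup>2 + (l2norm (\<lambda>x. indicator {0..} x *\<^sub>R m x))\<^sup>2"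
    "l2norm (two_sided p m) \<le> l2norm (\<lambda>x. indicator {0..} x *\<^sub>R p x) + l2norm (\<lambda>x. indicator {0..} x *\<^sub>R m x)"
proof -
  let ?p = "\<lambda>x. indicator {0..} x *\<^sub>R p x" and ?m = "\<lambda>x. indicator {0..} x *\<^sub>R m x"
  note rm = square_integrable_reflect[OF assms(2)]
  note lm = square_integrable_indicator[OF rm(1), of "{..<0}"]
  have eq: "two_sided p m = (\<lambda>x. ?p x + indicator {..<0} x *\<^sub>R ?m (- x))"
    by (auto simp: two_sided_def fun_eq_iff indicator_def)
  show si: "square_integrable (two_sided p m)"
    unfolding eq using assms(1) lm(1) by (intro square_integrable_add) auto
  have "(LINT x|lborel. (cmod (two_sided p m x))\<^sup>2) = (LINT x|lborel. (cmod (?p x))\<^sup>2 + (cmod (?m (- x)))\<^sup>2)"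
    by (rule integral_discrete_difference[where X = "{0::real}"]) (auto simp: two_sided_def indicator_def)
  also have "\<dots> = (LINT x|lborel. (cmod (?p x))\<^sup>2) + (LINT x|lborel. (cmod (?m (- x)))\<^sup>2)"
    by (rule Bochner_Integration.integral_add[OF square_integrableD(2)[OF assms(1)] square_integrableD(2)[OF rm(1)]])
  finally show sum: "(l2norm (two_sided p m))\<^sup>2 = (l2norm ?p)\<^sup>2 + (l2norm ?m)\<^sup>2"
    using rm(2) by (simp only: l2norm_power2[symmetric])
  have "(l2norm (two_sided p m))\<^sup>2 \<le> (l2norm ?p + l2norm ?m)\<^sup>2"
    unfolding sum by (simp add: power2_sum l2norm_nonneg)
  then show "l2norm (two_sided p m) \<le> l2norm ?p + l2norm ?m"
    by (rule power2_le_imp_le) (simp add: l2norm_nonneg)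
qed

section \<open>Transmission across the origin\<close>

lemma primitive_on_uminus:
  "primitive_on A F f \<Longrightarrow> primitive_on A (\<lambda>x. - F x) (\<lambda>x. - f x)"
  by (simp add: primitive_on_def set_lebesgue_integral_def) (metis add.commute minus_diff_eq uminus_add_conv_diff)

text \<open>
Reflection reverses the sign of derivatives, whence the sign in the left component.
\<close>
lemma primitive_on_two_sided:
  assumes p: "primitive_on {0..} p p'" and m: "primitive_on {0..} m m'" and match: "p 0 = m 0"
    and loc: "locally_integrable (two_sided p' (\<lambda>x. - m' x))"
  shows "primitive_on UNIV (two_sided p m) (two_sided p' (\<lambda>x. - m' x))"
proof (rule primitive_on_glue[OF _ _ loc, of 0])
  show "primitive_on {0..} (two_sided p m) (two_sided p' (\<lambda>x. - m' x))"
    by (rule primitive_on_cong[OF p]) (auto simp: two_sided_def)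
  have "{x::real. - x \<in> {0..}} = {..0}" by auto
  then have "primitive_on {..0} (\<lambda>x. m (- x)) (\<lambda>x. - m' (- x))"
    using primitive_on_reflect[OF m] by simp
  then show "primitive_on {..0} (two_sided p m) (two_sided p' (\<lambda>x. - m' x))"
    by (rule primitive_on_cong[where p = 0]) (use match in \<open>auto simp: two_sided_def\<close>)
qed

definition right_part :: "(real \<Rightarrow> complex) \<Rightarrow> real \<Rightarrow> complex" where
  "right_part f x = indicator {0..} x *\<^sub>R f x"

definition left_part :: "(real \<Rightarrow> complex) \<Rightarrow> real \<Rightarrow> complex" where
  "left_part f x = indicator {0..} x *\<^sub>R f (- x)"

text \<open>
The continuous function that solves the homogeneous equation off the origin and decays on both sides; its derivative jumps
at the origin by \<open>- (kp + km)\<close>.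
\<close>
definition mode :: "complex \<Rightarrow> complex \<Rightarrow> real \<Rightarrow> complex" where
  "mode kp km = two_sided (\<lambda>x. exp (- (kp * of_real x))) (\<lambda>x. exp (- (km * of_real x)))"

text \<open>
The value at the origin for which the two half-line solutions have the same derivative there.
\<close>
definition matching_value :: "complex \<Rightarrow> complex \<Rightarrow> (real \<Rightarrow> complex) \<Rightarrow> complex" where
  "matching_value kp km f = (LINT x|lborel. mode kp km x * f x) / (kp + km)"

definition Dirichlet_solution :: "complex \<Rightarrow> complex \<Rightarrow> (real \<Rightarrow> complex) \<Rightarrow> real \<Rightarrow> complex" where
  "Dirichlet_solution kp km f =
     two_sided (halfline_solution kp (right_part f) 0) (halfline_solution km (left_part f) 0)"

text \<open>
The solution on the whole line: two half-line solutions glued at their common boundary value.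
\<close>
definition transmission_solution :: "complex \<Rightarrow> complex \<Rightarrow> (real \<Rightarrow> complex) \<Rightarrow> real \<Rightarrow> complex" where
  "transmission_solution kp km f =
     two_sided (halfline_solution kp (right_part f) (matching_value kp km f))
       (halfline_solution km (left_part f) (matching_value kp km f))"

definition transmission_solution_deriv :: "complex \<Rightarrow> complex \<Rightarrow> (real \<Rightarrow> complex) \<Rightarrow> real \<Rightarrow> complex" where
  "transmission_solution_deriv kp km f =
     two_sided (halfline_solution_deriv kp (right_part f) (matching_value kp km f))
       (\<lambda>x. - halfline_solution_deriv km (left_part f) (matching_value kp km f) x)"

lemma square_integrable_parts:
  assumes "square_integrable f"
  shows "square_integrable (right_part f)" "l2norm (right_part f) \<le> l2norm f"
    "square_integrable (left_part f)" "l2norm (left_part f) \<le> l2norm f"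
  using square_integrable_indicator[OF assms, of "{0..}"]
    square_integrable_indicator[OF square_integrable_reflect(1)[OF assms], of "{0..}"]
    square_integrable_reflect(2)[OF assms]
  by (simp_all add: right_part_def[abs_def] left_part_def[abs_def])

context
  fixes kp km :: complex
  assumes kp: "0 < Re kp" and km: "0 < Re km"
begin

lemma mode_square_integrable:
  "square_integrable (mode kp km)"
  "(l2norm (mode kp km))\<^sup>2 = 1 / (2 * Re kp) + 1 / (2 * Re km)"
  using two_sided_l2[OF decay_square_integrable(1)[OF kp] decay_square_integrable(1)[OF km]]
    decay_square_integrable(2)[OF kp] decay_square_integrable(2)[OF km]
  by (simp_all add: mode_def)

context
  fixes f :: "real \<Rightarrow> complex"
  assumes f: "square_integrable f"
begin

text \<open>
The right-hand side collects the contributions of the source to the derivatives at the origin, and the left-hand side those of the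
boundary value.
\<close>
lemma matching_value_eq:
  "(kp + km) * matching_value kp km f = outgoing kp (right_part f) 0 + outgoing km (left_part f) 0"
proof -
  let ?E = "\<lambda>k x. indicator {0..} x *\<^sub>R exp (- (k * of_real x))"
  have ne: "kp + km \<noteq> 0"
    using kp km by (metis add_pos_pos less_irrefl plus_complex.simps(1) zero_complex.simps(1))
  have ip: "integrable lborel (\<lambda>x. ?E kp x * f x)"
    by (rule integrable_mult_square_integrable(1)[OF decay_square_integrable(1)[OF kp] f])
  have im: "integrable lborel (\<lambda>x. ?E km x * f (- x))"
    by (rule integrable_mult_square_integrable(1)[OF decay_square_integrable(1)[OF km] square_integrable_reflect(1)[OF f]])
  have im': "integrable lborel (\<lambda>x. ?E km (- x) * f x)"
    using lborel_integrable_real_affine[OF im, of "-1" 0] by simp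
  have "(LINT x|lborel. mode kp km x * f x) = (LINT x|lborel. ?E kp x * f x + ?E km (- x) * f x)"
    by (rule integral_discrete_difference[where X = "{0::real}"])
      (auto simp: mode_def two_sided_def indicator_def)
  also have "\<dots> = (LINT x|lborel. ?E kp x * f x) + (LINT x|lborel. ?E km (- x) * f x)"
    by (rule Bochner_Integration.integral_add[OF ip im'])
  also have "(LINT x|lborel. ?E kp x * f x) = outgoing kp (right_part f) 0"
    unfolding outgoing_def set_lebesgue_integral_def
    by (intro Bochner_Integration.integral_cong) (auto simp: right_part_def indicator_def)
  also have "(LINT x|lborel. ?E km (- x) * f x) = (LINT x|lborel. ?E km x * f (- x))"
    using lborel_integral_real_affine[of "-1" "\<lambda>x. ?E km (- x) * f x" 0] by simp
  also have "\<dots> = outgoing km (left_part f) 0"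
    unfolding outgoing_def set_lebesgue_integral_def
    by (intro Bochner_Integration.integral_cong) (auto simp: left_part_def indicator_def)
  finally show ?thesis
    using ne by (simp add: matching_value_def)
qed

lemma transmission_square_integrable:
  "square_integrable (transmission_solution kp km f)"
  "square_integrable (transmission_solution_deriv kp km f)"
proof -
  note s = square_integrable_parts[OF f]
  show "square_integrable (transmission_solution kp km f)"
    unfolding transmission_solution_def
    by (rule two_sided_l2(1)[OF halfline_square_integrable(1)[OF kp s(1)] halfline_square_integrable(1)[OF km s(3)]])
  have "square_integrable (\<lambda>x. indicator {0..} x *\<^sub>R (- halfline_solution_deriv km (left_part f) (matching_value kp km f) x))"
    using square_integrable_uminus[OF halfline_square_integrable(2)[OF km s(3)]] by simp
  then show "square_integrable (transmission_solution_deriv kp km f)"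
    unfolding transmission_solution_deriv_def
    by (rule two_sided_l2(1)[OF halfline_square_integrable(2)[OF kp s(1)]])
qed

lemma transmission_source_square_integrable:
  "square_integrable (\<lambda>x. step_potential (kp\<^sup>2) (km\<^sup>2) x * transmission_solution kp km f x - f x)"
  by (intro square_integrable_diff square_integrable_step_potential transmission_square_integrable(1) f)

lemma transmission_primitives:
  "primitive_on UNIV (transmission_solution kp km f) (transmission_solution_deriv kp km f)"
  "primitive_on UNIV (transmission_solution_deriv kp km f)
     (\<lambda>x. step_potential (kp\<^sup>2) (km\<^sup>2) x * transmission_solution kp km f x - f x)"
proof -
  note s = square_integrable_parts[OF f]
  let ?c = "matching_value kp km f"
  let ?p = "halfline_solution kp (right_part f) ?c" and ?m = "halfline_solution km (left_part f) ?c"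
  let ?p' = "halfline_solution_deriv kp (right_part f) ?c" and ?m' = "halfline_solution_deriv km (left_part f) ?c"
  have bp: "?p 0 = ?c" "?p' 0 = outgoing kp (right_part f) 0 - kp * ?c"
    by (rule halfline_boundary_values[OF kp s(1)]; simp add: right_part_def)+
  have bm: "?m 0 = ?c" "?m' 0 = outgoing km (left_part f) 0 - km * ?c"
    by (rule halfline_boundary_values[OF km s(3)]; simp add: left_part_def)+
  show "primitive_on UNIV (transmission_solution kp km f) (transmission_solution_deriv kp km f)"
    unfolding transmission_solution_def transmission_solution_deriv_def
  proof (rule primitive_on_two_sided)
    show "primitive_on {0..} ?p ?p'" by (rule halfline_primitives(1)[OF kp s(1)])
    show "primitive_on {0..} ?m ?m'" by (rule halfline_primitives(1)[OF km s(3)])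
    show "?p 0 = ?m 0" by (simp only: bp bm)
    show "locally_integrable (two_sided ?p' (\<lambda>x. - ?m' x))"
      using locally_integrable_square_integrable[OF transmission_square_integrable(2)]
      by (simp only: transmission_solution_deriv_def)
  qed
  have source: "(\<lambda>x. step_potential (kp\<^sup>2) (km\<^sup>2) x * transmission_solution kp km f x - f x)
      = two_sided (\<lambda>x. kp\<^sup>2 * ?p x - right_part f x) (\<lambda>x. - (- (km\<^sup>2 * ?m x - left_part f x)))"
    by (rule ext) (simp add: step_potential_def transmission_solution_def two_sided_def right_part_def left_part_def)
  show "primitive_on UNIV (transmission_solution_deriv kp km f)
     (\<lambda>x. step_potential (kp\<^sup>2) (km\<^sup>2) x * transmission_solution kp km f x - f x)"
    unfolding source transmission_solution_deriv_def
  proof (rule primitive_on_two_sided)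
    show "primitive_on {0..} ?p' (\<lambda>x. kp\<^sup>2 * ?p x - right_part f x)"
      by (rule halfline_primitives(2)[OF kp s(1)])
    show "primitive_on {0..} (\<lambda>x. - ?m' x) (\<lambda>x. - (km\<^sup>2 * ?m x - left_part f x))"
      by (rule primitive_on_uminus[OF halfline_primitives(2)[OF km s(3)]])
    show "?p' 0 = - ?m' 0"
      using matching_value_eq by (simp add: bp bm algebra_simps)
    show "locally_integrable (two_sided (\<lambda>x. kp\<^sup>2 * ?p x - right_part f x) (\<lambda>x. - (- (km\<^sup>2 * ?m x - left_part f x))))"
      unfolding source[symmetric]
      by (rule locally_integrable_square_integrable[OF transmission_source_square_integrable])
  qed
qed

lemma transmission_split:
  "transmission_solution kp km f x = matching_value kp km f * mode kp km x + Dirichlet_solution kp km f x"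
proof -
  have "kp \<noteq> 0" "km \<noteq> 0" using kp km by auto
  then show ?thesis
    using halfline_solution_split[of kp "right_part f" "matching_value kp km f"]
      halfline_solution_split[of km "left_part f" "matching_value kp km f"]
    by (simp add: transmission_solution_def Dirichlet_solution_def mode_def two_sided_def)
qed

lemma Dirichlet_solution_bound:
  "square_integrable (Dirichlet_solution kp km f)"
  "l2norm (Dirichlet_solution kp km f) \<le> (5 / (4 * cmod kp * Re kp) + 5 / (4 * cmod km * Re km)) * l2norm f"
proof -
  note s = square_integrable_parts[OF f]
  note t = two_sided_l2[OF halfline_square_integrable(1)[OF kp s(1)] halfline_square_integrable(1)[OF km s(3)]]
  show "square_integrable (Dirichlet_solution kp km f)"
    unfolding Dirichlet_solution_def by (rule t(1))
  have "l2norm (Dirichlet_solution kp km f) \<le>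
      5 / (4 * cmod kp * Re kp) * l2norm (right_part f) + 5 / (4 * cmod km * Re km) * l2norm (left_part f)"
    unfolding Dirichlet_solution_def
    by (rule order_trans[OF t(3) add_mono[OF Dirichlet_bound[OF kp s(1)] Dirichlet_bound[OF km s(3)]]])
  also have "\<dots> \<le> 5 / (4 * cmod kp * Re kp) * l2norm f + 5 / (4 * cmod km * Re km) * l2norm f"
    using s(2,4) kp km by (intro add_mono mult_left_mono) auto
  finally show "l2norm (Dirichlet_solution kp km f) \<le> (5 / (4 * cmod kp * Re kp) + 5 / (4 * cmod km * Re km)) * l2norm f"
    by (simp add: distrib_right)
qed

end

end

section \<open>Uniqueness of the decaying solution\<close>

lemma primitive_exists:
  assumes g: "locally_integrable g"
  obtains F where "primitive_on UNIV F g"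
proof -
  define F where "F = (\<lambda>x. if 0 \<le> x then (LINT t:{0..x}|lborel. g t) else - (LINT t:{x..0}|lborel. g t))"
  have "primitive_on UNIV F g"
  proof (rule primitive_on_glue[OF _ _ g, of 0])
    show "primitive_on {0..} F g"
      unfolding primitive_on_def
    proof (intro allI impI)
      fix a b :: real assume ab: "a \<le> b" "{a..b} \<subseteq> {0..}"
      then have "a \<in> {0..}" by (meson atLeastAtMost_iff order_refl subsetD)
      then have "0 \<le> a" by simp
      then show "F b - F a = (LINT x:{a..b}|lborel. g x)"
        using set_integral_Icc_split[OF g \<open>0 \<le> a\<close> ab(1)] ab(1) by (simp add: F_def)
    qed
    have z: "(LINT t:{0..0}|lborel. g t) = 0"
      using set_integral_Icc_split[OF g order_refl order_refl, of 0] by (metis add_cancel_right_right)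
    have Fneg: "F x = - (LINT t:{x..0}|lborel. g t)" if "x \<le> 0" for x
      using z that by (cases "x = 0") (auto simp: F_def)
    show "primitive_on {..0} F g"
      unfolding primitive_on_def
    proof (intro allI impI)
      fix a b :: real assume ab: "a \<le> b" "{a..b} \<subseteq> {..0}"
      then have "b \<in> {..0}" by (meson atLeastAtMost_iff order_refl subsetD)
      then have b: "b \<le> 0" by simp
      then have a: "a \<le> 0" using ab(1) by simp
      show "F b - F a = (LINT x:{a..b}|lborel. g x)"
        unfolding Fneg[OF a] Fneg[OF b] set_integral_Icc_split[OF g ab(1) b] by simp
    qed
  qed
  then show thesis by (rule that)
qed

lemma primitive_HK:
  assumes F: "primitive_on UNIV F g" and g: "locally_integrable g" and "a \<le> b"
  shows "g integrable_on {a..b}" "F b = F a + integral {a..b} g"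
proof -
  show "g integrable_on {a..b}"
    by (rule set_borel_integral_eq_integral(1)[OF locally_integrableD[OF g]])
  show "F b = F a + integral {a..b} g"
    using primitive_onD[OF F \<open>a \<le> b\<close>] set_borel_integral_eq_integral(2)[OF locally_integrableD[OF g, of a b]]
    by (simp add: algebra_simps)
qed

lemma primitive_isCont:
  assumes F: "primitive_on UNIV F g" and g: "locally_integrable g"
  shows "isCont F x"
proof -
  note HK = primitive_HK[OF F g]
  have "continuous_on {x - 1..x + 1} (\<lambda>u. F (x - 1) + integral {x - 1..u} g)"
    by (intro continuous_intros indefinite_integral_continuous_1 HK(1)) auto
  then have "continuous_on {x - 1..x + 1} F"
    by (rule continuous_on_eq) (use HK(2) in auto)
  then show ?thesis
    by (rule continuous_on_interior) (auto simp: interior_atLeastAtMost_real)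
qed

lemma primitive_has_vector_derivative:
  assumes F: "primitive_on UNIV F g" and g: "locally_integrable g" and c: "isCont g x"
  shows "(F has_vector_derivative g x) (at x)"
proof -
  note HK = primitive_HK[OF F g]
  have x: "x \<in> {x - 1..x + 1} - {}" and x': "x \<in> {x - 1..x + 1}" by simp_all
  have "((\<lambda>u. integral {x - 1..u} g) has_vector_derivative g x) (at x within {x - 1..x + 1})"
    using integral_has_vector_derivative_continuous_at[OF HK(1) x] c
      continuous_at_imp_continuous_at_within[OF c, of "{x - 1..x + 1}"] by simp
  then have "((\<lambda>u. F (x - 1) + integral {x - 1..u} g) has_vector_derivative 0 + g x) (at x within {x - 1..x + 1})"
    by (rule has_vector_derivative_add[OF has_vector_derivative_const])
  then have "(F has_vector_derivative 0 + g x) (at x within {x - 1..x + 1})"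
    by (rule has_vector_derivative_transform[OF x', rotated]) (use HK(2) in auto)
  moreover have "x \<in> interior {x - 1..x + 1}" by (simp add: interior_atLeastAtMost_real)
  ultimately show ?thesis
    using at_within_interior[of x "{x - 1..x + 1}"] by simp
qed

text \<open>
Any primitive of \<open>g\<close> has weak derivative \<open>g\<close>, so it differs from \<open>f\<close> by a function with weak derivative zero.
\<close>
lemma weak_derivative_primitive:
  assumes f: "locally_integrable f" and g: "locally_integrable g"
    and weak: "\<And>\<phi>. test_function \<phi> \<Longrightarrow> (LINT x|lborel. deriv \<phi> x *\<^sub>R f x) = - (LINT x|lborel. \<phi> x *\<^sub>R g x)"
  obtains F where "primitive_on UNIV F g" "AE x in lborel. f x = F x"
proof -
  obtain F where F: "primitive_on UNIV F g" using primitive_exists[OF g] .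
  have locF: "locally_integrable F"
    using primitive_isCont[OF F g]
    by (intro locally_integrable_continuous continuous_at_imp_continuous_on) auto
  have "\<exists>c. AE x in lborel. f x - F x = c"
  proof (rule du_Bois_Reymond[OF locally_integrable_diff[OF f locF]])
    fix \<phi> assume \<phi>: "test_function \<phi>"
    note \<phi>' = test_function_deriv[OF \<phi>]
    have "(LINT x|lborel. deriv \<phi> x *\<^sub>R (f x - F x))
        = (LINT x|lborel. deriv \<phi> x *\<^sub>R f x) - (LINT x|lborel. deriv \<phi> x *\<^sub>R F x)"
      using integrable_test_function_scaleR[OF \<phi>' f] integrable_test_function_scaleR[OF \<phi>' locF]
      by (simp add: scaleR_diff_right)
    also have "(LINT x|lborel. deriv \<phi> x *\<^sub>R F x) = - (LINT x|lborel. \<phi> x *\<^sub>R g x)"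
      by (rule weak_derivative_of_primitive[OF g _ \<phi>]) (rule primitive_onD[OF F]; simp)
    finally show "(LINT x|lborel. deriv \<phi> x *\<^sub>R (f x - F x)) = 0"
      using weak[OF \<phi>] by simp
  qed
  then obtain c where "AE x in lborel. f x - F x = c" ..
  then have "AE x in lborel. f x = F x + c"
    by (rule eventually_mono) (simp add: algebra_simps)
  moreover have "primitive_on UNIV (\<lambda>x. F x + c) g"
    using F by (simp add: primitive_on_def)
  ultimately show thesis using that by blast
qed

lemma primitive_on_AE_cong:
  assumes F: "primitive_on A F g" and eq: "AE x in lborel. g x = g' x"
    and g: "locally_integrable g" "locally_integrable g'"
  shows "primitive_on A F g'"
  unfolding primitive_on_def
proof (intro allI impI)
  fix a b :: real assume ab: "a \<le> b" "{a..b} \<subseteq> A"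
  have "(LINT x:{a..b}|lborel. g x) = (LINT x:{a..b}|lborel. g' x)"
    unfolding set_lebesgue_integral_def
  proof (rule integral_cong_AE)
    show "(\<lambda>x. indicator {a..b} x *\<^sub>R g x) \<in> borel_measurable lborel"
      "(\<lambda>x. indicator {a..b} x *\<^sub>R g' x) \<in> borel_measurable lborel"
      using g[THEN locally_integrableD, of a b]
      by (auto simp: set_integrable_def dest: borel_measurable_integrable)
    show "AE x in lborel. indicator {a..b} x *\<^sub>R g x = indicator {a..b} x *\<^sub>R g' x"
      using eq by (rule eventually_mono) simp
  qed
  then show "F b - F a = (LINT x:{a..b}|lborel. g' x)"
    using primitive_onD[OF F ab] by simp
qed

lemma square_integrable_AE_cong:
  assumes "square_integrable f" "AE x in lborel. f x = g x" "g \<in> borel_measurable borel"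
  shows "square_integrable g"
proof -
  have [measurable]: "f \<in> borel_measurable borel" "g \<in> borel_measurable borel"
    using assms square_integrableD by auto
  have "integrable lborel (\<lambda>x. (cmod (f x))\<^sup>2) \<longleftrightarrow> integrable lborel (\<lambda>x. (cmod (g x))\<^sup>2)"
    by (rule integrable_cong_AE) (use assms(2) in \<open>auto elim: eventually_mono\<close>)
  then show ?thesis
    using assms by (simp add: square_integrable_def)
qed

text \<open>
A nonzero constant is not square-integrable on a half-line.
\<close>
lemma eq_zero_if_bounded_by_square_integrable:
  assumes S: "square_integrable S" and le: "\<And>x. 0 \<le> x \<Longrightarrow> cmod A \<le> cmod (S x)"
  shows "A = 0"
proof (rule ccontr)
  assume A: "A \<noteq> 0"
  obtain n :: nat where n: "(l2norm S)\<^sup>2 / (cmod A)\<^sup>2 < real n"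
    using reals_Archimedean2 by blast
  have "real n * (cmod A)\<^sup>2 = (LINT x|lborel. indicator {0..real n} x *\<^sub>R (cmod A)\<^sup>2)"
    by simp
  also have "\<dots> \<le> (LINT x|lborel. (cmod (S x))\<^sup>2)"
  proof (rule integral_mono)
    show "integrable lborel (\<lambda>x. indicator {0..real n} x *\<^sub>R (cmod A)\<^sup>2)"
      by (intro integrable_scaleR_left integrable_real_indicator) (auto simp: emeasure_lborel_Icc_eq)
    show "integrable lborel (\<lambda>x. (cmod (S x))\<^sup>2)"
      by (rule square_integrableD(2)[OF S])
    fix x :: real
    show "indicator {0..real n} x *\<^sub>R (cmod A)\<^sup>2 \<le> (cmod (S x))\<^sup>2"
      using le[of x] by (auto simp: indicator_def power_mono)
  qed
  finally have "real n * (cmod A)\<^sup>2 \<le> (l2norm S)\<^sup>2"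
    by (simp add: l2norm_power2)
  then show False
    using n A by (simp add: field_simps)
qed

text \<open>
Both \<open>(F' + k F) exp (- k x)\<close> and, once \<open>F' = - k F\<close> is known, \<open>F exp (k x)\<close> are constant. The first constant vanishes
because otherwise \<open>F' + k F\<close> would grow exponentially.
\<close>
lemma halfline_homogeneous:
  fixes F G :: "real \<Rightarrow> complex"
  assumes k: "0 < Re k"
    and cont: "continuous_on {0..} F" "continuous_on {0..} G"
    and F': "\<And>x. 0 < x \<Longrightarrow> (F has_vector_derivative G x) (at x)"
    and G': "\<And>x. 0 < x \<Longrightarrow> (G has_vector_derivative k\<^sup>2 * F x) (at x)"
    and si: "square_integrable F" "square_integrable G"
  shows "G 0 = - k * F 0" "0 \<le> x \<Longrightarrow> F x = F 0 * exp (- (k * of_real x))"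
proof -
  have const: "H x = H 0"
    if "continuous_on {0..} H" "\<And>x. 0 < x \<Longrightarrow> (H has_vector_derivative 0) (at x)" "0 \<le> x" for H :: "real \<Rightarrow> complex" and x
  proof (rule has_derivative_zero_unique_strong_convex[of "{0..}" "{0}" H 0 "H 0" x])
    fix y :: real assume "y \<in> {0..} - {0}"
    then have "0 < y" by auto
    from has_vector_derivative_at_within[OF that(2)[OF this]]
    have "(H has_vector_derivative 0) (at y within {0..})" .
    then show "(H has_derivative (\<lambda>h. 0)) (at y within {0..})"
      by (simp add: has_vector_derivative_def)
  next
    show "continuous_on {0..} H" by (rule that(1))
    show "x \<in> {0..}" using that(3) by simp
  qed simp_all
  have E': "((\<lambda>x. exp (a * of_real x)) has_vector_derivative a * exp (a * of_real x)) (at x)" for a :: complex and x :: real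
    by (rule has_vector_derivative_real_field) (auto intro!: derivative_eq_intros)
  have A: "(G x + k * F x) * exp (- k * of_real x) = (G 0 + k * F 0) * exp (- k * of_real 0)" if "0 \<le> x" for x
  proof (rule const[OF _ _ that])
    show "continuous_on {0..} (\<lambda>x. (G x + k * F x) * exp (- k * of_real x))"
      by (intro continuous_intros cont)
    fix x :: real assume x: "0 < x"
    have "((\<lambda>x. (G x + k * F x) * exp (- k * of_real x)) has_vector_derivative
        (G x + k * F x) * (- k * exp (- k * of_real x)) + (k\<^sup>2 * F x + k * G x) * exp (- k * of_real x)) (at x)"
      by (intro has_vector_derivative_mult has_vector_derivative_add has_vector_derivative_mult_right F' G' E' x)
    also have "(G x + k * F x) * (- k * exp (- k * of_real x)) + (k\<^sup>2 * F x + k * G x) * exp (- k * of_real x) = 0"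
      by (simp add: algebra_simps power2_eq_square)
    finally show "((\<lambda>x. (G x + k * F x) * exp (- k * of_real x)) has_vector_derivative 0) (at x)" .
  qed
  have "G 0 + k * F 0 = 0"
  proof (rule eq_zero_if_bounded_by_square_integrable)
    show "square_integrable (\<lambda>x. G x + k * F x)"
      by (intro square_integrable_add square_integrable_cmult si)
    fix x :: real assume x: "0 \<le> x"
    have "cmod (G 0 + k * F 0) = cmod (G x + k * F x) * exp (- Re k * x)"
      using arg_cong[OF A[OF x], of cmod] by (simp add: norm_mult)
    also have "\<dots> \<le> cmod (G x + k * F x) * 1"
      using x k by (intro mult_left_mono) auto
    finally show "cmod (G 0 + k * F 0) \<le> cmod (G x + k * F x)" by simp
  qed
  then show "G 0 = - k * F 0" by (simp add: eq_neg_iff_add_eq_0)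
  have GF: "G x = - k * F x" if "0 \<le> x" for x
  proof -
    have "(G x + k * F x) * exp (- k * of_real x) = 0"
      unfolding A[OF that] \<open>G 0 + k * F 0 = 0\<close> by simp
    then show ?thesis by (simp add: eq_neg_iff_add_eq_0)
  qed
  assume x: "0 \<le> x"
  have "F x * exp (k * of_real x) = F 0 * exp (k * of_real 0)"
  proof (rule const[OF _ _ x])
    show "continuous_on {0..} (\<lambda>x. F x * exp (k * of_real x))"
      by (intro continuous_intros cont)
    fix x :: real assume x: "0 < x"
    have "((\<lambda>x. F x * exp (k * of_real x)) has_vector_derivative
        F x * (k * exp (k * of_real x)) + G x * exp (k * of_real x)) (at x)"
      by (intro has_vector_derivative_mult F' E' x)
    then show "((\<lambda>x. F x * exp (k * of_real x)) has_vector_derivative 0) (at x)"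
      using GF[of x] x by simp
  qed
  then show "F x = F 0 * exp (- (k * of_real x))"
    by (simp add: exp_minus field_simps)
qed

text \<open>
The decaying solutions have logarithmic derivative \<open>- kp\<close> at the origin from the right and \<open>km\<close> from the left. Since
\<open>kp + km\<close> is not zero, a solution with continuous derivative vanishes at the origin and hence everywhere.
\<close>
lemma homogeneous_solution_zero:
  assumes kp: "0 < Re kp" and km: "0 < Re km"
    and si: "square_integrable f" "square_integrable g" "square_integrable h"
    and fg: "\<And>\<phi>. test_function \<phi> \<Longrightarrow> (LINT x|lborel. deriv \<phi> x *\<^sub>R f x) = - (LINT x|lborel. \<phi> x *\<^sub>R g x)"
    and gh: "\<And>\<phi>. test_function \<phi> \<Longrightarrow> (LINT x|lborel. deriv \<phi> x *\<^sub>R g x) = - (LINT x|lborel. \<phi> x *\<^sub>R h x)"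
    and eq: "AE x in lborel. h x = step_potential (kp\<^sup>2) (km\<^sup>2) x * f x"
  shows "AE x in lborel. f x = 0"
proof -
  note loc = si[THEN locally_integrable_square_integrable]
  obtain F where F: "primitive_on UNIV F g" and fF: "AE x in lborel. f x = F x"
    using weak_derivative_primitive[OF loc(1,2) fg] by metis
  obtain G where G: "primitive_on UNIV G h" and gG: "AE x in lborel. g x = G x"
    using weak_derivative_primitive[OF loc(2,3) gh] by metis
  have cF: "isCont F x" and cG: "isCont G x" for x
    using primitive_isCont[OF F loc(2)] primitive_isCont[OF G loc(3)] by auto
  have meas: "F \<in> borel_measurable borel" "G \<in> borel_measurable borel"
    using cF cG by (auto intro!: borel_measurable_continuous_onI continuous_at_imp_continuous_on)
  have siF: "square_integrable F" and siG: "square_integrable G"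
    using square_integrable_AE_cong[OF si(1) fF meas(1)] square_integrable_AE_cong[OF si(2) gG meas(2)] by auto
  define Q where "Q = (\<lambda>x. step_potential (kp\<^sup>2) (km\<^sup>2) x * F x)"
  have siQ: "square_integrable Q" unfolding Q_def by (rule square_integrable_step_potential[OF siF])
  have hQ: "AE x in lborel. h x = Q x"
    using eq fF by eventually_elim (simp add: Q_def)
  have FG: "primitive_on UNIV F G"
    by (rule primitive_on_AE_cong[OF F gG loc(2) locally_integrable_square_integrable[OF siG]])
  have GQ: "primitive_on UNIV G Q"
    by (rule primitive_on_AE_cong[OF G hQ loc(3) locally_integrable_square_integrable[OF siQ]])
  have F': "(F has_vector_derivative G x) (at x)" for x
    by (rule primitive_has_vector_derivative[OF FG locally_integrable_square_integrable[OF siG] cG])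
  have G': "(G has_vector_derivative Q x) (at x)" if "x \<noteq> 0" for x
  proof (rule primitive_has_vector_derivative[OF GQ locally_integrable_square_integrable[OF siQ]])
    have "\<forall>\<^sub>F y in nhds x. y \<in> (if 0 < x then {0<..} else {..<0})"
      using that by (intro eventually_nhds_in_open) auto
    then have "\<forall>\<^sub>F y in nhds x. Q y = (if 0 < x then kp\<^sup>2 else km\<^sup>2) * F y"
      by (rule eventually_mono) (auto simp: Q_def step_potential_def split: if_splits)
    note Q = isCont_cong[OF this]
    have "isCont (\<lambda>y. (if 0 < x then kp\<^sup>2 else km\<^sup>2) * F y) x"
      using cF by (intro continuous_intros)
    then show "isCont Q x"
      by (simp only: Q)
  qed
  have neg': "((\<lambda>x. H (- x)) has_vector_derivative - D) (at x)" if "(H has_vector_derivative D) (at (- x))" for H :: "real \<Rightarrow> complex" and D x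
    using vector_diff_chain_at[OF has_vector_derivative_minus[OF has_vector_derivative_id], of H D x] that
    by (simp add: o_def)
  have cont: "continuous_on A F" "continuous_on A G" for A
    using cF cG continuous_at_imp_continuous_on by blast+
  have cont': "continuous_on A (\<lambda>x. F (- x))" "continuous_on A (\<lambda>x. - G (- x))" for A
    by (rule continuous_on_compose2[OF cont(1)[of UNIV], of A uminus],
        (intro continuous_intros | simp)+)
      (intro continuous_on_minus continuous_on_compose2[OF cont(2)[of UNIV], of A uminus], (intro continuous_intros | simp)+)
  have right: "G 0 = - kp * F 0" "0 \<le> x \<Longrightarrow> F x = F 0 * exp (- (kp * of_real x))" for x
  proof -
    have "(G has_vector_derivative kp\<^sup>2 * F x) (at x)" if "0 < x" for x
      using G'[of x] that by (simp add: Q_def step_potential_def)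
    note H = halfline_homogeneous[OF kp cont(1,2) F' this siF siG]
    show "G 0 = - kp * F 0" "0 \<le> x \<Longrightarrow> F x = F 0 * exp (- (kp * of_real x))" by (rule H; assumption)+
  qed
  have left: "- G 0 = - km * F 0" "0 \<le> x \<Longrightarrow> F (- x) = F 0 * exp (- (km * of_real x))" for x
  proof -
    have 1: "((\<lambda>x. F (- x)) has_vector_derivative - G (- x)) (at x)" for x
      by (rule neg'[OF F'])
    have 2: "((\<lambda>x. - G (- x)) has_vector_derivative km\<^sup>2 * F (- x)) (at x)" if "0 < x" for x
      using has_vector_derivative_minus[OF neg'[OF G'[of "- x"]]] that by (simp add: Q_def step_potential_def)
    note H = halfline_homogeneous[OF km cont' 1 2 square_integrable_reflect(1)[OF siF]
        square_integrable_uminus[OF square_integrable_reflect(1)[OF siG]]]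
    show "- G 0 = - km * F 0" "0 \<le> x \<Longrightarrow> F (- x) = F 0 * exp (- (km * of_real x))"
      using H(1) H(2)[of x] by auto
  qed
  have "(kp + km) * F 0 = 0"
    using right(1) left(1) by (simp add: algebra_simps)
  moreover have "kp + km \<noteq> 0"
    using kp km by (metis add_pos_pos less_irrefl plus_complex.simps(1) zero_complex.simps(1))
  ultimately have "F 0 = 0" by simp
  have "F x = 0" for x
    using right(2)[of x] left(2)[of "- x"] \<open>F 0 = 0\<close> by (cases "0 \<le> x") auto
  then show ?thesis using fF by simp
qed

section \<open>The resolvent on equivalence classes\<close>

lemma L2_obtain_rep:
  obtains f where "square_integrable f" "u = abs_L2 f" "f = rep_L2 u"
proof -
  have "square_integrable (rep_L2 u)"
    using Quotient_rep_reflp[OF Quotient_L2, of u] by blast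
  moreover have "u = abs_L2 (rep_L2 u)"
    by (rule Quotient_abs_rep[OF Quotient_L2, symmetric])
  ultimately show thesis by (rule that[OF _ _ refl])
qed

lemma abs_L2_eq_iff:
  assumes "square_integrable f" "square_integrable g"
  shows "abs_L2 f = abs_L2 g \<longleftrightarrow> (AE x in lborel. f x = g x)"
  using Quotient_rel[OF Quotient_L2, of f g] assms by auto

lemma has_weak_derivative_abs:
  assumes "square_integrable f" "square_integrable g"
  shows "has_weak_derivative (abs_L2 f) (abs_L2 g) \<longleftrightarrow>
    (\<forall>\<phi>. test_function \<phi> \<longrightarrow> (LINT x|lborel. deriv \<phi> x *\<^sub>R f x) = - (LINT x|lborel. \<phi> x *\<^sub>R g x))"
  using assms by (intro has_weak_derivative.abs_eq) auto

lemma abs_L2_lincomb: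
  assumes "square_integrable f" "square_integrable g"
  shows "r *\<^sub>R abs_L2 f + s *\<^sub>R abs_L2 g = abs_L2 (\<lambda>x. r *\<^sub>R f x + s *\<^sub>R g x)"
proof -
  have "r *\<^sub>R abs_L2 f = abs_L2 (\<lambda>x. r *\<^sub>R f x)" "s *\<^sub>R abs_L2 g = abs_L2 (\<lambda>x. s *\<^sub>R g x)"
    using assms by (auto intro!: scaleR_L2.abs_eq)
  then show ?thesis
    using assms square_integrable_scaleR by (auto intro!: plus_L2.abs_eq)
qed

lemma square_integrable_lincomb:
  "square_integrable f \<Longrightarrow> square_integrable g \<Longrightarrow> square_integrable (\<lambda>x. r *\<^sub>R f x + s *\<^sub>R g x)"
  by (intro square_integrable_add square_integrable_scaleR)

lemma has_weak_derivative_lincomb: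
  assumes "has_weak_derivative u u'" "has_weak_derivative v v'"
  shows "has_weak_derivative (r *\<^sub>R u + s *\<^sub>R v) (r *\<^sub>R u' + s *\<^sub>R v')"
proof -
  obtain f where f: "square_integrable f" "u = abs_L2 f" by (rule L2_obtain_rep)
  obtain f' where f': "square_integrable f'" "u' = abs_L2 f'" by (rule L2_obtain_rep)
  obtain g where g: "square_integrable g" "v = abs_L2 g" by (rule L2_obtain_rep)
  obtain g' where g': "square_integrable g'" "v' = abs_L2 g'" by (rule L2_obtain_rep)
  have lin: "(LINT x|lborel. \<phi> x *\<^sub>R (r *\<^sub>R a x + s *\<^sub>R b x))
      = r *\<^sub>R (LINT x|lborel. \<phi> x *\<^sub>R a x) + s *\<^sub>R (LINT x|lborel. \<phi> x *\<^sub>R b x)"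
    if "test_function \<phi>" "square_integrable a" "square_integrable b" for \<phi> a b
  proof -
    note ia = integrable_test_function_scaleR[OF that(1) locally_integrable_square_integrable[OF that(2)]]
    note ib = integrable_test_function_scaleR[OF that(1) locally_integrable_square_integrable[OF that(3)]]
    have "(\<lambda>x. \<phi> x *\<^sub>R (r *\<^sub>R a x + s *\<^sub>R b x)) = (\<lambda>x. r *\<^sub>R (\<phi> x *\<^sub>R a x) + s *\<^sub>R (\<phi> x *\<^sub>R b x))"
      by (intro ext) (simp add: scaleR_add_right mult.commute)
    then show ?thesis
      by (simp only: Bochner_Integration.integral_add[OF integrable_scaleR_right[OF ia] integrable_scaleR_right[OF ib]]
          integral_scaleR_right)
  qed
  have "(LINT x|lborel. deriv \<phi> x *\<^sub>R (r *\<^sub>R f x + s *\<^sub>R g x)) = - (LINT x|lborel. \<phi> x *\<^sub>R (r *\<^sub>R f' x + s *\<^sub>R g' x))"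
    if "test_function \<phi>" for \<phi>
    unfolding lin[OF test_function_deriv[OF that] f(1) g(1)] lin[OF that f'(1) g'(1)]
    using assms that f g f' g' by (simp add: has_weak_derivative_abs)
  then show ?thesis
    unfolding f(2) f'(2) g(2) g'(2)
    unfolding abs_L2_lincomb[OF f(1) g(1)] abs_L2_lincomb[OF f'(1) g'(1)]
    by (subst has_weak_derivative_abs) (auto intro!: square_integrable_lincomb f g f' g')
qed

lemma has_weak_derivative_unique:
  assumes "has_weak_derivative u v" "has_weak_derivative u w"
  shows "v = w"
proof -
  obtain f where f: "square_integrable f" "u = abs_L2 f" by (rule L2_obtain_rep)
  obtain g where g: "square_integrable g" "v = abs_L2 g" by (rule L2_obtain_rep)
  obtain h where h: "square_integrable h" "w = abs_L2 h" by (rule L2_obtain_rep)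
  note lg = locally_integrable_square_integrable[OF g(1)] and lh = locally_integrable_square_integrable[OF h(1)]
  have "AE x in lborel. g x - h x = 0"
  proof (rule AE_zero_if_orthogonal_to_test_functions[OF locally_integrable_diff[OF lg lh]])
    fix \<phi> assume \<phi>: "test_function \<phi>"
    have "(LINT x|lborel. \<phi> x *\<^sub>R g x) = (LINT x|lborel. \<phi> x *\<^sub>R h x)"
    proof -
      have "(LINT x|lborel. deriv \<phi> x *\<^sub>R f x) = - (LINT x|lborel. \<phi> x *\<^sub>R g x)"
        using assms(1) \<phi> unfolding f(2) g(2) has_weak_derivative_abs[OF f(1) g(1)] by simp
      moreover have "(LINT x|lborel. deriv \<phi> x *\<^sub>R f x) = - (LINT x|lborel. \<phi> x *\<^sub>R h x)"
        using assms(2) \<phi> unfolding f(2) h(2) has_weak_derivative_abs[OF f(1) h(1)] by simp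
      ultimately show ?thesis by simp
    qed
    then show "(LINT x|lborel. \<phi> x *\<^sub>R (g x - h x)) = 0"
      using integrable_test_function_scaleR[OF \<phi> lg] integrable_test_function_scaleR[OF \<phi> lh]
      by (simp add: scaleR_diff_right)
  qed
  then show ?thesis
    using g h by (simp add: abs_L2_eq_iff)
qed

lemma weak_deriv_eq: "has_weak_derivative u v \<Longrightarrow> weak_deriv u = v"
  unfolding weak_deriv_def by (rule the_equality) (simp_all only: has_weak_derivative_unique)

lemma has_weak_derivative_primitive:
  assumes "square_integrable f" "square_integrable g" "primitive_on UNIV f g"
  shows "has_weak_derivative (abs_L2 f) (abs_L2 g)"
  using weak_derivative_of_primitive[OF locally_integrable_square_integrable[OF assms(2)]] primitive_onD[OF assms(3)] assms(1,2)
  by (subst has_weak_derivative_abs) auto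

abbreviation shifted_schroedinger :: "complex \<Rightarrow> complex \<Rightarrow> complex \<Rightarrow> L2 \<Rightarrow> L2" where
  "shifted_schroedinger Vp Vm z u \<equiv> step_schroedinger Vp Vm u - z *\<^sub>C u"

lemma shifted_schroedinger_abs:
  assumes f: "square_integrable f" and g: "square_integrable g" and h: "square_integrable h"
    and fg: "has_weak_derivative (abs_L2 f) (abs_L2 g)" and gh: "has_weak_derivative (abs_L2 g) (abs_L2 h)"
  shows "shifted_schroedinger Vp Vm z (abs_L2 f) = abs_L2 (\<lambda>x. step_potential (Vp - z) (Vm - z) x * f x - h x)"
proof -
  note V = square_integrable_step_potential[OF f, of Vp Vm]
  have "potential_op Vp Vm (abs_L2 f) = abs_L2 (\<lambda>x. step_potential Vp Vm x * f x)"
    using f by (intro potential_op.abs_eq) auto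
  moreover have "z *\<^sub>C abs_L2 f = abs_L2 (\<lambda>x. z * f x)"
    using f by (intro scaleC_L2.abs_eq) auto
  moreover have "- abs_L2 h = abs_L2 (\<lambda>x. - h x)"
    using h by (intro uminus_L2.abs_eq) auto
  moreover have "abs_L2 (\<lambda>x. - h x) + abs_L2 (\<lambda>x. step_potential Vp Vm x * f x) = abs_L2 (\<lambda>x. - h x + step_potential Vp Vm x * f x)"
    using square_integrable_uminus[OF h] V by (intro plus_L2.abs_eq) auto
  moreover have "abs_L2 (\<lambda>x. - h x + step_potential Vp Vm x * f x) - abs_L2 (\<lambda>x. z * f x)
      = abs_L2 (\<lambda>x. - h x + step_potential Vp Vm x * f x - z * f x)"
    using square_integrable_add[OF square_integrable_uminus[OF h] V] square_integrable_cmult[OF f]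
    by (intro minus_L2.abs_eq) auto
  moreover have "(\<lambda>x. - h x + step_potential Vp Vm x * f x - z * f x) = (\<lambda>x. step_potential (Vp - z) (Vm - z) x * f x - h x)"
    by (auto simp: step_potential_def algebra_simps)
  ultimately show ?thesis
    by (simp add: step_schroedinger_def weak_deriv_eq[OF fg] weak_deriv_eq[OF gh])
qed

lemma H2_lincomb:
  assumes "u \<in> H2" "v \<in> H2"
  shows "r *\<^sub>R u + s *\<^sub>R v \<in> H2"
proof -
  obtain u' u'' v' v'' where "has_weak_derivative u u'" "has_weak_derivative u' u''"
    "has_weak_derivative v v'" "has_weak_derivative v' v''"
    using assms unfolding H2_def by blast
  then have "has_weak_derivative (r *\<^sub>R u + s *\<^sub>R v) (r *\<^sub>R u' + s *\<^sub>R v')"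
    "has_weak_derivative (r *\<^sub>R u' + s *\<^sub>R v') (r *\<^sub>R u'' + s *\<^sub>R v'')"
    by (simp_all only: has_weak_derivative_lincomb)
  then show ?thesis unfolding H2_def by blast
qed

lemma H2_obtain:
  assumes "u \<in> H2"
  obtains f g h where "square_integrable f" "square_integrable g" "square_integrable h" "u = abs_L2 f"
    "has_weak_derivative (abs_L2 f) (abs_L2 g)" "has_weak_derivative (abs_L2 g) (abs_L2 h)"
proof -
  obtain v w where vw: "has_weak_derivative u v" "has_weak_derivative v w"
    using assms by (auto simp: H2_def)
  obtain f where f: "square_integrable f" "u = abs_L2 f" by (rule L2_obtain_rep)
  obtain g where g: "square_integrable g" "v = abs_L2 g" by (rule L2_obtain_rep)
  obtain h where h: "square_integrable h" "w = abs_L2 h" by (rule L2_obtain_rep)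
  show thesis using that[OF f(1) g(1) h(1) f(2)] vw f g h by simp
qed

lemma shifted_schroedinger_lincomb:
  assumes "u \<in> H2" "v \<in> H2"
  shows "shifted_schroedinger Vp Vm z (r *\<^sub>R u + s *\<^sub>R v)
    = r *\<^sub>R shifted_schroedinger Vp Vm z u + s *\<^sub>R shifted_schroedinger Vp Vm z v"
proof -
  obtain f f' f'' where f: "square_integrable f" "square_integrable f'" "square_integrable f''" "u = abs_L2 f"
    "has_weak_derivative (abs_L2 f) (abs_L2 f')" "has_weak_derivative (abs_L2 f') (abs_L2 f'')"
    by (rule H2_obtain[OF assms(1)])
  obtain g g' g'' where g: "square_integrable g" "square_integrable g'" "square_integrable g''" "v = abs_L2 g"
    "has_weak_derivative (abs_L2 g) (abs_L2 g')" "has_weak_derivative (abs_L2 g') (abs_L2 g'')"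
    by (rule H2_obtain[OF assms(2)])
  let ?V = "step_potential (Vp - z) (Vm - z)"
  have d1: "has_weak_derivative (abs_L2 (\<lambda>x. r *\<^sub>R f x + s *\<^sub>R g x)) (abs_L2 (\<lambda>x. r *\<^sub>R f' x + s *\<^sub>R g' x))"
    using has_weak_derivative_lincomb[OF f(5) g(5), of r s] f g by (simp only: abs_L2_lincomb)
  have d2: "has_weak_derivative (abs_L2 (\<lambda>x. r *\<^sub>R f' x + s *\<^sub>R g' x)) (abs_L2 (\<lambda>x. r *\<^sub>R f'' x + s *\<^sub>R g'' x))"
    using has_weak_derivative_lincomb[OF f(6) g(6), of r s] f g by (simp only: abs_L2_lincomb)
  have sf: "square_integrable (\<lambda>x. ?V x * f x - f'' x)" and sg: "square_integrable (\<lambda>x. ?V x * g x - g'' x)"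
    using f g by (auto intro!: square_integrable_diff square_integrable_step_potential)
  have "shifted_schroedinger Vp Vm z (abs_L2 (\<lambda>x. r *\<^sub>R f x + s *\<^sub>R g x))
      = abs_L2 (\<lambda>x. ?V x * (r *\<^sub>R f x + s *\<^sub>R g x) - (r *\<^sub>R f'' x + s *\<^sub>R g'' x))"
    by (rule shifted_schroedinger_abs[OF square_integrable_lincomb[OF f(1) g(1)] square_integrable_lincomb[OF f(2) g(2)]
        square_integrable_lincomb[OF f(3) g(3)] d1 d2])
  also have "(\<lambda>x. ?V x * (r *\<^sub>R f x + s *\<^sub>R g x) - (r *\<^sub>R f'' x + s *\<^sub>R g'' x))
      = (\<lambda>x. r *\<^sub>R (?V x * f x - f'' x) + s *\<^sub>R (?V x * g x - g'' x))"
    by (intro ext) (simp add: scaleR_conv_of_real algebra_simps)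
  also have "abs_L2 \<dots> = r *\<^sub>R abs_L2 (\<lambda>x. ?V x * f x - f'' x) + s *\<^sub>R abs_L2 (\<lambda>x. ?V x * g x - g'' x)"
    by (rule abs_L2_lincomb[OF sf sg, symmetric])
  finally show ?thesis
    unfolding f(4) g(4) abs_L2_lincomb[OF f(1) g(1)]
    by (simp only: shifted_schroedinger_abs[OF f(1-3,5,6)] shifted_schroedinger_abs[OF g(1-3,5,6)])
qed

definition Green_operator :: "complex \<Rightarrow> complex \<Rightarrow> L2 \<Rightarrow> L2" where
  "Green_operator kp km u = abs_L2 (transmission_solution kp km (rep_L2 u))"

text \<open>
The norm of the rank-one operator \<open>f \<mapsto> (\<integral> \<phi> f) / (kp + km) \<cdot> \<phi>\<close>, where \<open>\<phi>\<close> is \<open>mode kp km\<close>.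
\<close>
definition mode_gain :: "complex \<Rightarrow> complex \<Rightarrow> real" where
  "mode_gain kp km = (1 / (2 * Re kp) + 1 / (2 * Re km)) / cmod (kp + km)"

text \<open>
The bound for the two Dirichlet resolvents obtained from \<open>Dirichlet_bound\<close>.
\<close>
definition Dirichlet_gain :: "complex \<Rightarrow> complex \<Rightarrow> real" where
  "Dirichlet_gain kp km = 5 / (4 * cmod kp * Re kp) + 5 / (4 * cmod km * Re km)"

context
  fixes kp km Vp Vm z :: complex
  assumes kp: "0 < Re kp" and km: "0 < Re km" and kp2: "kp\<^sup>2 = Vp - z" and km2: "km\<^sup>2 = Vm - z"
begin

lemma Green_operator_in_H2: "Green_operator kp km u \<in> H2"
  and Green_operator_right_inverse: "shifted_schroedinger Vp Vm z (Green_operator kp km u) = u"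
proof -
  obtain f where f: "square_integrable f" "u = abs_L2 f" "f = rep_L2 u" by (rule L2_obtain_rep)
  let ?u = "transmission_solution kp km f" and ?u' = "transmission_solution_deriv kp km f"
  let ?u'' = "\<lambda>x. step_potential (kp\<^sup>2) (km\<^sup>2) x * ?u x - f x"
  note si = transmission_square_integrable[OF kp km f(1)] transmission_source_square_integrable[OF kp km f(1)]
  have d1: "has_weak_derivative (abs_L2 ?u) (abs_L2 ?u')"
    by (rule has_weak_derivative_primitive[OF si(1,2) transmission_primitives(1)[OF kp km f(1)]])
  have d2: "has_weak_derivative (abs_L2 ?u') (abs_L2 ?u'')"
    by (rule has_weak_derivative_primitive[OF si(2,3) transmission_primitives(2)[OF kp km f(1)]])
  have G: "Green_operator kp km u = abs_L2 ?u"
    by (simp add: Green_operator_def f(3))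
  show "Green_operator kp km u \<in> H2"
    unfolding G H2_def using d1 d2 by blast
  have "shifted_schroedinger Vp Vm z (abs_L2 ?u) = abs_L2 (\<lambda>x. step_potential (Vp - z) (Vm - z) x * ?u x - ?u'' x)"
    by (rule shifted_schroedinger_abs[OF si d1 d2])
  also have "(\<lambda>x. step_potential (Vp - z) (Vm - z) x * ?u x - ?u'' x) = f"
    by (simp add: kp2 km2)
  finally show "shifted_schroedinger Vp Vm z (Green_operator kp km u) = u"
    by (simp only: G f(2)[symmetric])
qed

lemma shifted_schroedinger_kernel:
  assumes "u \<in> H2" "shifted_schroedinger Vp Vm z u = 0"
  shows "u = 0"
proof -
  obtain f g h where f: "square_integrable f" "square_integrable g" "square_integrable h" "u = abs_L2 f"
    "has_weak_derivative (abs_L2 f) (abs_L2 g)" "has_weak_derivative (abs_L2 g) (abs_L2 h)"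
    by (rule H2_obtain[OF assms(1)])
  have si: "square_integrable (\<lambda>x. step_potential (Vp - z) (Vm - z) x * f x - h x)"
    using f by (auto intro!: square_integrable_diff square_integrable_step_potential)
  have "abs_L2 (\<lambda>x. step_potential (Vp - z) (Vm - z) x * f x - h x) = abs_L2 (\<lambda>x. 0)"
    using assms(2) shifted_schroedinger_abs[OF f(1-3,5,6), of Vp Vm z] by (simp add: f(4) zero_L2_def)
  then have "AE x in lborel. step_potential (Vp - z) (Vm - z) x * f x - h x = 0"
    by (simp add: abs_L2_eq_iff[OF si square_integrable_zero])
  then have "AE x in lborel. h x = step_potential (kp\<^sup>2) (km\<^sup>2) x * f x"
    by (rule eventually_mono) (simp add: kp2 km2)
  then have "AE x in lborel. f x = 0"
    using f(5,6) by (intro homogeneous_solution_zero[OF kp km f(1-3)])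
      (simp_all add: has_weak_derivative_abs[OF f(1,2)] has_weak_derivative_abs[OF f(2,3)])
  then show ?thesis
    using abs_L2_eq_iff[OF f(1) square_integrable_zero] by (simp add: f(4) zero_L2_def)
qed

lemma shifted_schroedinger_inj:
  assumes "u \<in> H2" "v \<in> H2" "shifted_schroedinger Vp Vm z u = shifted_schroedinger Vp Vm z v"
  shows "u = v"
proof -
  have "1 *\<^sub>R u + (- 1) *\<^sub>R v = 0"
    by (rule shifted_schroedinger_kernel[OF H2_lincomb[OF assms(1,2)]])
      (simp only: shifted_schroedinger_lincomb[OF assms(1,2)] assms(3), simp)
  then show ?thesis by simp
qed

lemma Green_operator_lincomb:
  "Green_operator kp km (r *\<^sub>R u + s *\<^sub>R v) = r *\<^sub>R Green_operator kp km u + s *\<^sub>R Green_operator kp km v"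
  by (rule shifted_schroedinger_inj)
    (simp_all only: Green_operator_in_H2 H2_lincomb Green_operator_right_inverse shifted_schroedinger_lincomb)

lemma resolvent_eq_Green_operator:
  "resolvent H2 (step_schroedinger Vp Vm) z = Green_operator kp km"
proof
  fix u
  show "resolvent H2 (step_schroedinger Vp Vm) z u = Green_operator kp km u"
    unfolding resolvent_def
    by (rule inv_into_f_eq)
      (auto simp: inj_on_def Green_operator_in_H2 Green_operator_right_inverse intro: shifted_schroedinger_inj)
qed

lemma Green_operator_upper:
  "norm (Green_operator kp km u) \<le> (mode_gain kp km + Dirichlet_gain kp km) * norm u"
proof -
  obtain f where f: "square_integrable f" "u = abs_L2 f" "f = rep_L2 u" by (rule L2_obtain_rep)
  let ?c = "matching_value kp km f"
  note m = mode_square_integrable[OF kp km]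
  note D = Dirichlet_solution_bound[OF kp km f(1)]
  have "transmission_solution kp km f = (\<lambda>x. ?c * mode kp km x + Dirichlet_solution kp km f x)"
    using transmission_split[OF kp km f(1)] by (intro ext)
  then have "l2norm (transmission_solution kp km f) \<le> cmod ?c * l2norm (mode kp km) + l2norm (Dirichlet_solution kp km f)"
    using l2norm_add[OF square_integrable_cmult[OF m(1), of ?c] D(1)] by (simp add: l2norm_cmult)
  also have "cmod ?c * l2norm (mode kp km) \<le> mode_gain kp km * l2norm f"
  proof -
    have "cmod ?c \<le> l2norm (mode kp km) * l2norm f / cmod (kp + km)"
      using integrable_mult_square_integrable(2)[OF m(1) f(1)]
      by (simp add: matching_value_def norm_divide divide_right_mono)
    then have "cmod ?c * l2norm (mode kp km) \<le> l2norm (mode kp km) * l2norm f / cmod (kp + km) * l2norm (mode kp km)"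
      by (rule mult_right_mono) (rule l2norm_nonneg)
    also have "\<dots> = (l2norm (mode kp km))\<^sup>2 / cmod (kp + km) * l2norm f"
      by (simp add: power2_eq_square)
    finally show ?thesis
      by (simp only: m(2) mode_gain_def)
  qed
  also have "l2norm (Dirichlet_solution kp km f) \<le> Dirichlet_gain kp km * l2norm f"
    using D(2) by (simp only: Dirichlet_gain_def)
  finally have "l2norm (transmission_solution kp km f) \<le> (mode_gain kp km + Dirichlet_gain kp km) * l2norm f"
    by (simp add: distrib_right)
  then show ?thesis
    using norm_abs_L2[OF f(1)] norm_abs_L2[OF transmission_square_integrable(1)[OF kp km f(1)]]
    by (simp add: Green_operator_def f(2) flip: f(3)) (simp add: f(2)[symmetric] flip: f(3))
qed

text \<open>
The complex conjugate of the mode maximises the rank-one part, by equality in the Cauchy-Schwarz inequality.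
\<close>
lemma Green_operator_lower:
  obtains u where "u \<noteq> 0" "(mode_gain kp km - Dirichlet_gain kp km) * norm u \<le> norm (Green_operator kp km u)"
proof -
  note m = mode_square_integrable[OF kp km]
  let ?g = "\<lambda>x. cnj (mode kp km x)"
  have [measurable]: "mode kp km \<in> borel_measurable borel" by (rule square_integrableD(1)[OF m(1)])
  have meas: "?g \<in> borel_measurable borel"
    by (rule measurable_compose[OF square_integrableD(1)[OF m(1)] borel_measurable_continuous_onI])
      (intro continuous_intros)
  have g: "square_integrable ?g" by (rule square_integrable_bound(1)[OF m(1) meas]) simp
  have ng: "l2norm ?g = l2norm (mode kp km)" by (rule l2norm_cong_norm) simp
  have pos: "0 < l2norm (mode kp km)"
  proof -
    have "0 < (l2norm (mode kp km))\<^sup>2" unfolding m(2) using kp km by (intro add_pos_pos) auto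
    then show ?thesis using l2norm_nonneg[of "mode kp km"] by (simp add: zero_less_power2)
  qed
  define u where "u = abs_L2 ?g"
  obtain f where f: "square_integrable f" "u = abs_L2 f" "f = rep_L2 u" by (rule L2_obtain_rep)
  have fg: "AE x in lborel. f x = ?g x"
    using f(2) abs_L2_eq_iff[OF f(1) g] by (simp add: u_def)
  have nu: "norm u = l2norm (mode kp km)"
    using norm_abs_L2[OF g] ng by (simp add: u_def)
  have nf: "l2norm f = l2norm (mode kp km)"
    using norm_abs_L2[OF f(1)] nu f(2) by simp
  have [measurable]: "f \<in> borel_measurable borel" by (rule square_integrableD(1)[OF f(1)])
  let ?c = "matching_value kp km f"
  note D = Dirichlet_solution_bound[OF kp km f(1)]
  note T = transmission_square_integrable(1)[OF kp km f(1)]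
  have "(LINT x|lborel. mode kp km x * f x) = (LINT x|lborel. complex_of_real ((cmod (mode kp km x))\<^sup>2))"
  proof (rule integral_cong_AE)
    show "AE x in lborel. mode kp km x * f x = complex_of_real ((cmod (mode kp km x))\<^sup>2)"
      using fg by (rule eventually_mono) (simp only: complex_norm_square)
  qed simp_all
  also have "\<dots> = complex_of_real ((l2norm (mode kp km))\<^sup>2)"
    by (simp only: integral_complex_of_real l2norm_power2)
  finally have "cmod ?c = (l2norm (mode kp km))\<^sup>2 / cmod (kp + km)"
    by (simp add: matching_value_def norm_divide norm_power l2norm_nonneg)
  then have c: "cmod ?c = mode_gain kp km"
    by (simp only: m(2) mode_gain_def)
  have "(\<lambda>x. ?c * mode kp km x) = (\<lambda>x. transmission_solution kp km f x + (- 1) * Dirichlet_solution kp km f x)"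
    using transmission_split[OF kp km f(1)] by (intro ext) simp
  then have "l2norm (\<lambda>x. ?c * mode kp km x) \<le> l2norm (transmission_solution kp km f) + l2norm (\<lambda>x. (- 1) * Dirichlet_solution kp km f x)"
    using l2norm_add[OF T square_integrable_cmult[OF D(1), of "- 1"]] by simp
  then have "mode_gain kp km * l2norm (mode kp km) \<le> l2norm (transmission_solution kp km f) + l2norm (Dirichlet_solution kp km f)"
    by (simp only: l2norm_cmult c norm_minus_cancel norm_one mult_1)
  then have "mode_gain kp km * norm u \<le> l2norm (transmission_solution kp km f) + Dirichlet_gain kp km * norm u"
    using D(2) by (simp add: Dirichlet_gain_def nu nf)
  moreover have "norm (Green_operator kp km u) = l2norm (transmission_solution kp km f)"
    using norm_abs_L2[OF T] by (simp add: Green_operator_def flip: f(3))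
  moreover have "u \<noteq> 0" using pos nu by auto
  ultimately show thesis
    by (intro that[of u]) (simp_all add: algebra_simps)
qed

lemma resolvent_bounded_linear: "bounded_linear (resolvent H2 (step_schroedinger Vp Vm) z)"
  unfolding resolvent_eq_Green_operator
proof (rule bounded_linear_intro)
  show "Green_operator kp km (u + v) = Green_operator kp km u + Green_operator kp km v" for u v
    using Green_operator_lincomb[of 1 u 1 v] by simp
  show "Green_operator kp km (r *\<^sub>R u) = r *\<^sub>R Green_operator kp km u" for r u
    using Green_operator_lincomb[of r u 0 u] by simp
  show "norm (Green_operator kp km u) \<le> norm u * (mode_gain kp km + Dirichlet_gain kp km)" for u
    using Green_operator_upper[of u] by (simp add: mult.commute)
qed

lemma in_resolvent_set: "z \<in> resolvent_set H2 (step_schroedinger Vp Vm)"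
proof -
  have "bij_betw (shifted_schroedinger Vp Vm z) H2 UNIV"
    unfolding bij_betw_def
  proof
    show "inj_on (shifted_schroedinger Vp Vm z) H2"
      by (rule inj_onI) (rule shifted_schroedinger_inj)
    show "shifted_schroedinger Vp Vm z ` H2 = UNIV"
    proof (intro set_eqI iffI UNIV_I)
      fix u
      show "u \<in> shifted_schroedinger Vp Vm z ` H2"
        by (rule image_eqI[where x = "Green_operator kp km u"])
          (simp_all only: Green_operator_in_H2 Green_operator_right_inverse)
    qed
  qed
  then show ?thesis
    using resolvent_bounded_linear by (simp add: resolvent_set_def)
qed

lemma resolvent_norm_approx:
  "\<bar>onorm (resolvent H2 (step_schroedinger Vp Vm) z) - mode_gain kp km\<bar> \<le> Dirichlet_gain kp km"
proof -
  have up: "onorm (Green_operator kp km) \<le> mode_gain kp km + Dirichlet_gain kp km"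
  proof (rule onorm_bound)
    show "0 \<le> mode_gain kp km + Dirichlet_gain kp km"
      using kp km by (simp add: mode_gain_def Dirichlet_gain_def)
  qed (rule Green_operator_upper)
  obtain u where u: "u \<noteq> 0" "(mode_gain kp km - Dirichlet_gain kp km) * norm u \<le> norm (Green_operator kp km u)"
    by (rule Green_operator_lower)
  have "norm (Green_operator kp km u) \<le> onorm (Green_operator kp km) * norm u"
    using onorm[OF resolvent_bounded_linear, of u] by (simp only: resolvent_eq_Green_operator)
  then have "(mode_gain kp km - Dirichlet_gain kp km) * norm u \<le> onorm (Green_operator kp km) * norm u"
    using u(2) by linarith
  then have "mode_gain kp km - Dirichlet_gain kp km \<le> onorm (Green_operator kp km)"
    using u(1) by simp
  then show ?thesis
    using up by (simp add: resolvent_eq_Green_operator abs_le_iff)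
qed

end

section \<open>High-energy asymptotics\<close>

lemma csqrt_decay_rate:
  assumes "Im w \<noteq> 0"
  shows "0 < Re (csqrt w)" "2 * Re (csqrt w) * Im (csqrt w) = Im w"
    "(Im (csqrt w))\<^sup>2 = (Re (csqrt w))\<^sup>2 - Re w"
proof -
  have "Re ((csqrt w)\<^sup>2) = Re w" "Im ((csqrt w)\<^sup>2) = Im w" by simp_all
  then have eq: "(Re (csqrt w))\<^sup>2 - (Im (csqrt w))\<^sup>2 = Re w" "2 * Re (csqrt w) * Im (csqrt w) = Im w"
    by (simp_all only: Re_power2 Im_power2)
  have "Re (csqrt w) \<noteq> 0" using eq(2) assms by auto
  then show "0 < Re (csqrt w)"
    using csqrt_principal[of w] by (auto simp: order_le_less)
  show "2 * Re (csqrt w) * Im (csqrt w) = Im w" by (rule eq(2))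
  show "(Im (csqrt w))\<^sup>2 = (Re (csqrt w))\<^sup>2 - Re w" using eq(1) by simp
qed

text \<open>
From \<open>(Im k)\<^sup>2 = Re z - Re V + (Re k)\<^sup>2\<close> and \<open>2 Re k Im k = Im V - Im z\<close>: the second identity makes \<open>Re k\<close> of order
\<open>1 / sqrt (Re z)\<close>, and then the first one forces \<open>\<bar>Im k\<bar>\<close> to differ from \<open>sqrt (Re z)\<close> by the same order only.
\<close>
lemma csqrt_high_energy:
  fixes V z :: complex
  assumes "Im V \<noteq> Im z" "\<bar>Im V - Im z\<bar> \<le> D" "\<bar>Re V\<bar> \<le> B" "1 \<le> Re z" "2 * B \<le> Re z"
  defines "k \<equiv> csqrt (V - z)" and "R \<equiv> sqrt (Re z)"
  shows "Re k \<le> (B + D + D\<^sup>2) / R" "\<bar>\<bar>Im k\<bar> - R\<bar> \<le> (B + D + D\<^sup>2) / R"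
proof -
  have B: "0 \<le> B" and D: "0 \<le> D" using assms(2,3) by linarith+
  have R: "1 \<le> R" "R * R = Re z" using assms(4) by (auto simp: R_def)
  note k = csqrt_decay_rate[of "V - z", folded k_def]
  have k1: "0 < Re k" "2 * Re k * Im k = Im V - Im z" "(Im k)\<^sup>2 = (Re k)\<^sup>2 + (Re z - Re V)"
    using k assms(1) by auto
  define b where "b = \<bar>Im k\<bar>"
  have b: "0 \<le> b" "b * b = Re k * Re k + (Re z - Re V)"
    using k1(3) by (auto simp: b_def power2_eq_square)
  have prod: "2 * Re k * b \<le> D"
  proof -
    have "\<bar>2 * Re k * Im k\<bar> = 2 * Re k * b" using k1(1) by (simp add: b_def abs_mult)
    then show ?thesis using k1(2) assms(2) by simp
  qed
  have half: "R / 2 \<le> b"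
  proof (rule power2_le_imp_le)
    have "(R / 2)\<^sup>2 = Re z / 4" using R(2) by (simp add: power2_eq_square)
    also have "\<dots> \<le> Re z - Re V" using assms(3,4,5) by linarith
    also have "\<dots> \<le> b\<^sup>2" using b(2) by (simp add: power2_eq_square)
    finally show "(R / 2)\<^sup>2 \<le> b\<^sup>2" .
  qed (rule b(1))
  have "Re k * R \<le> 2 * Re k * b"
    using half k1(1) by (simp add: mult.commute mult.left_commute)
  then have "Re k * R \<le> D" using prod by linarith
  then have kD: "Re k \<le> D / R" using R(1) by (simp add: pos_le_divide_eq)
  show "Re k \<le> (B + D + D\<^sup>2) / R"
    by (rule order_trans[OF kD]) (use B R(1) in \<open>auto intro!: divide_right_mono\<close>)
  have "\<bar>b - R\<bar> * R \<le> \<bar>b - R\<bar> * (b + R)"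
    using b(1) by (intro mult_left_mono) auto
  also have "\<dots> = \<bar>(b - R) * (b + R)\<bar>"
    using b(1) R(1) by (simp add: abs_mult)
  also have "(b - R) * (b + R) = Re k * Re k - Re V"
    using b(2) R(2) by (simp add: algebra_simps)
  also have "\<bar>Re k * Re k - Re V\<bar> \<le> Re k * Re k + B"
    using assms(3) by (smt (verit) zero_le_square)
  also have "Re k * Re k \<le> D * D"
  proof -
    have "D / R \<le> D / 1" using D R(1) by (intro divide_left_mono) auto
    then have "D / R \<le> D" by simp
    then show ?thesis using kD k1(1) D by (intro mult_mono) auto
  qed
  finally have "\<bar>b - R\<bar> * R \<le> B + D + D\<^sup>2" using D by (simp add: power2_eq_square)
  then show "\<bar>\<bar>Im k\<bar> - R\<bar> \<le> (B + D + D\<^sup>2) / R"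
    using R(1) by (simp add: b_def pos_le_divide_eq)
qed

text \<open>
The identity \<open>1 / (2 Re k) = \<bar>Im k\<bar> / \<delta>\<close> turns \<open>mode_gain\<close> into \<open>L\<close> times two factors close to 1: the normalised
distance \<open>X\<close> of the two roots and a weighted mean \<open>Y\<close> of their imaginary parts. The distances \<open>\<delta>\<close> to the boundary of the
strip enter \<open>Y\<close> only as weights, which is why the estimate is uniform.
\<close>
lemma gain_asymptotics:
  fixes kp km :: complex and dp dm r E w :: real
  assumes alpha: "0 < Re kp" "0 < Re km"
    and prod: "2 * Re kp * \<bar>Im kp\<bar> = dp" "2 * Re km * \<bar>Im km\<bar> = dm" "0 < dp" "0 < dm"
    and opp: "Im kp * Im km < 0"
    and w: "cmod (kp\<^sup>2 - km\<^sup>2) = w"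
    and E: "1 \<le> r" "E \<le> r"
    and close: "Re kp \<le> E / sqrt r" "Re km \<le> E / sqrt r"
      "\<bar>\<bar>Im kp\<bar> - sqrt r\<bar> \<le> E / sqrt r" "\<bar>\<bar>Im km\<bar> - sqrt r\<bar> \<le> E / sqrt r"
  defines "L \<equiv> 2 * (dp + dm) / w * (r / (dp * dm))"
  shows "0 < L" "\<bar>mode_gain kp km / L - 1\<bar> \<le> 5 * (E / r)" "Dirichlet_gain kp km / L \<le> 5 / 4 * w / r"
proof -
  define R where "R = sqrt r"
  have R: "0 < R" "R * R = r" "1 \<le> R" using E by (auto simp: R_def)
  have r0: "0 < r" using E by simp
  define e where "e = E / r"
  have eR: "E / sqrt r = e * R" using R E(1) by (simp add: e_def R_def[symmetric] flip: R(2))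
  have e: "e \<le> 1" using E by (simp add: e_def)
  have e0: "0 < e"
    using alpha(1) close(1) R(1) by (metis eR less_le_trans mult_pos_pos not_less zero_less_mult_pos2)
  define a b where "a = \<bar>Im kp\<bar>" and "b = \<bar>Im km\<bar>"
  have a: "\<bar>a - R\<bar> \<le> e * R" and b: "\<bar>b - R\<bar> \<le> e * R"
    using close(3,4) unfolding eR by (simp_all add: a_def b_def R_def)
  have re: "Re kp \<le> e * R" "Re km \<le> e * R" using close(1,2) unfolding eR .
  have ab: "0 < a" "0 < b" using opp by (auto simp: a_def b_def)
  define K where "K = cmod (kp - km)"
  have ksum: "\<bar>Im kp - Im km\<bar> = a + b"
    using opp by (auto simp: a_def b_def mult_less_0_iff)
  have Klow: "a + b \<le> K"
    using abs_Im_le_cmod[of "kp - km"] ksum by (simp add: K_def)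
  have Kup: "K \<le> e * R + (a + b)"
  proof -
    have "K \<le> \<bar>Re (kp - km)\<bar> + \<bar>Im (kp - km)\<bar>" unfolding K_def by (rule cmod_le)
    also have "\<bar>Re (kp - km)\<bar> \<le> e * R" using re alpha by (simp add: abs_le_iff)
    finally show ?thesis using ksum by simp
  qed
  have K0: "0 < K" using Klow ab by linarith
  \<comment> \<open>The difference of squares trades the small sum \<open>kp + km\<close> for the large difference.\<close>
  have sum: "cmod (kp + km) * K = w"
    unfolding K_def w[symmetric] norm_mult[symmetric] by (simp add: power2_eq_square algebra_simps)
  have sum0: "0 < cmod (kp + km)"
    using alpha by (metis add_pos_pos less_irrefl plus_complex.simps(1) zero_complex.simps(1) zero_less_norm_iff)
  then have w0: "0 < w" using sum K0 by (metis mult_pos_pos)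
  show L0: "0 < L" using prod(3,4) w0 r0 by (simp add: L_def)
  have inv: "1 / (2 * Re kp) = a / dp" "1 / (2 * Re km) = b / dm"
    using prod ab alpha by (auto simp: a_def b_def field_simps)
  define X Y where "X = K / (2 * R)" and "Y = (a * dm + b * dp) / ((dp + dm) * R)"
  have "mode_gain kp km = (a / dp + b / dm) * K / w"
    unfolding mode_gain_def inv using sum K0 sum0 by (simp add: field_simps flip: sum)
  also have "\<dots> = X * Y * L"
  proof -
    have "(a / dp + b / dm) * K / w = K / (2 * R) * ((a * dm + b * dp) / (S * R)) * (2 * S / w * (R * R / (dp * dm)))"
      if "0 < S" for S
      using prod(3,4) w0 R(1) that by (simp add: field_simps)
    then show ?thesis
      using prod(3,4) unfolding X_def Y_def L_def R(2)[symmetric] by simp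
  qed
  finally have "mode_gain kp km / L = X * Y" using L0 by simp
  moreover have "\<bar>X * Y - 1\<bar> \<le> 5 * e"
  proof -
    have "R - e * R \<le> a" "R - e * R \<le> b" "a \<le> R + e * R" "b \<le> R + e * R" using a b by linarith+
    then have "(1 - e) * (2 * R) \<le> K" "K \<le> (1 + 2 * e) * (2 * R)"
      using Klow Kup e0 R(1) by (simp_all add: algebra_simps)
    then have X: "1 - e \<le> X" "X \<le> 1 + 2 * e"
      using R(1) by (simp_all add: X_def pos_le_divide_eq pos_divide_le_eq)
    have "(R - e * R) * dm \<le> a * dm" "(R - e * R) * dp \<le> b * dp" "a * dm \<le> (R + e * R) * dm" "b * dp \<le> (R + e * R) * dp"
      using \<open>R - e * R \<le> a\<close> \<open>R - e * R \<le> b\<close> \<open>a \<le> R + e * R\<close> \<open>b \<le> R + e * R\<close> prod(3,4)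
      by (simp_all only: mult_right_mono less_imp_le)
    then have "(1 - e) * ((dp + dm) * R) \<le> a * dm + b * dp" "a * dm + b * dp \<le> (1 + e) * ((dp + dm) * R)"
      by (simp_all add: algebra_simps)
    then have Y: "1 - e \<le> Y" "Y \<le> 1 + e"
      using R(1) prod(3,4) by (simp_all add: Y_def pos_le_divide_eq pos_divide_le_eq)
    have "\<bar>X * Y - 1\<bar> = \<bar>(X - 1) * Y + (Y - 1)\<bar>" by (simp add: algebra_simps)
    also have "\<dots> \<le> \<bar>X - 1\<bar> * \<bar>Y\<bar> + \<bar>Y - 1\<bar>"
      using abs_triangle_ineq[of "(X - 1) * Y" "Y - 1"] by (simp add: abs_mult)
    also have "\<dots> \<le> (2 * e) * 2 + e"
      using X Y e e0 by (intro add_mono mult_mono) auto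
    finally show ?thesis by simp
  qed
  ultimately show "\<bar>mode_gain kp km / L - 1\<bar> \<le> 5 * (E / r)" by (simp add: e_def)
  have bound: "5 / (4 * cmod k * Re k) \<le> 5 / (2 * d)" if "0 < Re k" "2 * Re k * \<bar>Im k\<bar> = d" "0 < d" for k d
  proof -
    have "2 * d = 4 * \<bar>Im k\<bar> * Re k" using that(2) by simp
    also have "\<dots> \<le> 4 * cmod k * Re k"
      using abs_Im_le_cmod[of k] that(1) by (intro mult_right_mono) auto
    finally show ?thesis using that(3) by (intro divide_left_mono) (auto intro!: mult_pos_pos)
  qed
  have "Dirichlet_gain kp km \<le> 5 / (2 * dp) + 5 / (2 * dm)"
    unfolding Dirichlet_gain_def
    by (intro add_mono bound alpha prod)
  also have "\<dots> = 5 / 4 * w / r * L"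
    using prod(3,4) w0 r0 by (simp add: L_def field_simps)
  finally show "Dirichlet_gain kp km / L \<le> 5 / 4 * w / r"
    using L0 by (simp add: pos_divide_le_eq)
qed

theorem theorem2p7:
  fixes Vp Vm :: complex
  assumes "Im Vp \<noteq> Im Vm"
  shows "\<exists>M>0. \<exists>C>0. \<forall>z::complex.
           Re z \<ge> M \<and> Im z \<in> {min (Im Vp) (Im Vm)<..<max (Im Vp) (Im Vm)} \<longrightarrow>
             z \<in> resolvent_set H2 (step_schroedinger Vp Vm) \<and>
             \<bar>onorm (resolvent H2 (step_schroedinger Vp Vm) z) /
                (2 * \<bar>Im Vp - Im Vm\<bar> / cmod (Vp - Vm) *
                  (Re z / (\<bar>Im Vp - Im z\<bar> * \<bar>Im Vm - Im z\<bar>))) - 1\<bar>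
               \<le> C / \<bar>Re z\<bar>"
proof -
  define B where "B = \<bar>Re Vp\<bar> + \<bar>Re Vm\<bar>"
  define D where "D = \<bar>Im Vp - Im Vm\<bar>"
  \<comment> \<open>The constant of \<open>csqrt_high_energy\<close>, common to both half-lines.\<close>
  define E where "E = B + D + D\<^sup>2"
  define w where "w = cmod (Vp - Vm)"
  have B: "0 \<le> B" "\<bar>Re Vp\<bar> \<le> B" "\<bar>Re Vm\<bar> \<le> B" and D: "0 < D"
    using assms by (auto simp: B_def D_def)
  have E: "0 < E" unfolding E_def using B D by (intro add_nonneg_pos add_nonneg_nonneg) auto
  have w: "0 < w" using assms by (auto simp: w_def)
  have main: "z \<in> resolvent_set H2 (step_schroedinger Vp Vm) \<and>
      \<bar>onorm (resolvent H2 (step_schroedinger Vp Vm) z) /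
        (2 * \<bar>Im Vp - Im Vm\<bar> / cmod (Vp - Vm) *
          (Re z / (\<bar>Im Vp - Im z\<bar> * \<bar>Im Vm - Im z\<bar>))) - 1\<bar> \<le> (5 * E + 5 / 4 * w) / \<bar>Re z\<bar>"
    if z: "1 + 2 * B + E \<le> Re z" "Im z \<in> {min (Im Vp) (Im Vm)<..<max (Im Vp) (Im Vm)}" for z
  proof -
    define r where "r = Re z"
    have r: "1 \<le> r" "2 * B \<le> r" "E \<le> r" "0 < r" using z(1) B E by (auto simp: r_def)
    define dp dm where "dp = \<bar>Im Vp - Im z\<bar>" and "dm = \<bar>Im Vm - Im z\<bar>"
    have d: "0 < dp" "0 < dm" "dp + dm = D" and ne: "Im Vp \<noteq> Im z" "Im Vm \<noteq> Im z"
      and opp: "(Im Vp - Im z) * (Im Vm - Im z) < 0"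
      using z(2) by (auto simp: dp_def dm_def D_def mult_less_0_iff min_def max_def split: if_splits)
    define kp km where "kp = csqrt (Vp - z)" and "km = csqrt (Vm - z)"
    have kp: "0 < Re kp" "2 * Re kp * Im kp = Im Vp - Im z" "kp\<^sup>2 = Vp - z"
      using csqrt_decay_rate[of "Vp - z"] ne by (simp_all add: kp_def)
    have km: "0 < Re km" "2 * Re km * Im km = Im Vm - Im z" "km\<^sup>2 = Vm - z"
      using csqrt_decay_rate[of "Vm - z"] ne by (simp_all add: km_def)
    have prod: "2 * Re kp * \<bar>Im kp\<bar> = dp" "2 * Re km * \<bar>Im km\<bar> = dm"
      using kp(1,2) km(1,2) unfolding dp_def dm_def by (metis abs_mult abs_numeral abs_of_pos)+
    have "(2 * Re kp * Im kp) * (2 * Re km * Im km) < 0"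
      using opp by (simp only: kp(2) km(2))
    then have opp': "Im kp * Im km < 0"
      using kp(1) km(1) by (simp add: mult_less_0_iff zero_less_mult_iff)
    have close: "Re kp \<le> E / sqrt r" "\<bar>\<bar>Im kp\<bar> - sqrt r\<bar> \<le> E / sqrt r"
      "Re km \<le> E / sqrt r" "\<bar>\<bar>Im km\<bar> - sqrt r\<bar> \<le> E / sqrt r"
      using csqrt_high_energy[of Vp z D B] csqrt_high_energy[of Vm z D B] ne B r d
      by (simp_all add: kp_def km_def E_def r_def dp_def dm_def)
    have "kp\<^sup>2 - km\<^sup>2 = Vp - Vm" by (simp add: kp(3) km(3))
    then have "cmod (kp\<^sup>2 - km\<^sup>2) = w" by (simp add: w_def)
    note gain = gain_asymptotics[OF kp(1) km(1) prod d(1,2) opp' this r(1,3) close(1,3,2,4)]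
    let ?N = "onorm (resolvent H2 (step_schroedinger Vp Vm) z)"
    let ?L = "2 * (dp + dm) / w * (r / (dp * dm))"
    have "x / y - 1 = (x - g) / y + (g / y - 1)" for x g y :: real
      by (simp add: diff_divide_distrib)
    then have "?N / ?L - 1 = (?N - mode_gain kp km) / ?L + (mode_gain kp km / ?L - 1)" .
    then have "\<bar>?N / ?L - 1\<bar> \<le> \<bar>?N - mode_gain kp km\<bar> / ?L + \<bar>mode_gain kp km / ?L - 1\<bar>"
      using abs_triangle_ineq[of "(?N - mode_gain kp km) / ?L"] gain(1)
      by (simp only: abs_divide abs_of_pos)
    also have "\<dots> \<le> Dirichlet_gain kp km / ?L + 5 * (E / r)"
      using resolvent_norm_approx[OF kp(1) km(1) kp(3) km(3)] gain(1,2)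
      by (intro add_mono divide_right_mono) auto
    also have "\<dots> \<le> 5 / 4 * w / r + 5 * (E / r)"
      using gain(3) by simp
    also have "\<dots> = (5 * E + 5 / 4 * w) / \<bar>r\<bar>"
      using r(4) by (simp add: add_divide_distrib)
    finally show ?thesis
      using in_resolvent_set[OF kp(1) km(1) kp(3) km(3)]
      unfolding d(3) unfolding D_def w_def r_def dp_def dm_def by blast
  qed
  show ?thesis
  proof (intro exI conjI allI impI)
    show "0 < 1 + 2 * B + E" using B E by linarith
    show "0 < 5 * E + 5 / 4 * w" using E w by linarith
  qed (use main in blast)+
qed

end
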